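(* Let $H$ be a Hilbert space, let $\alpha>0$, and let $t\mapsto A(t)$, $t\in\mathbb{R}$, be a $C^{1,\alpha}$ curve of unbounded self-adjoint operators in $H$ with common domain of definition $V$ and with compact resolvent. Then the eigenvalues of $A(t)$ may be parameterized in a $C^1$ way in $t$; that is, there is a sequence of $C^1$ functions $\lambda_i:\mathbb{R}\to\mathbb{R}$ which parameterizes the eigenvalues of $A(t)$, $t\in\mathbb R$.
   Context: $H$ is a complex Hilbert space. A curve $t\mapsto A(t)$, $t\in\mathbb{R}$, of unbounded self-adjoint operators in $H$ with common domain: there is a dense linear subspace $V\subseteq H$ which is the domain of definition of each $A(t)$, and $A(t)^*=A(t)$ for each $t$. A function $f$ of a real variable is called $C^{k,\alpha}$ if it is $k$ times differentiable and the expression $\frac{f^{(k)}(t)-f^{(k)}(s)}{|t-s|^\alpha}$ is locally bounded in $t\neq s$. The curve $A$ is called $C^{k,\alpha}$ if for each $u\in V$ and $v\in H$ the function $t\mapsto\langle A(t)u,v\rangle$ is $C^{k,\alpha}$. Compact resolvent: for each $t$, the operator $(A(t)-z)^{-1}:H\to H$ is compact for some (equivalently any) $z$ in the resolvent set of $A(t)$. A (finite or infinite) sequence of functions $\lambda_i:\mathbb{R}\to\mathbb{R}$ is said to parameterize the eigenvalues of $A(t)$ if for each $t\in\mathbb{R}$ and each $z\in\mathbb{R}$ the cardinality $|\{i:\lambda_i(t)=z\}|$ equals the multiplicity of $z$ as an eigenvalue of $A(t)$ (multiplicity $0$ if $z$ is not an eigenvalue). *)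

theory Defs
  imports "HOL-Analysis.Analysis" "HOL-Library.Equipollence" "HOL-Library.Extended_Nat"
begin

text \<open>
  The inner product is linear in its first argument. The real inner product space structure
  that the class builds on, and with it norm and topology, is the one induced by
  \<open>Re (cinner x y)\<close>; definiteness of \<open>cinner\<close> is inherited from \<open>inner\<close>.
\<close>

class complex_hilbert_space = real_inner + complete_space +
  fixes scaleC :: "complex \<Rightarrow> 'a \<Rightarrow> 'a" (infixr "*\<^sub>C" 75)
    and cinner :: "'a \<Rightarrow> 'a \<Rightarrow> complex"
  assumes scaleC_add_right: "a *\<^sub>C (x + y) = a *\<^sub>C x + a *\<^sub>C y"
    and scaleC_add_left: "(a + b) *\<^sub>C x = a *\<^sub>C x + b *\<^sub>C x"
    and scaleC_scaleC: "a *\<^sub>C b *\<^sub>C x = (a * b) *\<^sub>C x"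
    and scaleC_of_real: "complex_of_real r *\<^sub>C x = r *\<^sub>R x"
    and cinner_commute: "cinner x y = cnj (cinner y x)"
    and cinner_add_left: "cinner (x + y) w = cinner x w + cinner y w"
    and cinner_scaleC_left: "cinner (a *\<^sub>C x) y = a * cinner x y"
    and inner_eq_Re_cinner: "x \<bullet> y = Re (cinner x y)"

interpretation complex_vector: vector_space
  "scaleC :: complex \<Rightarrow> 'a \<Rightarrow> 'a::complex_hilbert_space"
proof
  show "1 *\<^sub>C x = x" for x :: 'a
    using scaleC_of_real[of 1 x] by simp
qed (simp_all add: scaleC_add_right scaleC_add_left scaleC_scaleC)

text \<open>
  An unbounded operator is a domain \<open>V\<close> together with a total function \<open>T\<close>
  of which only the values on \<open>V\<close> matter.
\<close>

definition linear_on_dom ::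
  "'h::complex_hilbert_space set \<Rightarrow> ('h \<Rightarrow> 'h) \<Rightarrow> bool" where
  "linear_on_dom V T \<longleftrightarrow> complex_vector.subspace V \<and>
     (\<forall>u\<in>V. \<forall>v\<in>V. T (u + v) = T u + T v) \<and> (\<forall>c. \<forall>u\<in>V. T (c *\<^sub>C u) = c *\<^sub>C T u)"

definition adjoint_graph ::
  "'h::complex_hilbert_space set \<Rightarrow> ('h \<Rightarrow> 'h) \<Rightarrow> ('h \<times> 'h) set" where
  "adjoint_graph V T = {(v, w). \<forall>u\<in>V. cinner (T u) v = cinner u w}"

text \<open>
  Equality of graphs includes equality of the domains of the adjoint and of the operator.
\<close>

definition selfadjoint_op ::
  "'h::complex_hilbert_space set \<Rightarrow> ('h \<Rightarrow> 'h) \<Rightarrow> bool" where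
  "selfadjoint_op V T \<longleftrightarrow> linear_on_dom V T \<and> closure V = UNIV \<and>
     adjoint_graph V T = {(v, T v) |v. v \<in> V}"

definition resolvent ::
  "'h::complex_hilbert_space set \<Rightarrow> ('h \<Rightarrow> 'h) \<Rightarrow> complex \<Rightarrow> 'h \<Rightarrow> 'h" where
  "resolvent V T z = inv_into V (\<lambda>u. T u - z *\<^sub>C u)"

definition resolvent_set ::
  "'h::complex_hilbert_space set \<Rightarrow> ('h \<Rightarrow> 'h) \<Rightarrow> complex set" where
  "resolvent_set V T =
     {z. bij_betw (\<lambda>u. T u - z *\<^sub>C u) V UNIV \<and> bounded_linear (resolvent V T z)}"

definition compact_op :: "('h::real_normed_vector \<Rightarrow> 'h) \<Rightarrow> bool" where
  "compact_op R \<longleftrightarrow> bounded_linear R \<and> compact (closure (R ` cball 0 1))"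

definition compact_resolvent ::
  "'h::complex_hilbert_space set \<Rightarrow> ('h \<Rightarrow> 'h) \<Rightarrow> bool" where
  "compact_resolvent V T \<longleftrightarrow> (\<exists>z\<in>resolvent_set V T. compact_op (resolvent V T z))"

definition nth_deriv :: "nat \<Rightarrow> (real \<Rightarrow> 'b::real_normed_vector) \<Rightarrow> real \<Rightarrow> 'b" where
  "nth_deriv k f = ((\<lambda>g t. vector_derivative g (at t)) ^^ k) f"

text \<open>
  Local boundedness of the difference quotient is understood near every point of the plane,
  the diagonal included (where the quotient itself is not considered).
\<close>

definition C_holder :: "nat \<Rightarrow> real \<Rightarrow> (real \<Rightarrow> 'b::real_normed_vector) \<Rightarrow> bool" where
  "C_holder k \<alpha> f \<longleftrightarrow>
     (\<forall>j<k. \<forall>t. nth_deriv j f differentiable (at t)) \<and>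
     (\<forall>p::real \<times> real. \<exists>U M. open U \<and> p \<in> U \<and>
        (\<forall>(t, s)\<in>U. t \<noteq> s \<longrightarrow>
           norm (nth_deriv k f t - nth_deriv k f s) / \<bar>t - s\<bar> powr \<alpha> \<le> M))"

definition C_holder_curve ::
  "nat \<Rightarrow> real \<Rightarrow> 'h::complex_hilbert_space set \<Rightarrow> (real \<Rightarrow> 'h \<Rightarrow> 'h) \<Rightarrow> bool" where
  "C_holder_curve k \<alpha> V A \<longleftrightarrow> (\<forall>u\<in>V. \<forall>v. C_holder k \<alpha> (\<lambda>t. cinner (A t u) v))"

definition eigenspace ::
  "'h::complex_hilbert_space set \<Rightarrow> ('h \<Rightarrow> 'h) \<Rightarrow> complex \<Rightarrow> 'h set" where
  "eigenspace V T z = {u \<in> V. T u = z *\<^sub>C u}"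

text \<open>
  The multiplicity is the complex dimension of the eigenspace, as a cardinal: equipollence with
  a basis is used because \<open>card\<close> and \<open>dim\<close> do not tell infinite from zero.
\<close>

definition parameterizes_eigenvalues ::
  "nat set \<Rightarrow> (nat \<Rightarrow> real \<Rightarrow> real) \<Rightarrow> 'h::complex_hilbert_space set \<Rightarrow> (real \<Rightarrow> 'h \<Rightarrow> 'h) \<Rightarrow> bool"
  where
  "parameterizes_eigenvalues I lam V A \<longleftrightarrow>
     (\<forall>t z. \<exists>B. complex_vector.independent B \<and>
        complex_vector.span B = eigenspace V (A t) (complex_of_real z) \<and>
        {i \<in> I. lam i t = z} \<approx> B)"

end

theory Submission
  imports Defs
begin

text \<open>
  Attach to every time \<open>t\<close> the multiset of pairs \<open>(\<lambda>, \<mu>)\<close> of reals, where \<open>\<lambda>\<close> is an eigenvalue of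
  \<open>A(t)\<close> and \<open>\<mu>\<close> an eigenvalue of the compression of the derivative \<open>A'(t)\<close> to the eigenspace of
  \<open>\<lambda>\<close>; the multiplicities over a fixed \<open>\<lambda>\<close> add up to the multiplicity of \<open>\<lambda>\<close>. Perturbation theory
  of first order says that \<open>\<mu>\<close> is a slope: near \<open>t0\<close>, the eigenvalues that emerge from \<open>\<lambda>0\<close> lie
  within \<open>o(t - t0)\<close> of the lines \<open>\<lambda>0 + (t - t0) \<mu>\<close>, as many near each line as the multiplicity of
  the pair, and their own slopes are close to that \<open>\<mu>\<close> (lemma \<open>splitting\<close>). Two things follow. The
  multiset of pairs depends continuously on \<open>t\<close> (\<open>continuous_multiset_mult\<close>), and every continuous
  curve of pairs \<open>(\<lambda>(t), \<mu>(t))\<close> in it satisfies \<open>\<lambda>' = \<mu>\<close> (\<open>selection_derivative\<close>), so that \<open>\<lambda>\<close> is of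
  class \<open>C\<^sup>1\<close>. It remains to write the moving multiset as a union of continuous curves.

  This is a statement about continuous multisets over the line alone
  (\<open>continuous_multiset_parametrization\<close>). Local curves exist by induction on the multiplicity: where
  a point carries the full multiplicity the value of the curve is forced, and the complement is a
  union of open intervals on which smaller multiplicities suffice. They continue to all times as long
  as they cannot run off to infinity, which is guaranteed here by the differential inequality
  \<open>\<bar>\<lambda>'\<bar> \<le> B (1 + \<bar>\<lambda>\<bar>)\<close>. Removing a curve leaves a continuous multiset, so curves can be removed one
  after the other until nothing is left at time \<open>0\<close>; then nothing is left at any time, because any
  remaining point would lie on a curve through time \<open>0\<close>.

  The perturbation theory avoids contour integrals and spectral projections. Its main spectral input
  is \<open>gap\<close>: a vector of the domain that is orthogonal to all eigenvectors with eigenvalue in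
  \<open>[c - r, c + r]\<close> satisfies \<open>\<parallel>(A - c) x\<parallel> \<ge> r \<parallel>x\<parallel>\<close>. Together with a dimension count this compares the
  numbers of eigenvalues of \<open>A(t)\<close> and \<open>A(t0)\<close>, and the same lemma, applied to the compression of
  \<open>A'(t0)\<close>, separates the slopes. The Hoelder hypothesis enters through the uniform boundedness
  principle: weak differentiability with a weakly Hoelder derivative becomes differentiability in
  norm relative to the graph norm (\<open>selfadjoint_curve_of_C1_holder\<close>).
\<close>

section \<open>Continuous selections of moving multisets\<close>

text \<open>
  The function \<open>m t\<close> gives the multiplicities of a multiset of points. Continuity asks that, for all
  sufficiently small balls around \<open>p\<close>, the number of points in the ball near time \<open>t0\<close> is the
  multiplicity of \<open>p\<close> at \<open>t0\<close>; for \<open>p\<close> outside the multiset, the ball is empty.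
\<close>

definition continuous_multiset :: "real set \<Rightarrow> (real \<Rightarrow> 'p::metric_space \<Rightarrow> nat) \<Rightarrow> bool" where
  "continuous_multiset J m \<longleftrightarrow>
     (\<forall>t0\<in>J. \<forall>p. \<exists>e0>0. \<forall>e. 0 < e \<longrightarrow> e < e0 \<longrightarrow>
        (\<exists>d>0. \<forall>t\<in>J. dist t t0 < d \<longrightarrow>
           finite {q \<in> ball p e. 0 < m t q} \<and> sum (m t) {q \<in> ball p e. 0 < m t q} = m t0 p))"

definition selection :: "(real \<Rightarrow> 'p::metric_space \<Rightarrow> nat) \<Rightarrow> real set \<Rightarrow> (real \<Rightarrow> 'p) \<Rightarrow> bool" where
  "selection m U c \<longleftrightarrow> continuous_on U c \<and> (\<forall>t\<in>U. 0 < m t (c t))"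

definition locally_selectable :: "real set \<Rightarrow> (real \<Rightarrow> 'p::metric_space \<Rightarrow> nat) \<Rightarrow> bool" where
  "locally_selectable J m \<longleftrightarrow>
     (\<forall>t\<in>J. \<forall>p. 0 < m t p \<longrightarrow> (\<exists>d>0. \<exists>c. ball t d \<subseteq> J \<and> selection m (ball t d) c \<and> c t = p))"

text \<open>
  Boundedness near either endpoint is all that is needed to continue a curve, and unlike a global
  bound it passes to every sub-multiset.
\<close>

definition non_escaping :: "real set \<Rightarrow> (real \<Rightarrow> 'p::metric_space \<Rightarrow> nat) \<Rightarrow> bool" where
  "non_escaping J m \<longleftrightarrow>
     (\<forall>b\<in>J. \<exists>d>0. \<forall>a c. (b - d < a \<and> a < b \<and> selection m {a..<b} c \<longrightarrow> bounded (c ` {a..<b})) \<and>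
        (b < a \<and> a < b + d \<and> selection m {b<..a} c \<longrightarrow> bounded (c ` {b<..a})))"

lemma selection_subset: "selection m U c \<Longrightarrow> W \<subseteq> U \<Longrightarrow> selection m W c"
  by (auto simp: selection_def intro: continuous_on_subset)

lemma selection_mono:
  "selection m U c \<Longrightarrow> (\<And>t q. t \<in> U \<Longrightarrow> 0 < m t q \<Longrightarrow> 0 < m' t q) \<Longrightarrow> selection m' U c"
  by (auto simp: selection_def)

lemma non_escaping_mono:
  assumes "non_escaping J m" "J' \<subseteq> J" and *: "\<And>t q. 0 < m' t q \<Longrightarrow> 0 < m t q"
  shows "non_escaping J' m'"
proof -
  have "selection m' U c \<Longrightarrow> selection m U c" for U c
    by (erule selection_mono) (rule *)
  then show ?thesis
    using assms(1,2) unfolding non_escaping_def by (meson subsetD)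
qed

lemma sum_eq_imp_subset_eq:
  fixes f :: "'a \<Rightarrow> nat"
  assumes "finite A" "B \<subseteq> A" "sum f A = sum f B" "\<And>x. x \<in> A \<Longrightarrow> 0 < f x"
  shows "A = B"
proof -
  have "sum f A = sum f (A - B) + sum f B" by (rule sum.subset_diff[OF assms(2,1)])
  then have "sum f (A - B) = 0" using assms(3) by simp
  then have "\<forall>x\<in>A - B. f x = 0" using assms(1) by (subst (asm) sum_eq_0_iff) auto
  then show ?thesis using assms(2,4) by force
qed

text \<open>
  A ball and a smaller concentric ball contain the same number of points, so the shell between them
  is empty: the points near \<open>p\<close> are separated from all others.
\<close>

lemma continuous_multiset_isolated:
  fixes m :: "real \<Rightarrow> 'p::metric_space \<Rightarrow> nat"
  assumes "continuous_multiset J m" "t0 \<in> J"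
  shows "\<exists>e0>0. \<forall>e e'. 0 < e' \<longrightarrow> e' \<le> e \<longrightarrow> e < e0 \<longrightarrow>
       (\<exists>d>0. \<forall>t\<in>J. dist t t0 < d \<longrightarrow>
           finite {q \<in> ball p e. 0 < m t q} \<and> sum (m t) {q \<in> ball p e. 0 < m t q} = m t0 p
           \<and> {q \<in> ball p e. 0 < m t q} \<subseteq> ball p e')"
proof -
  obtain e0 where e0: "e0 > 0" and *: "\<And>e. 0 < e \<Longrightarrow> e < e0 \<Longrightarrow>
        (\<exists>d>0. \<forall>t\<in>J. dist t t0 < d \<longrightarrow>
           finite {q \<in> ball p e. 0 < m t q} \<and> sum (m t) {q \<in> ball p e. 0 < m t q} = m t0 p)"
    using bspec[OF assms(1)[unfolded continuous_multiset_def] assms(2), rule_format, of p] by auto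
  show ?thesis
  proof (rule exI[of _ e0], intro conjI allI impI e0)
    fix e e' :: real assume e: "0 < e'" "e' \<le> e" "e < e0"
    obtain d where d: "d > 0" "\<And>t. t \<in> J \<Longrightarrow> dist t t0 < d \<Longrightarrow>
       finite {q \<in> ball p e. 0 < m t q} \<and> sum (m t) {q \<in> ball p e. 0 < m t q} = m t0 p"
      using *[of e] e by auto
    obtain d' where d': "d' > 0" "\<And>t. t \<in> J \<Longrightarrow> dist t t0 < d' \<Longrightarrow>
       finite {q \<in> ball p e'. 0 < m t q} \<and> sum (m t) {q \<in> ball p e'. 0 < m t q} = m t0 p"
      using *[of e'] e by auto
    show "\<exists>d>0. \<forall>t\<in>J. dist t t0 < d \<longrightarrow>
           finite {q \<in> ball p e. 0 < m t q} \<and> sum (m t) {q \<in> ball p e. 0 < m t q} = m t0 p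
           \<and> {q \<in> ball p e. 0 < m t q} \<subseteq> ball p e'"
    proof (intro exI[of _ "min d d'"] conjI ballI impI)
      fix t assume t: "t \<in> J" "dist t t0 < min d d'"
      let ?A = "{q \<in> ball p e. 0 < m t q}" and ?B = "{q \<in> ball p e'. 0 < m t q}"
      have A: "finite ?A" "sum (m t) ?A = m t0 p" and B: "finite ?B" "sum (m t) ?B = m t0 p"
        using d(2)[of t] d'(2)[of t] t by auto
      have "?A = ?B"
      proof (rule sum_eq_imp_subset_eq[of _ _ "m t"])
        show "?B \<subseteq> ?A" using e by auto
        show "sum (m t) ?A = sum (m t) ?B" using A B by simp
      qed (use A in auto)
      then show "?A \<subseteq> ball p e'" by auto
      show "finite ?A" "sum (m t) ?A = m t0 p" by fact+
    qed (use d d' in auto)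
  qed
qed

lemma confined:
  fixes c :: "real \<Rightarrow> 'p::metric_space"
  assumes "continuous_on I c" "connected I" "s \<in> I" "dist q (c s) < e'" "e' < e"
    and "\<And>t. t \<in> I \<Longrightarrow> dist q (c t) < e \<Longrightarrow> dist q (c t) < e'"
    and "t \<in> I"
  shows "dist q (c t) < e'"
proof (rule ccontr)
  assume neg: "\<not> ?thesis"
  let ?f = "\<lambda>t. dist q (c t)"
  have "connected (?f ` I)"
    by (intro connected_continuous_image continuous_intros assms)
  moreover have "?f s \<in> ?f ` I" "?f t \<in> ?f ` I" using assms by auto
  ultimately have "{?f s .. ?f t} \<subseteq> ?f ` I"
    by (rule connected_contains_Icc)
  moreover have "e \<le> ?f t" using neg assms by force
  ultimately have "e' \<in> ?f ` I" using assms by (auto simp: subset_iff)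
  then show False using assms by force
qed

text \<open>
  A cluster value of the curve exists by boundedness. Around it there is an empty shell, which the
  curve cannot cross, so that it stays close to the cluster value once it has come close.
\<close>

lemma selection_limit_left:
  fixes m :: "real \<Rightarrow> 'p::heine_borel \<Rightarrow> nat"
  assumes cm: "continuous_multiset J m" and b: "b \<in> J" and "a < b" "{a..<b} \<subseteq> J"
    and sel: "selection m {a..<b} c" and bd: "bounded (c ` {a..<b})"
  shows "\<exists>q. 0 < m b q \<and> (c \<longlongrightarrow> q) (at_left b)"
proof -
  define t where "t n = b - (b - a) / real (n + 2)" for n
  have t: "t n \<in> {a..<b}" for n
  proof -
    have "0 < (b - a) / real (n + 2)" "(b - a) / real (n + 2) \<le> (b - a) / 1"
      using \<open>a < b\<close> by (simp, intro divide_left_mono) auto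
    then show ?thesis by (simp add: t_def)
  qed
  have tl: "t \<longlonglongrightarrow> b"
  proof -
    have "(\<lambda>n. b - (b - a) * inverse (real (n + 2))) \<longlonglongrightarrow> b - (b-a) * 0"
      by (intro tendsto_intros LIMSEQ_ignore_initial_segment[OF lim_inverse_n])
    then show ?thesis by (simp add: t_def[abs_def] divide_inverse)
  qed
  have "bounded (range (c \<circ> t))"
    by (rule bounded_subset[OF bd]) (use t in auto)
  then obtain q r where r: "strict_mono r" and q: "((c \<circ> t) \<circ> r) \<longlonglongrightarrow> q"
    using bounded_imp_convergent_subsequence by blast
  have tr: "(t \<circ> r) \<longlonglongrightarrow> b" using tl r by (rule LIMSEQ_subseq_LIMSEQ)
  obtain e0 where e0: "e0 > 0" and *:
    "\<forall>e e'. 0 < e' \<longrightarrow> e' \<le> e \<longrightarrow> e < e0 \<longrightarrow>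
       (\<exists>d>0. \<forall>t\<in>J. dist t b < d \<longrightarrow>
           finite {x \<in> ball q e. 0 < m t x} \<and> sum (m t) {x \<in> ball q e. 0 < m t x} = m b q
           \<and> {x \<in> ball q e. 0 < m t x} \<subseteq> ball q e')"
    using continuous_multiset_isolated[OF cm b, of q] by blast
  have key: "0 < m b q \<and> (\<exists>s<b. \<forall>t\<in>{s<..<b}. dist q (c t) < e)" if e: "0 < e" "e < e0" for e
  proof -
    obtain d where d: "d > 0" "\<And>t. t \<in> J \<Longrightarrow> dist t b < d \<Longrightarrow>
           finite {x \<in> ball q e. 0 < m t x} \<and> sum (m t) {x \<in> ball q e. 0 < m t x} = m b q
           \<and> {x \<in> ball q e. 0 < m t x} \<subseteq> ball q (e/2)"
      using *[rule_format, of "e/2" e] e by auto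
    have "\<forall>\<^sub>F n in sequentially. dist ((t \<circ> r) n) b < d \<and> dist (((c \<circ> t) \<circ> r) n) q < e/2"
      using tendstoD[OF tr d(1)] tendstoD[OF q, of "e/2"] that by (auto intro: eventually_conj)
    then obtain n where n: "dist (t (r n)) b < d" "dist (c (t (r n))) q < e/2"
      by (auto simp: eventually_sequentially)
    define s where "s = t (r n)"
    have s: "a \<le> s" "s < b" using t by (auto simp: s_def)
    have near: "dist x b < d" "x \<in> J" "0 < m x (c x)" if "x \<in> {s..<b}" for x
      using that n s sel \<open>{a..<b} \<subseteq> J\<close> by (auto simp: s_def[symmetric] dist_real_def selection_def subset_iff)
    have conf: "dist q (c x) < e/2" if "x \<in> {s..<b}" for x
    proof (rule confined[of "{s..<b}" c s q "e/2" e])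
      show "continuous_on {s..<b} c"
        using sel s by (auto simp: selection_def intro: continuous_on_subset)
      show "dist q (c y) < e / 2" if "y \<in> {s..<b}" "dist q (c y) < e" for y
        using d(2)[of y] near[of y] that by auto
    qed (use s n that \<open>0<e\<close> in \<open>auto simp: s_def dist_commute\<close>)
    have "c s \<in> {x \<in> ball q e. 0 < m s x}" using conf[of s] near[of s] s \<open>0<e\<close> by auto
    then have "0 < sum (m s) {x \<in> ball q e. 0 < m s x}"
      using d(2)[of s] near[of s] s by (intro sum_pos) auto
    then have "0 < m b q" using d(2)[of s] near[of s] s by auto
    moreover have "dist q (c t) < e" if "t \<in> {s<..<b}" for t
      using conf[of t] that e by auto
    ultimately show ?thesis using s by blast
  qed
  have "0 < m b q" using key[of "e0/2"] e0 by auto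
  moreover have "(c \<longlongrightarrow> q) (at_left b)"
  proof (rule tendstoI)
    fix e :: real assume "0 < e"
    then obtain s where s: "s < b" "\<forall>t\<in>{s<..<b}. dist q (c t) < min e (e0/2)"
      using key[of "min e (e0/2)"] e0 by (auto simp: min_less_iff_disj)
    have "\<forall>\<^sub>F x in at_left b. x \<in> {s<..<b}" using eventually_at_left_real s(1) by simp
    then show "\<forall>\<^sub>F x in at_left b. dist (c x) q < e"
      by eventually_elim (use s in \<open>auto simp: dist_commute\<close>)
  qed
  ultimately show ?thesis by blast
qed

lemma selection_extend_right:
  fixes m :: "real \<Rightarrow> 'p::heine_borel \<Rightarrow> nat"
  assumes cm: "continuous_multiset J m" and ls: "locally_selectable J m" and ne: "non_escaping J m"
    and U: "open U" "is_interval U" "U \<subseteq> J" "a \<in> U"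
    and b: "b \<in> J" "b \<notin> U" "a < b" "{a..<b} \<subseteq> U"
    and sel: "selection m U c"
  shows "\<exists>W c'. open W \<and> is_interval W \<and> W \<subseteq> J \<and> U \<subseteq> W \<and> b \<in> W \<and> selection m W c' \<and> (\<forall>t\<in>U. c' t = c t)"
proof -
  have Ub: "t < b" if "t \<in> U" for t
  proof (rule ccontr)
    assume "\<not> t < b"
    then have "b \<in> U" using U(2,4) that b(3) unfolding is_interval_1 by (meson less_eq_real_def not_le)
    then show False using b by blast
  qed
  obtain d0 where d0: "d0 > 0" "\<And>a c. b - d0 < a \<Longrightarrow> a < b \<Longrightarrow> selection m {a..<b} c \<Longrightarrow> bounded (c ` {a..<b})"
    using ne b(1) unfolding non_escaping_def by metis
  define a' where "a' = max a (b - d0/2)"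
  have a': "a \<le> a'" "a' < b" "b - d0 < a'" using b d0 by (auto simp: a'_def)
  have sub: "{a'..<b} \<subseteq> U" using b a' by auto
  have sel': "selection m {a'..<b} c" using sel sub by (rule selection_subset)
  obtain q where q: "0 < m b q" "(c \<longlongrightarrow> q) (at_left b)"
    using selection_limit_left[OF cm b(1) a'(2) _ sel' d0(2)[OF a'(3,2) sel']] sub U by auto
  obtain d c1 where d: "d > 0" "ball b d \<subseteq> J" and c1: "selection m (ball b d) c1" "c1 b = q"
    using ls b(1) q(1) unfolding locally_selectable_def by metis
  define W where "W = U \<union> ball b (min d (b - a))"
  define c' where "c' t = (if t < b then c t else c1 t)" for t
  have ballb: "t < b \<Longrightarrow> t \<in> ball b (min d (b-a)) \<Longrightarrow> t \<in> U" for t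
    using b by (auto simp: dist_real_def subset_iff)
  have mem: "t \<in> W \<longleftrightarrow> (t < b \<and> t \<in> U) \<or> (b \<le> t \<and> t < b + min d (b - a))" for t
    using ballb[of t] Ub[of t] by (auto simp: W_def dist_real_def)
  have oW: "open W" unfolding W_def using U by auto
  have iW: "is_interval W"
    unfolding is_interval_1
  proof (intro ballI allI impI)
    fix x y z assume *: "x \<in> W" "y \<in> W" "x \<le> z \<and> z \<le> y"
    show "z \<in> W"
    proof (cases "z < b")
      case True
      then have x: "x \<in> U" using * mem by auto
      have "z \<in> U"
      proof (cases "a \<le> z")
        case False
        then show ?thesis using x U(2,4) * unfolding is_interval_1 by (meson less_eq_real_def not_le)
      qed (use b True in auto)
      then show ?thesis by (simp add: W_def)
    next
      case False
      then show ?thesis using * mem[of y] mem[of z] Ub[of y] by auto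
    qed
  qed
  have cont: "continuous (at t) c'" if t: "t \<in> W" for t
  proof -
    consider "t < b" | "t > b" | "t = b" by linarith
    then show ?thesis
    proof cases
      case 1
      then have tU: "t \<in> U" using mem t by auto
      have "continuous (at t) c" using sel tU U(1) by (auto simp: selection_def continuous_on_eq_continuous_at)
      moreover have "\<forall>\<^sub>F x in nhds t. c' x = c x"
        using eventually_nhds_in_open[OF open_lessThan, of t b] 1 by (auto simp: c'_def elim: eventually_mono)
      ultimately show ?thesis using isCont_cong by blast
    next
      case 2
      then have tU: "t \<in> ball b d" using mem t by (auto simp: dist_real_def)
      have "continuous (at t) c1" using c1(1) tU by (auto simp: selection_def continuous_on_eq_continuous_at)
      moreover have "\<forall>\<^sub>F x in nhds t. c' x = c1 x"
        using eventually_nhds_in_open[OF open_greaterThan, of t b] 2 by (auto simp: c'_def elim: eventually_mono)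
      ultimately show ?thesis using isCont_cong by blast
    next
      case 3
      have "continuous (at b) c1" using c1(1) d by (auto simp: selection_def continuous_on_eq_continuous_at)
      then have "(c1 \<longlongrightarrow> q) (at_right b)" using c1(2) by (auto simp: continuous_at filterlim_at_split)
      moreover have "\<forall>\<^sub>F x in at_right b. c1 x = c' x"
        by (auto simp: c'_def eventually_at_filter)
      ultimately have R: "(c' \<longlongrightarrow> q) (at_right b)" by (rule Lim_transform_eventually)
      have "\<forall>\<^sub>F x in at_left b. c x = c' x"
        by (auto simp: c'_def eventually_at_filter)
      with q(2) have L: "(c' \<longlongrightarrow> q) (at_left b)" by (rule Lim_transform_eventually)
      have "c' b = q" by (simp add: c'_def c1)
      then show ?thesis using L R 3 by (auto simp: continuous_at filterlim_at_split)
    qed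
  qed
  have "selection m W c'"
    unfolding selection_def
  proof (intro conjI ballI)
    show "continuous_on W c'" using cont by (simp add: continuous_at_imp_continuous_on)
    fix t assume t: "t \<in> W"
    show "0 < m t (c' t)"
      using t mem[of t] sel c1(1) by (auto simp: c'_def selection_def dist_real_def)
  qed
  moreover have "W \<subseteq> J" using U(3) d by (auto simp: W_def)
  moreover have "\<forall>t\<in>U. c' t = c t" using Ub by (auto simp: c'_def)
  ultimately show ?thesis using oW iW d b mem[of b] by (intro exI[of _ W] exI[of _ c']) (auto simp: W_def)
qed

lemma uminus_image_iff: "x \<in> uminus ` S \<longleftrightarrow> - x \<in> S" for x :: real
proof
  assume "- x \<in> S"
  then have "- (- x) \<in> uminus ` S" by (rule imageI)
  then show "x \<in> uminus ` S" by simp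
qed auto

text \<open>
  Reversal of time, to obtain the continuation to the left from the one to the right.
\<close>

lemma selection_reflect:
  assumes "selection m U c"
  shows "selection (\<lambda>t. m (- t)) (uminus ` U) (\<lambda>t. c (- t))"
proof -
  have "continuous_on (uminus ` U) (\<lambda>t. c (- t))"
  proof (rule continuous_on_compose2[of U c])
    show "continuous_on U c" using assms by (simp add: selection_def)
    show "continuous_on (uminus ` U) (\<lambda>t. - t)" by (rule continuous_on_minus[OF continuous_on_id])
  qed auto
  then show ?thesis using assms by (auto simp: selection_def)
qed

lemma continuous_multiset_reflect:
  assumes "continuous_multiset J m"
  shows "continuous_multiset (uminus ` J) (\<lambda>t. m (- t))"
  unfolding continuous_multiset_def
proof (intro ballI allI)
  fix t0 p assume "t0 \<in> uminus ` J"
  then have "- t0 \<in> J" by auto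
  then obtain e0 where e0: "e0 > 0" and *: "\<And>e. 0 < e \<Longrightarrow> e < e0 \<Longrightarrow>
        (\<exists>d>0. \<forall>t\<in>J. dist t (- t0) < d \<longrightarrow>
           finite {q \<in> ball p e. 0 < m t q} \<and> sum (m t) {q \<in> ball p e. 0 < m t q} = m (- t0) p)"
    using bspec[OF assms[unfolded continuous_multiset_def], rule_format, of "- t0" p] by auto
  show "\<exists>e0>0. \<forall>e>0. e < e0 \<longrightarrow> (\<exists>d>0. \<forall>t\<in>uminus ` J. dist t t0 < d \<longrightarrow>
          finite {q \<in> ball p e. 0 < m (- t) q} \<and> sum (m (- t)) {q \<in> ball p e. 0 < m (- t) q} = m (- t0) p)"
  proof (rule exI[of _ e0], intro conjI allI impI e0)
    fix e assume "0 < e" "e < e0"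
    then obtain d where d: "d > 0" "\<And>t. t \<in> J \<Longrightarrow> dist t (- t0) < d \<Longrightarrow>
           finite {q \<in> ball p e. 0 < m t q} \<and> sum (m t) {q \<in> ball p e. 0 < m t q} = m (- t0) p"
      using * by blast
    have "finite {q \<in> ball p e. 0 < m (- t) q} \<and> sum (m (- t)) {q \<in> ball p e. 0 < m (- t) q} = m (- t0) p"
      if "t \<in> uminus ` J" "dist t t0 < d" for t
      using d(2)[of "- t"] that by (auto simp: dist_real_def abs_minus_commute)
    then show "\<exists>d>0. \<forall>t\<in>uminus ` J. dist t t0 < d \<longrightarrow>
          finite {q \<in> ball p e. 0 < m (- t) q} \<and> sum (m (- t)) {q \<in> ball p e. 0 < m (- t) q} = m (- t0) p"
      using d(1) by blast
  qed
qed

lemma locally_selectable_reflect: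
  assumes "locally_selectable J m"
  shows "locally_selectable (uminus ` J) (\<lambda>t. m (- t))"
  unfolding locally_selectable_def
proof (intro ballI allI impI)
  fix t p assume "t \<in> uminus ` J" "0 < m (- t) p"
  then obtain d c where d: "d > 0" "ball (- t) d \<subseteq> J" "selection m (ball (- t) d) c" "c (- t) = p"
    using assms[unfolded locally_selectable_def, rule_format, of "- t" p] uminus_image_iff[of t J] by auto
  have "uminus ` ball (- t) d = ball t d"
    unfolding set_eq_iff uminus_image_iff by (auto simp: dist_real_def)
  then show "\<exists>d>0. \<exists>c. ball t d \<subseteq> uminus ` J \<and> selection (\<lambda>t. m (- t)) (ball t d) c \<and> c t = p"
    using selection_reflect[OF d(3)] d(1,2,4) image_mono[OF d(2), of uminus]
    by (intro exI[of _ d] conjI exI[of _ "\<lambda>t. c (- t)"]) simp_all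
qed

lemma non_escaping_reflect:
  assumes "non_escaping J m"
  shows "non_escaping (uminus ` J) (\<lambda>t. m (- t))"
  unfolding non_escaping_def
proof
  fix b assume "b \<in> uminus ` J"
  then have bJ: "- b \<in> J" by auto
  obtain d where "d > 0" and *: "\<forall>a c. (- b - d < a \<and> a < - b \<and> selection m {a..<- b} c \<longrightarrow> bounded (c ` {a..<- b})) \<and>
        (- b < a \<and> a < - b + d \<and> selection m {- b<..a} c \<longrightarrow> bounded (c ` {- b<..a}))"
    using bspec[OF assms[unfolded non_escaping_def] bJ] by (elim exE conjE) (rule that)
  then have d: "d > 0"
    "\<And>a c. - b - d < a \<Longrightarrow> a < - b \<Longrightarrow> selection m {a..<- b} c \<Longrightarrow> bounded (c ` {a..<- b})"
    "\<And>a c. - b < a \<Longrightarrow> a < - b + d \<Longrightarrow> selection m {- b<..a} c \<Longrightarrow> bounded (c ` {- b<..a})"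
    using * by simp_all
  have im: "uminus ` {a..<b} = {- b<..- a}" "uminus ` {b<..a} = {- a..<- b}" for a b :: real
    by simp_all
  have "bounded (c ` {a..<b})" if "b - d < a" "a < b" "selection (\<lambda>t. m (- t)) {a..<b} c" for a c
  proof -
    have "bounded ((\<lambda>t. c (- t)) ` {- b<..- a})"
      using d(3)[of "- a" "\<lambda>t. c (- t)"] selection_reflect[OF that(3)] that im by simp
    moreover have "(\<lambda>t. c (- t)) ` {- b<..- a} = c ` {a..<b}"
      by (simp only: im(1)[symmetric] image_image minus_minus)
    ultimately show ?thesis by simp
  qed
  moreover have "bounded (c ` {b<..a})" if "b < a" "a < b + d" "selection (\<lambda>t. m (- t)) {b<..a} c" for a c
  proof -
    have "bounded ((\<lambda>t. c (- t)) ` {- a..<- b})"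
      using d(2)[of "- a" "\<lambda>t. c (- t)"] selection_reflect[OF that(3)] that im by simp
    moreover have "(\<lambda>t. c (- t)) ` {- a..<- b} = c ` {b<..a}"
      by (simp only: im(2)[symmetric] image_image minus_minus)
    ultimately show ?thesis by simp
  qed
  ultimately show "\<exists>d>0. \<forall>a c. (b - d < a \<and> a < b \<and> selection (\<lambda>t. m (- t)) {a..<b} c \<longrightarrow> bounded (c ` {a..<b})) \<and>
        (b < a \<and> a < b + d \<and> selection (\<lambda>t. m (- t)) {b<..a} c \<longrightarrow> bounded (c ` {b<..a}))"
    using d(1) by blast
qed

lemma selection_extend_left:
  fixes m :: "real \<Rightarrow> 'p::heine_borel \<Rightarrow> nat"
  assumes cm: "continuous_multiset J m" and ls: "locally_selectable J m" and ne: "non_escaping J m"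
    and U: "open U" "is_interval U" "U \<subseteq> J" "a \<in> U"
    and b: "b \<in> J" "b \<notin> U" "b < a" "{b<..a} \<subseteq> U"
    and sel: "selection m U c"
  shows "\<exists>W c'. open W \<and> is_interval W \<and> W \<subseteq> J \<and> U \<subseteq> W \<and> b \<in> W \<and> selection m W c' \<and> (\<forall>t\<in>U. c' t = c t)"
proof -
  have int: "is_interval (uminus ` S)" if "is_interval S" for S :: "real set"
    unfolding is_interval_1 uminus_image_iff
  proof (intro ballI allI impI)
    fix x y z assume "x \<in> uminus ` S" "y \<in> uminus ` S" "x \<le> z \<and> z \<le> y"
    then have "- x \<in> S" "- y \<in> S" "- y \<le> - z \<and> - z \<le> - x" by (auto simp: uminus_image_iff)
    then show "- z \<in> S" using that unfolding is_interval_1 by blast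
  qed
  have inv: "uminus ` uminus ` S = S" for S :: "real set" by (simp add: image_image)
  have "\<exists>W c'. open W \<and> is_interval W \<and> W \<subseteq> uminus ` J \<and> uminus ` U \<subseteq> W \<and> - b \<in> W \<and>
      selection (\<lambda>t. m (- t)) W c' \<and> (\<forall>t\<in>uminus ` U. c' t = c (- t))"
  proof (rule selection_extend_right[OF continuous_multiset_reflect[OF cm] locally_selectable_reflect[OF ls]
          non_escaping_reflect[OF ne] open_negations[OF U(1)] int[OF U(2)] image_mono[OF U(3)] imageI[OF U(4)]
          imageI[OF b(1)] _ _ _ selection_reflect[OF sel]])
    show "{- a..<- b} \<subseteq> uminus ` U"
      using b(4) unfolding subset_iff uminus_image_iff by auto
  qed (use b in \<open>auto simp: uminus_image_iff\<close>)
  then obtain W c' where W: "open W" "is_interval W" "W \<subseteq> uminus ` J" "uminus ` U \<subseteq> W" "- b \<in> W"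
      "selection (\<lambda>t. m (- t)) W c'" "\<forall>t\<in>uminus ` U. c' t = c (- t)"
    by blast
  show ?thesis
  proof (intro exI conjI)
    show "uminus ` W \<subseteq> J" using image_mono[OF W(3), of uminus] by (simp add: inv)
    show "U \<subseteq> uminus ` W" using image_mono[OF W(4), of uminus] by (simp add: inv)
    show "b \<in> uminus ` W" using W(5) by force
    show "selection m (uminus ` W) (\<lambda>t. c' (- t))" using selection_reflect[OF W(6)] by simp
  qed (use W int open_negations in auto)
qed

text \<open>
  A curve on a maximal open interval exists by Zorn's lemma, applied to graphs. At an endpoint inside
  \<open>J\<close> it could be continued.
\<close>

lemma selection_on_interval:
  fixes m :: "real \<Rightarrow> 'p::heine_borel \<Rightarrow> nat"
  assumes cm: "continuous_multiset J m" and ls: "locally_selectable J m" and ne: "non_escaping J m"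
    and J: "is_interval J" and t0: "t0 \<in> J" "0 < m t0 p"
  shows "\<exists>c. selection m J c \<and> c t0 = p"
proof -
  define good where "good U c \<longleftrightarrow> open U \<and> is_interval U \<and> t0 \<in> U \<and> U \<subseteq> J \<and> selection m U c \<and> c t0 = p"
    for U c
  define gr where "gr U c = (\<lambda>t. (t, c t)) ` U" for U and c :: "real \<Rightarrow> 'p"
  define A where "A = {gr U c |U c. good U c}"
  have grD: "U \<subseteq> U' \<and> (\<forall>t\<in>U. c' t = c t)" if "gr U c \<subseteq> gr U' c'" for U U' c c'
  proof -
    have "(t, c t) \<in> gr U' c'" if "t \<in> U" for t
      using \<open>gr U c \<subseteq> gr U' c'\<close> that by (auto simp: gr_def)
    then show ?thesis by (fastforce simp: gr_def)
  qed
  have "\<exists>M\<in>A. \<forall>X\<in>A. M \<subseteq> X \<longrightarrow> X = M"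
  proof (rule subset_Zorn_nonempty)
    obtain d c where "d > 0" "ball t0 d \<subseteq> J" "selection m (ball t0 d) c" "c t0 = p"
      using ls[unfolded locally_selectable_def, rule_format, OF t0] by auto
    then have "good (ball t0 d) c" by (auto simp: good_def is_interval_ball_real)
    then show "A \<noteq> {}" by (auto simp: A_def)
  next
    fix C assume C: "C \<noteq> {}" "subset.chain A C"
    define I where "I = {(U, c). good U c \<and> gr U c \<in> C}"
    have CI: "C = (\<lambda>(U, c). gr U c) ` I"
      using C(2) unfolding subset.chain_def A_def I_def by force
    have I: "good U c" if "(U, c) \<in> I" for U c using that by (auto simp: I_def)
    define U where "U = (\<Union>(U, c)\<in>I. U)"
    define f where "f t = (SOME q. (t, q) \<in> \<Union>C)" for t
    have f: "f t = c t" if "(V, c) \<in> I" "t \<in> V" for V c t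
    proof -
      have *: "(t, c t) \<in> \<Union>C" using that by (auto simp: CI gr_def)
      then have "(t, f t) \<in> \<Union>C" unfolding f_def by (rule someI)
      then obtain V' c' where V': "(V', c') \<in> I" "t \<in> V'" "f t = c' t" by (auto simp: CI gr_def)
      have "gr V c \<in> C" "gr V' c' \<in> C" using that V' by (auto simp: CI)
      then have "gr V c \<subseteq> gr V' c' \<or> gr V' c' \<subseteq> gr V c"
        using C(2) unfolding subset.chain_def by blast
      then show ?thesis using grD that V' by metis
    qed
    have "good U f"
      unfolding good_def
    proof (intro conjI)
      show oU: "open U" unfolding U_def using I by (auto simp: good_def)
      obtain V0 c0 where 0: "(V0, c0) \<in> I" using C(1) CI by auto
      show "t0 \<in> U" using I[OF 0] 0 by (auto simp: U_def good_def)
      show "f t0 = p" using f[OF 0, of t0] I[OF 0] by (auto simp: good_def)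
      show "U \<subseteq> J" unfolding U_def using I unfolding good_def by blast
      have "t0 \<in> \<Inter>(fst ` I)" "connected V" if "V \<in> fst ` I" for V
        using I that by (auto simp: good_def is_interval_connected_1)
      then have "connected (\<Union>(fst ` I))"
        by (intro connected_Union) (use 0 in force)+
      moreover have "\<Union>(fst ` I) = U" by (auto simp: U_def)
      ultimately show "is_interval U" by (simp add: is_interval_connected_1)
      show "selection m U f"
        unfolding selection_def
      proof (intro conjI ballI)
        have "isCont f t" if tU: "t \<in> U" for t
        proof -
          obtain V c where V: "(V, c) \<in> I" "t \<in> V" using tU by (auto simp: U_def)
          have oV: "open V" and cV: "continuous_on V c" using I[OF V(1)] by (auto simp: good_def selection_def)
          then have "isCont c t" using V by (simp add: continuous_on_eq_continuous_at)
          moreover have "\<forall>\<^sub>F x in nhds t. f x = c x"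
            using eventually_nhds_in_open[OF oV V(2)] f[OF V(1)] by (auto elim: eventually_mono)
          ultimately show ?thesis using isCont_cong by blast
        qed
        then show "continuous_on U f" by (simp add: continuous_at_imp_continuous_on)
      next
        fix t assume "t \<in> U"
        then obtain V c where V: "(V, c) \<in> I" "t \<in> V" by (auto simp: U_def)
        then show "0 < m t (f t)" using I[OF V(1)] f[OF V] by (auto simp: good_def selection_def)
      qed
    qed
    moreover have "\<Union>C = gr U f" unfolding CI gr_def U_def using f by (force simp: image_iff)
    ultimately show "\<Union>C \<in> A" by (auto simp: A_def)
  qed
  then obtain M where M: "M \<in> A" "\<forall>X\<in>A. M \<subseteq> X \<longrightarrow> X = M" by (elim bexE)
  obtain U c where g: "good U c" and MU: "M = gr U c"
    using M(1) unfolding A_def mem_Collect_eq by (elim exE conjE)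
  have max: "gr W c' = gr U c" if "good W c'" "gr U c \<subseteq> gr W c'" for W c'
    using M(2)[rule_format, of "gr W c'"] that MU by (auto simp: A_def)
  have noext: False if "open W" "is_interval W" "W \<subseteq> J" "U \<subseteq> W" "b \<in> W" "selection m W c'" "\<forall>t\<in>U. c' t = c t" "b \<notin> U"
    for W c' b
  proof -
    have "good W c'" using that g by (auto simp: good_def)
    moreover have "gr U c \<subseteq> gr W c'" using that by (auto simp: gr_def)
    ultimately have "gr W c' = gr U c" by (rule max)
    then show False using that grD[of W c' U c] by auto
  qed
  have U: "open U" "is_interval U" "t0 \<in> U" "U \<subseteq> J" "selection m U c" "c t0 = p"
    using g by (auto simp: good_def)
  have "J \<subseteq> U"
  proof (rule ccontr)
    assume "\<not> J \<subseteq> U"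
    then obtain x where x: "x \<in> J" "x \<notin> U" by auto
    then have "x \<noteq> t0" using U by auto
    then consider "t0 < x" | "x < t0" by linarith
    then show False
    proof cases
      case 1
      have le: "u \<le> x" if "u \<in> U" for u
        using U(2,3) x 1 that unfolding is_interval_1 by (meson less_eq_real_def not_le)
      define b where "b = Sup U"
      have bdd: "bdd_above U" using le by (auto simp: bdd_above_def)
      have bx: "b \<le> x" unfolding b_def using le U by (intro cSup_least) auto
      have ub: "u \<le> b" if "u \<in> U" for u unfolding b_def by (rule cSup_upper[OF that bdd])
      have bU: "b \<notin> U"
      proof
        assume "b \<in> U"
        then obtain d where "d > 0" "ball b d \<subseteq> U" using U(1) by (meson open_contains_ball)
        then have "b + d/2 \<in> U" by (auto simp: subset_iff dist_real_def)
        then show False using ub[of "b + d/2"] \<open>d > 0\<close> by auto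
      qed
      have t0b: "t0 < b" using ub[OF U(3)] bU U(3) by (metis less_eq_real_def)
      have sub: "{t0..<b} \<subseteq> U"
      proof
        fix y assume y: "y \<in> {t0..<b}"
        then obtain u where "u \<in> U" "y < u" using less_cSup_iff[OF _ bdd, of y] U(3) unfolding b_def by auto
        then show "y \<in> U" using U(2,3) y unfolding is_interval_1 by (meson atLeastLessThan_iff less_eq_real_def)
      qed
      have bJ: "b \<in> J" using J t0(1) x(1) t0b bx unfolding is_interval_1 by (meson less_eq_real_def)
      obtain W c' where "open W" "is_interval W" "W \<subseteq> J" "U \<subseteq> W" "b \<in> W" "selection m W c'" "\<forall>t\<in>U. c' t = c t"
        using selection_extend_right[OF cm ls ne U(1,2,4,3) bJ bU t0b sub U(5)] by (elim exE conjE)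
      then show False using noext bU by blast
    next
      case 2
      have le: "x \<le> u" if "u \<in> U" for u
        using U(2,3) x 2 that unfolding is_interval_1 by (meson less_eq_real_def not_le)
      define b where "b = Inf U"
      have bdd: "bdd_below U" using le by (auto simp: bdd_below_def)
      have bx: "x \<le> b" unfolding b_def using le U by (intro cInf_greatest) auto
      have ub: "b \<le> u" if "u \<in> U" for u unfolding b_def by (rule cInf_lower[OF that bdd])
      have bU: "b \<notin> U"
      proof
        assume "b \<in> U"
        then obtain d where "d > 0" "ball b d \<subseteq> U" using U(1) by (meson open_contains_ball)
        then have "b - d/2 \<in> U" by (auto simp: subset_iff dist_real_def)
        then show False using ub[of "b - d/2"] \<open>d > 0\<close> by auto
      qed
      have t0b: "b < t0" using ub[OF U(3)] bU U(3) by (metis less_eq_real_def)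
      have sub: "{b<..t0} \<subseteq> U"
      proof
        fix y assume y: "y \<in> {b<..t0}"
        then obtain u where "u \<in> U" "u < y" using cInf_less_iff[OF _ bdd, of y] U(3) unfolding b_def by auto
        then show "y \<in> U" using U(2,3) y unfolding is_interval_1 by (meson greaterThanAtMost_iff less_eq_real_def)
      qed
      have bJ: "b \<in> J" using J t0(1) x(1) t0b bx unfolding is_interval_1 by (meson less_eq_real_def)
      obtain W c' where "open W" "is_interval W" "W \<subseteq> J" "U \<subseteq> W" "b \<in> W" "selection m W c'" "\<forall>t\<in>U. c' t = c t"
        using selection_extend_left[OF cm ls ne U(1,2,4,3) bJ bU t0b sub U(5)] by (elim exE conjE)
      then show False using noext bU by blast
    qed
  qed
  then show ?thesis using U by (metis subset_antisym)
qed

text \<open>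
  Induction on the multiplicity \<open>k\<close> of the point. Isolate the point in a ball that contains exactly
  \<open>k\<close> points, and let \<open>Z\<close> be the set of times at which they coincide. At times of \<open>Z\<close> the curve is
  forced and automatically continuous, since all \<open>k\<close> points converge to it. The complement of \<open>Z\<close> is
  open, and on each of its components the induction hypothesis provides local curves, hence a curve
  on the whole component; the curves on different components need not be compatible.
\<close>

lemma locally_selectable_of_continuous:
  fixes m :: "real \<Rightarrow> 'p::heine_borel \<Rightarrow> nat"
  assumes J: "open J" and cm: "continuous_multiset J m"
  shows "locally_selectable J m"
proof -
  have "\<forall>t0\<in>J. \<forall>p. m t0 p = k \<longrightarrow> 0 < k \<longrightarrow> (\<exists>d>0. \<exists>c. ball t0 d \<subseteq> J \<and> selection m (ball t0 d) c \<and> c t0 = p)" for k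
  proof (induction k rule: less_induct)
    case (less k)
    show ?case
    proof (intro ballI allI impI)
      fix t0 p assume t0: "t0 \<in> J" and k: "m t0 p = k" "0 < k"
      obtain e0 where e0: "e0 > 0" and iso0: "\<forall>e e'. 0 < e' \<longrightarrow> e' \<le> e \<longrightarrow> e < e0 \<longrightarrow>
       (\<exists>d>0. \<forall>t\<in>J. dist t t0 < d \<longrightarrow>
           finite {q \<in> ball p e. 0 < m t q} \<and> sum (m t) {q \<in> ball p e. 0 < m t q} = m t0 p
           \<and> {q \<in> ball p e. 0 < m t q} \<subseteq> ball p e')"
        using continuous_multiset_isolated[OF cm t0, of p] by (elim exE conjE)
      define e where "e = e0/2"
      define e' where "e' = e0/4"
      have e: "0 < e'" "e' < e" "e < e0" using e0 by (auto simp: e_def e'_def)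
      define S where "S t = {q \<in> ball p e. 0 < m t q}" for t
      obtain d0 where d0: "d0 > 0" "\<And>t. t \<in> J \<Longrightarrow> dist t t0 < d0 \<Longrightarrow> finite (S t) \<and> sum (m t) (S t) = k \<and> S t \<subseteq> ball p e'"
        using iso0[rule_format, of e' e] e k unfolding S_def by auto
      obtain d1 where d1: "d1 > 0" "ball t0 d1 \<subseteq> J" using J t0 by (meson open_contains_ball)
      define J' where "J' = ball t0 (min d0 d1)"
      have J': "open J'" "t0 \<in> J'" "J' \<subseteq> J" using d0 d1 by (auto simp: J'_def)
      have S: "finite (S t)" "sum (m t) (S t) = k" "S t \<subseteq> ball p e'" if "t \<in> J'" for t
        using d0(2)[of t] that J'(3) by (simp_all add: J'_def dist_commute subset_iff)
      have mle: "m t q \<le> k" if "t \<in> J'" "q \<in> S t" for t q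
        using member_le_sum[of q "S t" "m t"] S[OF that(1)] that(2) by auto
      have uniq: "S t = {q}" if "t \<in> J'" "q \<in> S t" "m t q = k" for t q
      proof (rule sum_eq_imp_subset_eq[of _ _ "m t"])
        show "sum (m t) (S t) = sum (m t) {q}" using S(2)[OF that(1)] that(3) by simp
      qed (use that S(1) in \<open>simp_all add: S_def\<close>)
      \<comment> \<open>The times at which the \<open>k\<close> points in the ball coincide.\<close>
      define Z where "Z = {t \<in> J'. \<exists>q\<in>S t. m t q = k}"
      have iso: "\<exists>r0>0. \<forall>r. 0 < r \<longrightarrow> r < r0 \<longrightarrow> ball q r \<subseteq> ball p e \<and>
          (\<exists>d>0. \<forall>s\<in>J'. dist s t < d \<longrightarrow> finite {x \<in> ball q r. 0 < m s x} \<and>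
            sum (m s) {x \<in> ball q r. 0 < m s x} = m t q)" if t: "t \<in> J'" and q: "q \<in> ball p e" for t q
      proof -
        have tJ: "t \<in> J" using t J' by auto
        obtain r0 where r0: "r0 > 0" "\<forall>r. 0 < r \<longrightarrow> r < r0 \<longrightarrow>
          (\<exists>d>0. \<forall>s\<in>J. dist s t < d \<longrightarrow> finite {x \<in> ball q r. 0 < m s x} \<and>
            sum (m s) {x \<in> ball q r. 0 < m s x} = m t q)"
          using bspec[OF cm[unfolded continuous_multiset_def] tJ, rule_format, of q] by auto
        have sub: "ball q r \<subseteq> ball p e" if "r < e - dist p q" for r
        proof
          fix x assume "x \<in> ball q r"
          then show "x \<in> ball p e" using dist_triangle[of p x q] that by (simp add: dist_commute)
        qed
        show ?thesis
        proof (rule exI[of _ "min r0 (e - dist p q)"], intro conjI allI impI)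
          fix r assume r: "0 < r" "r < min r0 (e - dist p q)"
          then obtain d where "d > 0" and d: "\<forall>s\<in>J. dist s t < d \<longrightarrow> finite {x \<in> ball q r. 0 < m s x} \<and>
            sum (m s) {x \<in> ball q r. 0 < m s x} = m t q"
            using r0(2)[rule_format, of r] by auto
          then show "\<exists>d>0. \<forall>s\<in>J'. dist s t < d \<longrightarrow> finite {x \<in> ball q r. 0 < m s x} \<and>
            sum (m s) {x \<in> ball q r. 0 < m s x} = m t q"
            using J'(3) by (intro exI[of _ d] conjI ballI) auto
        qed (use r0 q sub in auto)
      qed
      have near: "\<exists>d>0. \<forall>s\<in>J'. dist s t < d \<longrightarrow> S s \<subseteq> ball q r" if t: "t \<in> J'" "q \<in> S t" "m t q = k" and r: "0 < r" for t q r
      proof -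
        have qp: "q \<in> ball p e" using t by (auto simp: S_def)
        obtain r0 where r0: "r0 > 0" "\<forall>r. 0 < r \<longrightarrow> r < r0 \<longrightarrow> ball q r \<subseteq> ball p e \<and>
          (\<exists>d>0. \<forall>s\<in>J'. dist s t < d \<longrightarrow> finite {x \<in> ball q r. 0 < m s x} \<and>
            sum (m s) {x \<in> ball q r. 0 < m s x} = m t q)"
          using iso[OF t(1) qp] by (elim exE conjE)
        define r' where "r' = min r (r0/2)"
        have r': "0 < r'" "r' < r0" "r' \<le> r" using r r0 by (auto simp: r'_def)
        obtain d where d: "d > 0" "\<forall>s\<in>J'. dist s t < d \<longrightarrow> finite {x \<in> ball q r'. 0 < m s x} \<and>
            sum (m s) {x \<in> ball q r'. 0 < m s x} = m t q" and sub: "ball q r' \<subseteq> ball p e"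
          using r0(2)[rule_format, OF r'(1,2)] by auto
        have "S s \<subseteq> ball q r" if s: "s \<in> J'" "dist s t < d" for s
        proof -
          have "S s = {x \<in> ball q r'. 0 < m s x}"
          proof (rule sum_eq_imp_subset_eq[of _ _ "m s"])
            show "{x \<in> ball q r'. 0 < m s x} \<subseteq> S s" using sub unfolding S_def by blast
            show "sum (m s) (S s) = sum (m s) {x \<in> ball q r'. 0 < m s x}"
              using S(2)[OF s(1)] d(2)[rule_format, OF s] t(3) by simp
            show "finite (S s)" by (rule S(1)[OF s(1)])
          qed (simp add: S_def)
          then show ?thesis using r' by auto
        qed
        then show ?thesis using d by blast
      qed
      have pts: "\<exists>d>0. \<forall>s\<in>J'. dist s t < d \<longrightarrow> S s \<inter> ball q r \<noteq> {}" if t: "t \<in> J'" "q \<in> S t" and r: "0 < r" for t q r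
      proof -
        have qp: "q \<in> ball p e" and mq: "0 < m t q" using t by (auto simp: S_def)
        obtain r0 where r0: "r0 > 0" "\<forall>r. 0 < r \<longrightarrow> r < r0 \<longrightarrow> ball q r \<subseteq> ball p e \<and>
          (\<exists>d>0. \<forall>s\<in>J'. dist s t < d \<longrightarrow> finite {x \<in> ball q r. 0 < m s x} \<and>
            sum (m s) {x \<in> ball q r. 0 < m s x} = m t q)"
          using iso[OF t(1) qp] by (elim exE conjE)
        define r' where "r' = min r (r0/2)"
        have r': "0 < r'" "r' < r0" "r' \<le> r" using r r0 by (auto simp: r'_def)
        obtain d where d: "d > 0" "\<forall>s\<in>J'. dist s t < d \<longrightarrow> finite {x \<in> ball q r'. 0 < m s x} \<and>
            sum (m s) {x \<in> ball q r'. 0 < m s x} = m t q" and sub: "ball q r' \<subseteq> ball p e"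
          using r0(2)[rule_format, OF r'(1,2)] by auto
        have "S s \<inter> ball q r \<noteq> {}" if s: "s \<in> J'" "dist s t < d" for s
        proof -
          have "{x \<in> ball q r'. 0 < m s x} \<noteq> {}"
            using d(2)[rule_format, OF s] mq by (metis less_numeral_extra(3) sum.empty)
          then show ?thesis using sub r'(3) by (force simp: S_def)
        qed
        then show ?thesis using d by blast
      qed
      have oJZ: "open (J' - Z)"
        unfolding open_dist
      proof
        fix t assume t: "t \<in> J' - Z"
        then have tJ: "t \<in> J'" by simp
        have "S t \<noteq> {}" using S(2)[OF tJ] k by auto
        then obtain q1 where q1: "q1 \<in> S t" by auto
        have "S t \<noteq> {q1}" using S(2)[OF tJ] q1 t by (auto simp: Z_def)
        then obtain q2 where q2: "q2 \<in> S t" "q1 \<noteq> q2" using q1 by auto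
        define r where "r = dist q1 q2 / 2"
        have r: "0 < r" using q2 by (simp add: r_def)
        have disj: "ball q1 r \<inter> ball q2 r = {}"
          by (rule disjoint_ballI) (simp add: r_def)
        obtain da where da: "da > 0" "\<forall>s\<in>J'. dist s t < da \<longrightarrow> S s \<inter> ball q1 r \<noteq> {}"
          using pts[OF tJ q1 r] by (elim exE conjE)
        obtain db where db: "db > 0" "\<forall>s\<in>J'. dist s t < db \<longrightarrow> S s \<inter> ball q2 r \<noteq> {}"
          using pts[OF tJ q2(1) r] by (elim exE conjE)
        obtain dc where dc: "dc > 0" "ball t dc \<subseteq> J'" using J'(1) tJ by (meson open_contains_ball)
        have "s \<in> J' - Z" if s: "dist s t < min da (min db dc)" for s
        proof -
          have sJ: "s \<in> J'" using s dc by (auto simp: dist_commute)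
          moreover have "s \<notin> Z"
          proof
            assume "s \<in> Z"
            then obtain q where "q \<in> S s" "m s q = k" by (auto simp: Z_def)
            then have "S s = {q}" using uniq sJ by blast
            then have "q \<in> ball q1 r" "q \<in> ball q2 r" using da(2) db(2) sJ s by auto
            then show False using disj by blast
          qed
          ultimately show ?thesis by simp
        qed
        then show "\<exists>e>0. \<forall>y. dist y t < e \<longrightarrow> y \<in> J' - Z"
          using da(1) db(1) dc(1) by (intro exI[of _ "min da (min db dc)"]) auto
      qed
      define m' where "m' t q = (if q \<in> ball p e then m t q else 0)" for t q
      have m'S: "0 < m' t q \<longleftrightarrow> q \<in> S t" for t q by (auto simp: m'_def S_def)
      define comp where "comp t = connected_component_set (J' - Z) t" for t
      have comp: "open (comp t)" "is_interval (comp t)" "comp t \<subseteq> J' - Z" for t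
        unfolding comp_def is_interval_connected_1
        using open_connected_component[OF oJZ] connected_component_subset[of "J' - Z"]
        by (simp_all only: connected_connected_component)
      have ex: "\<exists>c. selection m' (comp t) c" if t: "t \<in> J' - Z" for t
      proof -
        have tJ: "t \<in> J'" using t by simp
        have "S t \<noteq> {}" using S(2)[OF tJ] k by auto
        then obtain q where q: "0 < m' t q" using m'S by auto
        have cm': "continuous_multiset (comp t) m'"
          unfolding continuous_multiset_def
        proof (intro ballI allI)
          fix s x assume "s \<in> comp t"
          then have s: "s \<in> J'" using comp by auto
          show "\<exists>r0>0. \<forall>r>0. r < r0 \<longrightarrow> (\<exists>d>0. \<forall>u\<in>comp t. dist u s < d \<longrightarrow>
             finite {y \<in> ball x r. 0 < m' u y} \<and> sum (m' u) {y \<in> ball x r. 0 < m' u y} = m' s x)"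
          proof (cases "x \<in> ball p e")
            case True
            obtain r0 where r0: "r0 > 0" "\<forall>r. 0 < r \<longrightarrow> r < r0 \<longrightarrow> ball x r \<subseteq> ball p e \<and>
              (\<exists>d>0. \<forall>u\<in>J'. dist u s < d \<longrightarrow> finite {y \<in> ball x r. 0 < m u y} \<and>
                sum (m u) {y \<in> ball x r. 0 < m u y} = m s x)"
              using iso[OF s True] by (elim exE conjE)
            show ?thesis
            proof (rule exI[of _ r0], intro conjI allI impI r0(1))
              fix r assume r: "0 < r" "r < r0"
              obtain d where d: "d > 0" "\<forall>u\<in>J'. dist u s < d \<longrightarrow> finite {y \<in> ball x r. 0 < m u y} \<and>
                sum (m u) {y \<in> ball x r. 0 < m u y} = m s x" and sub: "ball x r \<subseteq> ball p e"
                using r0(2)[rule_format, OF r] by auto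
              have "{y \<in> ball x r. 0 < m' u y} = {y \<in> ball x r. 0 < m u y}" for u
                using sub by (auto simp: m'_def)
              moreover have "sum (m' u) {y \<in> ball x r. 0 < m u y} = sum (m u) {y \<in> ball x r. 0 < m u y}" for u
                using sub by (intro sum.cong) (auto simp: m'_def)
              moreover have "m' s x = m s x" using True by (simp add: m'_def)
              ultimately show "\<exists>d>0. \<forall>u\<in>comp t. dist u s < d \<longrightarrow>
                finite {y \<in> ball x r. 0 < m' u y} \<and> sum (m' u) {y \<in> ball x r. 0 < m' u y} = m' s x"
                using d comp(3)[of t] by (intro exI[of _ d]) auto
            qed
          next
            case False
            have empty: "{y \<in> ball x r. 0 < m' u y} = {}" if "r < e - e'" "u \<in> comp t" for r u
            proof -
              have False if "y \<in> ball x r" "0 < m' u y" for y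
              proof -
                have "y \<in> ball p e'" using S(3)[of u] comp(3)[of t] \<open>u \<in> comp t\<close> that m'S by blast
                then show False using that(1) False \<open>r < e - e'\<close> dist_triangle[of p x y] by (simp add: dist_commute)
              qed
              then show ?thesis by blast
            qed
            have z: "m' s x = 0" using False by (simp add: m'_def)
            show ?thesis
            proof (rule exI[of _ "e - e'"], intro conjI allI impI)
              fix r assume r: "r < e - e'"
              show "\<exists>d>0. \<forall>u\<in>comp t. dist u s < d \<longrightarrow>
                finite {y \<in> ball x r. 0 < m' u y} \<and> sum (m' u) {y \<in> ball x r. 0 < m' u y} = m' s x"
                by (intro exI[of _ 1] conjI ballI impI) (simp_all only: empty[OF r] z finite.emptyI sum.empty zero_less_one)
            qed (use e in simp)
          qed
        qed
        have ls': "locally_selectable (comp t) m'"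
          unfolding locally_selectable_def
        proof (intro ballI allI impI)
          fix s x assume s: "s \<in> comp t" and "0 < m' s x"
          then have x: "x \<in> S s" by (simp add: m'S)
          have sJ: "s \<in> J'" "s \<in> J" "s \<notin> Z" using s comp(3)[of t] J' by auto
          have "m s x \<noteq> k" using x sJ by (auto simp: Z_def)
          then have lt: "m s x < k" using mle[OF sJ(1) x] by simp
          have "0 < m s x" using x by (auto simp: S_def)
          then obtain da c where da: "da > 0" "ball s da \<subseteq> J" and c: "selection m (ball s da) c" "c s = x"
            using less.IH[OF lt, rule_format, OF sJ(2) refl] by auto
          have "continuous_on (ball s da) c" using c by (simp add: selection_def)
          then have "isCont c s" using da by (simp add: continuous_on_eq_continuous_at)
          moreover have "x \<in> ball p e" using x by (simp add: S_def)
          ultimately have "\<forall>\<^sub>F u in nhds s. c u \<in> ball p e"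
            using c(2) by (auto simp: isCont_def tendsto_at_iff_tendsto_nhds intro!: topological_tendstoD simp del: mem_ball)
          then obtain db where db: "db > 0" "\<And>u. dist u s < db \<Longrightarrow> c u \<in> ball p e"
            by (auto simp: eventually_nhds_metric simp del: mem_ball)
          obtain dc where dc: "dc > 0" "ball s dc \<subseteq> comp t" using comp(1) s by (meson open_contains_ball)
          define d where "d = min da (min db dc)"
          have "selection m' (ball s d) c"
            unfolding selection_def
          proof (intro conjI ballI)
            show "continuous_on (ball s d) c" using c by (auto simp: selection_def d_def intro: continuous_on_subset)
            fix u assume u: "u \<in> ball s d"
            have "0 < m u (c u)" using u c by (auto simp: selection_def d_def)
            moreover have "c u \<in> ball p e" using db(2)[of u] u by (auto simp: d_def dist_commute)
            ultimately show "0 < m' u (c u)" by (simp add: m'_def)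
          qed
          then show "\<exists>d>0. \<exists>c. ball s d \<subseteq> comp t \<and> selection m' (ball s d) c \<and> c s = x"
            using c dc da db by (intro exI[of _ d] conjI exI[of _ c]) (auto simp: d_def)
        qed
        have bdd: "bounded (c ` U)" if "selection m' U c" for U c
        proof (rule bounded_subset[of "ball p e"])
          show "c ` U \<subseteq> ball p e" using that m'S by (auto simp: selection_def S_def)
        qed simp
        have ne': "non_escaping (comp t) m'"
          unfolding non_escaping_def using bdd by (intro ballI exI[of _ 1]) auto
        have "t \<in> comp t" using t by (simp add: comp_def)
        from selection_on_interval[OF cm' ls' ne' comp(2) this q] show ?thesis by (elim exE conjE) (rule exI)
      qed
      define cc where "cc C = (SOME c. selection m' C c)" for C
      have cc: "selection m' (comp t) (cc (comp t))" if "t \<in> J' - Z" for t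
        unfolding cc_def by (rule someI_ex[OF ex[OF that]])
      define c where "c t = (if t \<in> Z then (SOME q. q \<in> S t \<and> m t q = k) else cc (comp t) t)" for t
      have cZ: "c t \<in> S t \<and> m t (c t) = k" if "t \<in> Z" for t
      proof -
        have "\<exists>q. q \<in> S t \<and> m t q = k" using that by (auto simp: Z_def)
        from someI_ex[OF this] show ?thesis using that by (simp add: c_def)
      qed
      have self: "t \<in> comp t" if "t \<in> J' - Z" for t using that by (simp add: comp_def)
      have cS: "c t \<in> S t" if "t \<in> J'" for t
      proof (cases "t \<in> Z")
        case False
        then have "0 < m' t (cc (comp t) t)" using cc[of t] self[of t] that by (auto simp: selection_def)
        then show ?thesis using False by (simp add: m'S c_def)
      qed (use cZ in blast)
      have "isCont c t" if t: "t \<in> J'" for t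
      proof (cases "t \<in> Z")
        case False
        then have t': "t \<in> J' - Z" using t by simp
        have "continuous_on (comp t) (cc (comp t))" using cc[OF t'] by (simp add: selection_def)
        then have "isCont (cc (comp t)) t" using comp(1) self[OF t'] by (simp add: continuous_on_eq_continuous_at)
        moreover have "c u = cc (comp t) u" if u: "u \<in> comp t" for u
        proof -
          have "comp u = comp t" using u unfolding comp_def by (metis connected_component_eq)
          moreover have "u \<notin> Z" using comp(3) u by auto
          ultimately show ?thesis by (simp add: c_def)
        qed
        then have "\<forall>\<^sub>F u in nhds t. c u = cc (comp t) u"
          using eventually_nhds_in_open[OF comp(1) self[OF t']] by (auto elim: eventually_mono)
        ultimately show ?thesis using isCont_cong by blast
      next
        case True
        show ?thesis
          unfolding continuous_at_eps_delta
        proof (intro allI impI)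
          fix r :: real assume r: "0 < r"
          obtain d where d: "d > 0" "\<forall>s\<in>J'. dist s t < d \<longrightarrow> S s \<subseteq> ball (c t) r"
            using near[OF t _ _ r, of "c t"] cZ[OF True] by auto
          obtain db where db: "db > 0" "ball t db \<subseteq> J'" using J'(1) t by (meson open_contains_ball)
          have "dist (c s) (c t) < r" if "dist s t < min d db" for s
          proof -
            have "s \<in> J'" using that db by (auto simp: dist_commute)
            then show ?thesis using d(2) cS[of s] that by (auto simp: dist_commute subset_iff)
          qed
          then show "\<exists>d>0. \<forall>s. dist s t < d \<longrightarrow> dist (c s) (c t) < r"
            using d db by (intro exI[of _ "min d db"]) auto
        qed
      qed
      then have "continuous_on J' c" by (simp add: continuous_at_imp_continuous_on)
      moreover have "0 < m t (c t)" if "t \<in> J'" for t using cS[OF that] by (simp add: S_def)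
      ultimately have sel: "selection m J' c" by (simp add: selection_def)
      have pS: "p \<in> S t0" using e k by (auto simp: S_def)
      have "S t0 = {p}" by (rule uniq[OF J'(2) pS k(1)])
      then have "c t0 = p" using cS[OF J'(2)] by simp
      then show "\<exists>d>0. \<exists>c. ball t0 d \<subseteq> J \<and> selection m (ball t0 d) c \<and> c t0 = p"
        using sel J'(3) d0 d1 by (intro exI[of _ "min d0 d1"] conjI exI[of _ c]) (auto simp: J'_def)
    qed
  qed
  then show ?thesis unfolding locally_selectable_def by simp
qed

text \<open>
  A curve that enters a small ball around \<open>p\<close> near time \<open>t0\<close> is caught behind the empty shell and
  passes through \<open>p\<close> at \<open>t0\<close>. So the number of curves in the ball does not depend on the time.
\<close>

lemma continuous_multiset_residual:
  fixes m :: "real \<Rightarrow> 'p::metric_space \<Rightarrow> nat"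
  assumes cm: "continuous_multiset UNIV m"
    and cont: "\<And>l. l \<in> L \<Longrightarrow> continuous_on UNIV (f l)"
    and cnt: "\<And>t q. finite {l \<in> L. f l t = q} \<and> card {l \<in> L. f l t = q} \<le> m t q"
  shows "continuous_multiset UNIV (\<lambda>t q. m t q - card {l \<in> L. f l t = q})"
  unfolding continuous_multiset_def
proof (intro ballI allI)
  fix t0 p
  define r where "r t q = m t q - card {l \<in> L. f l t = q}" for t q
  have pos: "0 < m t (f l t)" if "l \<in> L" for l t
  proof -
    have "{k \<in> L. f k t = f l t} \<noteq> {}" using that by auto
    then have "0 < card {k \<in> L. f k t = f l t}" using cnt[of t "f l t"] by (simp add: card_gt_0_iff)
    then show ?thesis using cnt[of t "f l t"] by simp
  qed
  obtain e0 where e0: "e0 > 0" and iso0: "\<forall>e e'. 0 < e' \<longrightarrow> e' \<le> e \<longrightarrow> e < e0 \<longrightarrow>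
       (\<exists>d>0. \<forall>t\<in>UNIV. dist t t0 < d \<longrightarrow>
           finite {q \<in> ball p e. 0 < m t q} \<and> sum (m t) {q \<in> ball p e. 0 < m t q} = m t0 p
           \<and> {q \<in> ball p e. 0 < m t q} \<subseteq> ball p e')"
    using continuous_multiset_isolated[OF cm UNIV_I, of t0 p] by (elim exE conjE)
  show "\<exists>e0>0. \<forall>e>0. e < e0 \<longrightarrow> (\<exists>d>0. \<forall>t\<in>UNIV. dist t t0 < d \<longrightarrow>
      finite {q \<in> ball p e. 0 < m t q - card {l \<in> L. f l t = q}} \<and>
      (\<Sum>q | q \<in> ball p e \<and> 0 < m t q - card {l \<in> L. f l t = q}. m t q - card {l \<in> L. f l t = q})
        = m t0 p - card {l \<in> L. f l t0 = p})"
    unfolding r_def[symmetric]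
  proof (rule exI[of _ e0], intro conjI allI impI e0)
    fix e :: real assume e: "0 < e" "e < e0"
    define B where "B t = {q \<in> ball p e. 0 < m t q}" for t
    obtain d where d: "d > 0" and B: "\<And>t. dist t t0 < d \<Longrightarrow> finite (B t) \<and> sum (m t) (B t) = m t0 p \<and> B t \<subseteq> ball p (e/2)"
      using iso0[rule_format, of "e/2" e] e unfolding B_def by auto
    have fB: "f l t \<in> B t \<longleftrightarrow> dist p (f l t) < e" if "l \<in> L" for l t
      using pos[OF that] by (simp add: B_def)
    have stay: "dist p (f l t) < e / 2" if l: "l \<in> L" and s: "dist s t0 < d" "dist p (f l s) < e" and t: "dist t t0 < d" for l s t
    proof (rule confined[of "ball t0 d" "f l" s p "e/2" e])
      show "continuous_on (ball t0 d) (f l)" using cont[OF l] by (rule continuous_on_subset) simp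
      show "connected (ball t0 d)" by (rule convex_connected) (rule convex_ball)
      show *: "dist p (f l u) < e / 2" if "u \<in> ball t0 d" "dist p (f l u) < e" for u
        using B[of u] fB[OF l, of u] that by (auto simp: dist_commute subset_iff)
      show "dist p (f l s) < e/2" using *[of s] s by (simp add: dist_commute)
    qed (use s t e in \<open>auto simp: dist_commute\<close>)
    have at0: "f l t0 = p" if l: "l \<in> L" and "dist p (f l t0) < e" for l
    proof (rule ccontr)
      assume ne: "f l t0 \<noteq> p"
      have fl: "f l t0 \<in> B t0" using fB[OF l] that by simp
      have Bt: "finite (B t0)" "sum (m t0) (B t0) = m t0 p" using B[of t0] d by auto
      have "m t0 p = m t0 (f l t0) + sum (m t0) (B t0 - {f l t0})"
        using sum.remove[OF Bt(1) fl, of "m t0"] Bt(2) by simp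
      moreover have "m t0 p \<le> sum (m t0) (B t0 - {f l t0})"
      proof (cases "m t0 p = 0")
        case False
        then have "p \<in> B t0 - {f l t0}" using ne e by (auto simp: B_def)
        then show ?thesis by (rule member_le_sum) (use Bt in auto)
      qed simp
      ultimately show False using pos[OF l, of t0] by simp
    qed
    have sets: "{l \<in> L. f l t \<in> B t} = {l \<in> L. f l t0 = p}" if t: "dist t t0 < d" for t
    proof -
      have "f l t \<in> B t \<longleftrightarrow> f l t0 = p" if l: "l \<in> L" for l
      proof
        assume "f l t \<in> B t"
        then have "dist p (f l t) < e" using fB l by simp
        then have "dist p (f l t0) < e / 2" using stay[OF l t _ ] d by simp
        then show "f l t0 = p" using at0[OF l] e by simp
      next
        assume "f l t0 = p"
        then have "dist p (f l t) < e / 2" using stay[OF l _ _ t, of t0] d e by simp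
        then show "f l t \<in> B t" using fB l e by simp
      qed
      then show ?thesis by auto
    qed
    have main: "finite {q \<in> ball p e. 0 < r t q} \<and> sum (r t) {q \<in> ball p e. 0 < r t q} = r t0 p"
      if t: "dist t t0 < d" for t
    proof -
      have fin: "finite (B t)" and sm: "sum (m t) (B t) = m t0 p" using B[OF t] by auto
      have sub: "{q \<in> ball p e. 0 < r t q} \<subseteq> B t" by (auto simp: B_def r_def)
      have "sum (r t) {q \<in> ball p e. 0 < r t q} = sum (r t) (B t)"
        by (rule sum.mono_neutral_left[OF fin sub]) (auto simp: B_def)
      also have "\<dots> = sum (m t) (B t) - (\<Sum>q\<in>B t. card {l \<in> L. f l t = q})"
        unfolding r_def by (rule sum_subtractf_nat) (use cnt in auto)
      also have "(\<Sum>q\<in>B t. card {l \<in> L. f l t = q}) = card (\<Union>q\<in>B t. {l \<in> L. f l t = q})"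
        by (rule card_UN_disjoint[symmetric]) (use fin cnt in auto)
      also have "(\<Union>q\<in>B t. {l \<in> L. f l t = q}) = {l \<in> L. f l t \<in> B t}" by auto
      also have "\<dots> = {l \<in> L. f l t0 = p}" by (rule sets[OF t])
      finally have "sum (r t) {q \<in> ball p e. 0 < r t q} = r t0 p" using sm by (simp add: r_def)
      then show ?thesis using finite_subset[OF sub fin] by simp
    qed
    show "\<exists>d>0. \<forall>t\<in>UNIV. dist t t0 < d \<longrightarrow> finite {q \<in> ball p e. 0 < r t q} \<and> sum (r t) {q \<in> ball p e. 0 < r t q} = r t0 p"
      using d main by blast
  qed
qed

lemma countable_support:
  fixes m :: "real \<Rightarrow> 'p::{metric_space, second_countable_topology} \<Rightarrow> nat"
  assumes "continuous_multiset UNIV m"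
  shows "countable {q. 0 < m t q}"
proof -
  have "\<exists>e>0. finite {q \<in> ball p e. 0 < m t q}" for p
  proof -
    obtain e0 where e0: "e0 > 0" and *: "\<And>e. 0 < e \<Longrightarrow> e < e0 \<Longrightarrow>
        (\<exists>d>0. \<forall>s\<in>UNIV. dist s t < d \<longrightarrow>
           finite {q \<in> ball p e. 0 < m s q} \<and> sum (m s) {q \<in> ball p e. 0 < m s q} = m t p)"
      using bspec[OF assms[unfolded continuous_multiset_def] UNIV_I, rule_format, of t p] by auto
    obtain d where "d > 0" and "\<forall>s\<in>UNIV. dist s t < d \<longrightarrow>
           finite {q \<in> ball p (e0/2). 0 < m s q} \<and> sum (m s) {q \<in> ball p (e0/2). 0 < m s q} = m t p"
      using *[of "e0/2"] e0 by auto
    then have "finite {q \<in> ball p (e0/2). 0 < m t q}" by auto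
    then show ?thesis using e0 by (intro exI[of _ "e0/2"]) auto
  qed
  then obtain e where e: "\<And>p. e p > 0" "\<And>p. finite {q \<in> ball p (e p). 0 < m t q}" by metis
  have "\<And>S. S \<in> range (\<lambda>p. ball p (e p)) \<Longrightarrow> open S" by auto
  then obtain F' where F': "F' \<subseteq> range (\<lambda>p. ball p (e p))" "countable F'" "\<Union>F' = (\<Union>p. ball p (e p))"
    by (rule Lindelof)
  have "{q. 0 < m t q} \<subseteq> (\<Union>S\<in>F'. {q \<in> S. 0 < m t q})"
  proof
    fix q assume "q \<in> {q. 0 < m t q}"
    moreover have "q \<in> \<Union>F'" unfolding F'(3) using e(1)[of q] by (auto intro!: exI[of _ q])
    ultimately show "q \<in> (\<Union>S\<in>F'. {q \<in> S. 0 < m t q})" by auto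
  qed
  moreover have "countable (\<Union>S\<in>F'. {q \<in> S. 0 < m t q})"
  proof (rule countable_UN[OF F'(2)])
    fix S assume "S \<in> F'"
    then obtain p where "S = ball p (e p)" using F'(1) by blast
    then show "countable {q \<in> S. 0 < m t q}" using countable_finite[OF e(2)[of p]] by simp
  qed
  ultimately show ?thesis by (rule countable_subset)
qed

text \<open>
  Every curve passes through time \<open>0\<close>, so it is enough to use up the countably many points present at
  time \<open>0\<close>; \<open>K\<close> lists them with repetitions.
\<close>

theorem continuous_multiset_parametrization:
  fixes m :: "real \<Rightarrow> 'p::euclidean_space \<Rightarrow> nat"
  assumes cm: "continuous_multiset UNIV m" and ne: "non_escaping UNIV m"
  shows "\<exists>(N::enat) c. (\<forall>i. enat i < N \<longrightarrow> continuous_on UNIV (c i)) \<and>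
    (\<forall>t q. finite {i. enat i < N \<and> c i t = q} \<and> card {i. enat i < N \<and> c i t = q} = m t q)"
proof -
  define K where "K = {(q, j). j < m 0 q}"
  have cK: "countable K"
  proof (rule countable_subset)
    show "K \<subseteq> {q. 0 < m 0 q} \<times> UNIV" by (auto simp: K_def)
    show "countable ({q. 0 < m 0 q} \<times> (UNIV :: nat set))" using countable_support[OF cm] by auto
  qed
  define e where "e = to_nat_on K"
  have inj: "inj_on e K" unfolding e_def by (rule inj_on_to_nat_on[OF cK])
  define D where "D n = {l \<in> K. e l < n}" for n
  define good where "good n f \<longleftrightarrow> (\<forall>l\<in>D n. continuous_on UNIV (f l) \<and> f l 0 = fst l) \<and>
     (\<forall>t q. finite {l \<in> D n. f l t = q} \<and> card {l \<in> D n. f l t = q} \<le> m t q)" for n and f :: "'p \<times> nat \<Rightarrow> real \<Rightarrow> 'p"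
  have finD: "finite (D n)" for n
  proof (rule inj_on_finite[of e _ "{..<n}"])
    show "inj_on e (D n)" using inj by (rule inj_on_subset) (auto simp: D_def)
  qed (auto simp: D_def)
  have sel_ex: "\<exists>c. selection r UNIV c \<and> c t = q"
    if "continuous_multiset UNIV r" "\<And>t q. r t q \<le> m t q" "0 < r t q" for r t q
  proof (rule selection_on_interval[OF that(1) _ _ is_interval_univ UNIV_I that(3)])
    show "locally_selectable UNIV r" by (rule locally_selectable_of_continuous[OF open_UNIV that(1)])
    show "non_escaping UNIV r"
      by (rule non_escaping_mono[OF ne order_refl]) (use that(2) in \<open>meson less_le_trans\<close>)
  qed
  have step: "\<exists>f'. good (Suc n) f' \<and> (\<forall>l\<in>D n. f' l = f l)" if f: "good n f" for n f
  proof (cases "\<exists>l0\<in>K. e l0 = n")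
    case False
    then have "D (Suc n) = D n" by (auto simp: D_def less_Suc_eq)
    then have "good (Suc n) f" using f by (simp add: good_def)
    then show ?thesis by blast
  next
    case True
    then obtain l0 where l0: "l0 \<in> K" "e l0 = n" by blast
    have D: "D (Suc n) = insert l0 (D n)"
      using l0 inj by (auto simp: D_def less_Suc_eq inj_on_def)
    have l0n: "l0 \<notin> D n" using l0 by (simp add: D_def)
    define r where "r t q = m t q - card {l \<in> D n. f l t = q}" for t q
    have cr: "continuous_multiset UNIV r"
      unfolding r_def by (rule continuous_multiset_residual[OF cm]) (use f in \<open>auto simp: good_def\<close>)
    let ?B = "{fst l0} \<times> {..<m 0 (fst l0)}"
    have sub: "{l \<in> D n. f l 0 = fst l0} \<subseteq> ?B - {l0}"
      using f l0n by (auto simp: good_def D_def K_def)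
    have "l0 \<in> ?B" using l0 by (auto simp: K_def)
    then have "card (?B - {l0}) < card ?B" by (intro card_Diff1_less) auto
    moreover have "card {l \<in> D n. f l 0 = fst l0} \<le> card (?B - {l0})" by (rule card_mono[OF _ sub]) auto
    ultimately have rp: "0 < r 0 (fst l0)" by (simp add: r_def)
    have "r t q \<le> m t q" for t q by (simp add: r_def)
    from sel_ex[OF cr this rp] obtain c where c: "selection r UNIV c" "c 0 = fst l0" by (elim exE conjE)
    have old: "(f(l0 := c)) l = f l" if "l \<in> D n" for l using that l0n by auto
    have "good (Suc n) (f(l0 := c))"
      unfolding good_def D
    proof (intro conjI ballI allI)
      fix l assume "l \<in> insert l0 (D n)"
      then show "continuous_on UNIV ((f(l0 := c)) l)" "(f(l0 := c)) l 0 = fst l"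
        using f c old[of l] by (auto simp: good_def selection_def)
    next
      fix t q
      have eq: "{l \<in> insert l0 (D n). (f(l0 := c)) l t = q} =
          {l \<in> D n. f l t = q} \<union> (if c t = q then {l0} else {})"
        using l0n by auto
      show "finite {l \<in> insert l0 (D n). (f(l0 := c)) l t = q}" using finD by simp
      have cn: "card {l \<in> D n. f l t = q} \<le> m t q" using f by (simp add: good_def)
      show "card {l \<in> insert l0 (D n). (f(l0 := c)) l t = q} \<le> m t q"
      proof (cases "c t = q")
        case True
        then have "0 < r t q" using c by (auto simp: selection_def)
        then show ?thesis unfolding eq using True finD l0n by (simp add: r_def)
      next
        case False
        then show ?thesis unfolding eq using cn by simp
      qed
    qed
    then show ?thesis using old by blast
  qed
  have "\<exists>F. \<forall>n. good n (F n) \<and> (\<forall>l\<in>D n. F (Suc n) l = F n l)"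
  proof (rule dependent_nat_choice)
    show "\<exists>f. good 0 f" by (simp add: good_def D_def)
  qed (rule step)
  then obtain F where F: "\<And>n. good n (F n)" "\<And>n l. l \<in> D n \<Longrightarrow> F (Suc n) l = F n l" by (elim exE) blast
  have stable: "F n l = F k l" if "l \<in> D k" "k \<le> n" for k n l
    using that(2) by (induction n rule: dec_induct) (use F(2) that(1) in \<open>auto simp: D_def\<close>)
  define g where "g l = F (Suc (e l)) l" for l
  have gF: "g l = F n l" if "l \<in> D n" for l n
    unfolding g_def using stable[of l "Suc (e l)" n] that by (auto simp: D_def)
  have KD: "l \<in> D (Suc (e l))" if "l \<in> K" for l using that by (simp add: D_def)
  have gc: "continuous_on UNIV (g l)" "g l 0 = fst l" if "l \<in> K" for l
    using F(1)[of "Suc (e l)"] KD[OF that] unfolding g_def good_def by auto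
  have gcard: "finite {l \<in> K. g l t = q} \<and> card {l \<in> K. g l t = q} \<le> m t q" for t q
  proof (rule finite_if_finite_subsets_card_bdd)
    fix G assume G: "G \<subseteq> {l \<in> K. g l t = q}" "finite G"
    define n where "n = Suc (Max (insert 0 (e ` G)))"
    have "e l < n" if "l \<in> G" for l
      unfolding n_def using G(2) that by (simp add: less_Suc_eq_le Max_ge)
    then have GD: "l \<in> D n" if "l \<in> G" for l using G(1) that by (auto simp: D_def)
    have "F n l t = q" if "l \<in> G" for l using gF[OF GD[OF that]] G(1) that by auto
    then have "G \<subseteq> {l \<in> D n. F n l t = q}" using GD by blast
    then have "card G \<le> card {l \<in> D n. F n l t = q}" using finD by (intro card_mono) auto
    also have "\<dots> \<le> m t q" using F(1)[of n] by (simp add: good_def)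
    finally show "card G \<le> m t q" .
  qed
  define r where "r t q = m t q - card {l \<in> K. g l t = q}" for t q
  have cr: "continuous_multiset UNIV r"
    unfolding r_def by (rule continuous_multiset_residual[OF cm gc(1) gcard])
  have r0: "r 0 q = 0" for q
  proof -
    have "{l \<in> K. g l 0 = q} = {q} \<times> {..<m 0 q}" using gc(2) by (auto simp: K_def)
    then show ?thesis by (simp add: r_def)
  qed
  have "r t q = 0" for t q
  proof (rule ccontr)
    assume "r t q \<noteq> 0"
    then have "\<exists>c. selection r UNIV c \<and> c t = q" by (intro sel_ex cr) (auto simp: r_def)
    then obtain c where "selection r UNIV c" by blast
    then have "0 < r 0 (c 0)" by (auto simp: selection_def)
    then show False using r0 by simp
  qed
  then have full: "card {l \<in> K. g l t = q} = m t q" for t q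
    using gcard[of t q] by (simp add: r_def le_antisym)
  obtain N :: enat and h where h: "bij_betw h {i. enat i < N} K"
  proof (cases "finite K")
    case True
    then obtain h where "bij_betw h {0..<card K} K" using ex_bij_betw_nat_finite by blast
    then show ?thesis by (intro that[of h "enat (card K)"]) (simp add: atLeast0LessThan lessThan_def)
  next
    case False
    then show ?thesis using bij_betw_from_nat_into[OF cK False] by (intro that[of _ \<infinity>]) simp
  qed
  have bij: "bij_betw h {i. enat i < N \<and> g (h i) t = q} {l \<in> K. g l t = q}" for t q
    by (rule bij_betw_subset[OF h]) (use h in \<open>auto simp: bij_betw_def\<close>)
  show ?thesis
  proof (intro exI[of _ N] exI[of _ "\<lambda>i. g (h i)"] conjI allI impI)
    show "continuous_on UNIV (g (h i))" if "enat i < N" for i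
      by (rule gc) (use h that in \<open>auto simp: bij_betw_def\<close>)
    fix t q
    show "finite {i. enat i < N \<and> g (h i) t = q}" using bij_betw_finite[OF bij] gcard by blast
    show "card {i. enat i < N \<and> g (h i) t = q} = m t q" using bij_betw_same_card[OF bij] full by simp
  qed
qed

section \<open>Orthonormal sets and dimensions in a complex Hilbert space\<close>

lemma cinner_scaleC_right: "cinner x (a *\<^sub>C y) = cnj a * cinner x y"
  by (metis cinner_commute cinner_scaleC_left complex_cnj_mult)

lemma cinner_add_right: "cinner x (y + w) = cinner x y + cinner x w"
  by (metis cinner_add_left cinner_commute complex_cnj_add)

lemma cinner_self: "cinner x x = complex_of_real ((norm x)\<^sup>2)"
proof -
  have "Im (cinner x x) = 0" using cinner_commute[of x x] by (metis cnj.simps(2) equal_neg_zero)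
  moreover have "Re (cinner x x) = (norm x)\<^sup>2" by (simp add: inner_eq_Re_cinner[symmetric] power2_norm_eq_inner)
  ultimately show ?thesis by (simp add: complex_eq_iff)
qed

lemma norm_scaleC: "norm (a *\<^sub>C x) = cmod a * norm x"
proof -
  have "complex_of_real ((norm (a *\<^sub>C x))\<^sup>2) = (a * cnj a) * cinner x x"
    by (simp only: cinner_self[symmetric] cinner_scaleC_left cinner_scaleC_right ac_simps)
  also have "\<dots> = complex_of_real ((cmod a * norm x)\<^sup>2)"
    by (simp add: complex_norm_square[symmetric] cinner_self power_mult_distrib)
  finally have "(norm (a *\<^sub>C x))\<^sup>2 = (cmod a * norm x)\<^sup>2" by (simp only: of_real_eq_iff)
  then show ?thesis by (rule power2_eq_imp_eq) simp_all
qed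

lemma cmod_cinner_le: "cmod (cinner x y) \<le> norm x * norm y"
proof (cases "cinner x y = 0")
  case False
  define z where "z = cinner x y"
  define a where "a = cnj z / cmod z"
  have a: "cmod a = 1" using False by (simp add: a_def z_def norm_divide)
  have "cinner (a *\<^sub>C x) y = complex_of_real (cmod z)"
    using False by (simp add: cinner_scaleC_left z_def[symmetric] a_def mult.commute[of "cnj z"]
        complex_norm_square[symmetric] power2_eq_square)
  then have "cmod z = (a *\<^sub>C x) \<bullet> y" by (simp add: inner_eq_Re_cinner)
  also have "\<dots> \<le> norm (a *\<^sub>C x) * norm y" by (rule norm_cauchy_schwarz)
  finally show ?thesis by (simp add: norm_scaleC a z_def)
qed simp

interpretation cinner: bounded_bilinear "cinner :: 'a::complex_hilbert_space \<Rightarrow> 'a \<Rightarrow> complex"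
proof
  fix r :: real and a b :: 'a
  show "cinner (r *\<^sub>R a) b = r *\<^sub>R cinner a b"
    by (simp add: scaleC_of_real[symmetric] cinner_scaleC_left scaleR_conv_of_real)
  show "cinner a (r *\<^sub>R b) = r *\<^sub>R cinner a b"
    by (simp add: scaleC_of_real[symmetric] cinner_scaleC_right scaleR_conv_of_real)
  show "\<exists>K. \<forall>a b :: 'a. cmod (cinner a b) \<le> norm a * norm b * K"
    using cmod_cinner_le by (intro exI[of _ 1]) auto
qed (simp_all add: cinner_add_left cinner_add_right)

interpretation scaleC: bounded_bilinear "scaleC :: complex \<Rightarrow> 'a \<Rightarrow> 'a::complex_hilbert_space"
proof
  fix r :: real and a :: complex and b :: 'a
  show "(r *\<^sub>R a) *\<^sub>C b = r *\<^sub>R (a *\<^sub>C b)"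
    by (simp add: scaleC_of_real[symmetric] scaleC_scaleC scaleR_conv_of_real)
  show "a *\<^sub>C (r *\<^sub>R b) = r *\<^sub>R (a *\<^sub>C b)"
    by (simp add: scaleC_of_real[symmetric] scaleC_scaleC mult.commute)
  show "\<exists>K. \<forall>(a::complex) (b::'a). norm (a *\<^sub>C b) \<le> norm a * norm b * K"
    by (intro exI[of _ 1]) (simp add: norm_scaleC)
qed (simp_all add: scaleC_add_left scaleC_add_right)

lemmas cinner_simps = cinner_add_left cinner_add_right cinner.diff_left cinner.diff_right
  cinner_scaleC_left cinner_scaleC_right cinner.minus_left cinner.minus_right
  cinner.zero_left cinner.zero_right

lemma cinner_eq_zero_commute: "cinner x y = 0 \<longleftrightarrow> cinner y x = 0"
  using cinner_commute[of x y] cinner_commute[of y x] by auto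

lemma cinner_self_eq_0 [simp]: "cinner x x = 0 \<longleftrightarrow> x = 0"
  by (simp add: cinner_self)

lemma orthogonal_of_cinner_eq_0: "cinner x y = 0 \<Longrightarrow> orthogonal x y"
  by (simp add: orthogonal_def inner_eq_Re_cinner)

lemma norm_add_cinner_eq_0: "cinner x y = 0 \<Longrightarrow> (norm (x + y))\<^sup>2 = (norm x)\<^sup>2 + (norm y)\<^sup>2"
  by (rule norm_add_Pythagorean) (rule orthogonal_of_cinner_eq_0)

definition orthonormal :: "'h::complex_hilbert_space set \<Rightarrow> bool" where
  "orthonormal B \<longleftrightarrow> (\<forall>a\<in>B. \<forall>b\<in>B. cinner a b = (if a = b then 1 else 0))"

text \<open>
  Finite dimension comes with an orthonormal basis, because \<open>complex_vector.dim\<close> is zero for spaces of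
  infinite dimension.
\<close>

definition fin_dim :: "'h::complex_hilbert_space set \<Rightarrow> bool" where
  "fin_dim E \<longleftrightarrow> (\<exists>B. finite B \<and> orthonormal B \<and> complex_vector.span B = E)"

definition proj :: "'h::complex_hilbert_space set \<Rightarrow> 'h \<Rightarrow> 'h" where
  "proj B u = (\<Sum>b\<in>B. cinner u b *\<^sub>C b)"

lemma cinner_span_eq_0:
  assumes "\<And>b. b \<in> B \<Longrightarrow> cinner u b = 0" "x \<in> complex_vector.span B"
  shows "cinner u x = 0"
  using assms(2)
  by (induction rule: complex_vector.span_induct_alt) (simp_all add: cinner_simps assms(1))

lemma orthonormal_norm: "orthonormal B \<Longrightarrow> b \<in> B \<Longrightarrow> norm b = 1"
  using cinner_self[of b] unfolding orthonormal_def
  by (metis norm_ge_zero of_real_eq_1_iff power2_eq_1_iff zero_le_one le_minus_one_simps(3))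

lemma orthonormal_nonzero: "orthonormal B \<Longrightarrow> 0 \<notin> B"
  using orthonormal_norm[of B 0] by auto

lemma orthonormal_independent:
  assumes "orthonormal B"
  shows "complex_vector.independent B"
  unfolding complex_vector.dependent_def
proof
  assume "\<exists>a\<in>B. a \<in> complex_vector.span (B - {a})"
  then obtain a where a: "a \<in> B" "a \<in> complex_vector.span (B - {a})" by blast
  have "cinner a a = 0"
    by (rule cinner_span_eq_0[OF _ a(2)]) (use assms a in \<open>auto simp: orthonormal_def\<close>)
  moreover have "cinner a a = 1" using assms a(1) by (simp only: orthonormal_def if_True refl)
  ultimately show False by (metis zero_neq_one)
qed

lemma proj_add: "proj B (u + v) = proj B u + proj B v"
  by (simp add: proj_def cinner_add_left scaleC_add_left sum.distrib)

lemma proj_scale: "proj B (a *\<^sub>C u) = a *\<^sub>C proj B u"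
  by (simp add: proj_def cinner_scaleC_left scaleC_scaleC complex_vector.scale_sum_right)

lemma proj_in_span: "proj B u \<in> complex_vector.span B"
  unfolding proj_def by (intro complex_vector.span_sum complex_vector.span_scale complex_vector.span_base)

lemma proj_orth:
  assumes "finite B" "orthonormal B" "x \<in> complex_vector.span B"
  shows "cinner (u - proj B u) x = 0"
proof (rule cinner_span_eq_0[OF _ assms(3)])
  fix b assume b: "b \<in> B"
  have "cinner (proj B u) b = (\<Sum>c\<in>B. if c = b then cinner u b else 0)"
    unfolding proj_def cinner.sum_left
    by (rule sum.cong) (use assms b in \<open>auto simp: cinner_scaleC_left orthonormal_def\<close>)
  also have "\<dots> = cinner u b" using assms b by simp
  finally show "cinner (u - proj B u) b = 0" by (simp add: cinner_simps)
qed

lemma orthonormal_insert: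
  assumes "finite B" "orthonormal B" "x \<notin> complex_vector.span B"
  shows "\<exists>b. orthonormal (insert b B) \<and> b \<notin> B \<and> complex_vector.span (insert b B) = complex_vector.span (insert x B)"
proof -
  define y where "y = x - proj B x"
  define c where "c = complex_of_real (1 / norm y)"
  define b where "b = c *\<^sub>C y"
  have y0: "y \<noteq> 0" using assms(3) proj_in_span[of B x] by (auto simp: y_def)
  then have c0: "c \<noteq> 0" by (simp add: c_def)
  have "norm b = 1" using y0 by (simp add: b_def c_def norm_scaleC norm_divide)
  then have bb: "cinner b b = 1" by (simp add: cinner_self)
  have yo: "cinner y e = 0" if "e \<in> B" for e
    unfolding y_def by (rule proj_orth[OF assms(1,2) complex_vector.span_base[OF that]])
  then have bo: "cinner b e = 0" "cinner e b = 0" if "e \<in> B" for e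
    using that cinner_eq_zero_commute[of e b] by (simp_all add: b_def cinner_simps)
  have "b \<notin> B" using bb bo[of b] by force
  moreover have "orthonormal (insert b B)"
    using assms(2) bb bo unfolding orthonormal_def by auto
  moreover have "complex_vector.span (insert b B) = complex_vector.span (insert x B)"
    unfolding complex_vector.span_eq
  proof
    have xs: "x \<in> complex_vector.span (insert x B)" and ps: "proj B x \<in> complex_vector.span (insert x B)"
      using proj_in_span[of B x] complex_vector.span_mono[of B "insert x B"] complex_vector.span_base[of x "insert x B"] by auto
    then have "b \<in> complex_vector.span (insert x B)"
      unfolding b_def y_def by (intro complex_vector.span_scale complex_vector.span_diff)
    then show "insert b B \<subseteq> complex_vector.span (insert x B)"
      using complex_vector.span_base[of _ "insert x B"] by auto
    have "x = (1 / c) *\<^sub>C b + proj B x" using c0 by (simp add: b_def scaleC_scaleC y_def)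
    moreover have "(1 / c) *\<^sub>C b + proj B x \<in> complex_vector.span (insert b B)"
      using proj_in_span[of B x] complex_vector.span_mono[of B "insert b B"] complex_vector.span_base[of b "insert b B"]
      by (intro complex_vector.span_add complex_vector.span_scale) auto
    ultimately have "x \<in> complex_vector.span (insert b B)" by simp
    then show "insert x B \<subseteq> complex_vector.span (insert b B)"
      using complex_vector.span_base[of _ "insert b B"] by auto
  qed
  ultimately show ?thesis by blast
qed

text \<open>
  An orthonormal set of maximal cardinality spans, since it could otherwise be enlarged.
\<close>

lemma fin_dim_of_card_bound:
  assumes E: "complex_vector.subspace E"
    and bd: "\<And>B. finite B \<Longrightarrow> orthonormal B \<Longrightarrow> B \<subseteq> E \<Longrightarrow> card B \<le> N"
  shows "fin_dim E \<and> complex_vector.dim E \<le> N"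
proof -
  define P where "P B \<longleftrightarrow> finite B \<and> orthonormal B \<and> B \<subseteq> E" for B
  have "P {}" by (simp add: P_def orthonormal_def)
  moreover have "\<forall>B. P B \<longrightarrow> card B < Suc N" using bd by (simp add: P_def less_Suc_eq_le)
  ultimately have "\<exists>B. P B \<and> (\<forall>C. P C \<longrightarrow> card C \<le> card B)" by (rule Lattices_Big.ex_has_greatest_nat)
  then obtain B where B: "P B" and mx: "\<And>C. P C \<Longrightarrow> card C \<le> card B" by blast
  have "E \<subseteq> complex_vector.span B"
  proof
    fix x assume x: "x \<in> E"
    show "x \<in> complex_vector.span B"
    proof (rule ccontr)
      assume nx: "x \<notin> complex_vector.span B"
      have fB: "finite B" "orthonormal B" "B \<subseteq> E" using B by (simp_all add: P_def)
      obtain b where b: "orthonormal (insert b B)" "b \<notin> B" "complex_vector.span (insert b B) = complex_vector.span (insert x B)"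
        using orthonormal_insert[OF fB(1,2) nx] by blast
      have "complex_vector.span (insert x B) \<subseteq> E"
        by (rule complex_vector.span_minimal) (use x fB E in auto)
      then have "insert b B \<subseteq> E" using b(3) complex_vector.span_superset[of "insert b B"] by auto
      then have "P (insert b B)" using b fB by (simp add: P_def)
      then show False using mx[of "insert b B"] b(2) fB by simp
    qed
  qed
  then have "complex_vector.span B = E"
    using B E complex_vector.span_minimal[of B E] by (auto simp: P_def)
  moreover have "complex_vector.dim E = card B"
    using calculation B by (metis P_def complex_vector.dim_span_eq_card_independent orthonormal_independent)
  ultimately show ?thesis using B bd by (auto simp: P_def fin_dim_def)
qed

lemma fin_dim_subspace: "fin_dim E \<Longrightarrow> complex_vector.subspace E"
  unfolding fin_dim_def by (metis complex_vector.subspace_span)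

lemma fin_dimE:
  assumes "fin_dim E"
  obtains B where "finite B" "orthonormal B" "complex_vector.span B = E" "complex_vector.dim E = card B"
  using assms unfolding fin_dim_def
  by (metis complex_vector.dim_span_eq_card_independent orthonormal_independent)

lemma orthonormal_card_le_dim:
  assumes "fin_dim E" "orthonormal B" "B \<subseteq> E"
  shows "finite B \<and> card B \<le> complex_vector.dim E"
proof -
  obtain C where C: "finite C" "complex_vector.span C = E" "complex_vector.dim E = card C"
    using assms(1) by (rule fin_dimE)
  show ?thesis
    using complex_vector.independent_span_bound[OF C(1) orthonormal_independent[OF assms(2)]] assms(3) C by simp
qed

lemma fin_dim_subset:
  assumes "fin_dim E" "complex_vector.subspace F" "F \<subseteq> E"
  shows "fin_dim F" "complex_vector.dim F \<le> complex_vector.dim E"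
  using fin_dim_of_card_bound[OF assms(2), of "complex_vector.dim E"] orthonormal_card_le_dim[OF assms(1)] assms(3)
  by blast+

lemma orth_decomp:
  assumes "fin_dim E"
  shows "\<exists>p\<in>E. \<forall>e\<in>E. cinner (u - p) e = 0"
proof -
  obtain B where B: "finite B" "orthonormal B" "complex_vector.span B = E"
    using assms unfolding fin_dim_def by (elim exE conjE)
  show ?thesis
    using proj_in_span[of B u] proj_orth[OF B(1,2)] B(3) by (intro bexI[of _ "proj B u"] ballI) simp_all
qed

text \<open>
  The orthogonal projection from \<open>F\<close> to \<open>E\<close> is injective. This is the way in which all multiplicities
  are compared below.
\<close>

lemma dim_le_of_orth_trivial:
  assumes F: "complex_vector.subspace F" and E: "fin_dim E"
    and triv: "\<And>u. u \<in> F \<Longrightarrow> (\<And>e. e \<in> E \<Longrightarrow> cinner u e = 0) \<Longrightarrow> u = 0"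
  shows "fin_dim F" "complex_vector.dim F \<le> complex_vector.dim E"
proof -
  obtain C where C: "finite C" "orthonormal C" "complex_vector.span C = E" "complex_vector.dim E = card C"
    using E by (rule fin_dimE)
  interpret P: module_hom scaleC scaleC "proj C :: 'a \<Rightarrow> 'a"
    by unfold_locales (simp_all add: proj_def cinner_simps scaleC_add_left sum.distrib scaleC_scaleC
        complex_vector.scale_sum_right)
  have "card B \<le> card C" if B: "finite B" "orthonormal B" "B \<subseteq> F" for B
  proof -
    have "complex_vector.span B \<subseteq> F" using B(3) F by (rule complex_vector.span_minimal)
    have inj: "inj_on (proj C) (complex_vector.span B)"
    proof (rule inj_onI)
      fix x y assume xy: "x \<in> complex_vector.span B" "y \<in> complex_vector.span B" "proj C x = proj C y"
      have "x - y = 0"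
      proof (rule triv)
        show "x - y \<in> F" using xy \<open>complex_vector.span B \<subseteq> F\<close> F by (auto intro: complex_vector.subspace_diff)
        fix e assume e: "e \<in> E"
        have "cinner (x - y - proj C (x - y)) e = 0" using proj_orth[OF C(1,2)] e C(3) by simp
        then show "cinner (x - y) e = 0" using xy(3) by (simp add: P.diff)
      qed
      then show "x = y" by simp
    qed
    have "complex_vector.independent (proj C ` B)"
      by (rule P.independent_injective_image[OF orthonormal_independent[OF B(2)] inj])
    moreover have "proj C ` B \<subseteq> complex_vector.span C" using proj_in_span by blast
    ultimately have "card (proj C ` B) \<le> card C"
      using complex_vector.independent_span_bound[OF C(1)] by blast
    moreover have "card (proj C ` B) = card B"
      by (rule card_image) (rule inj_on_subset[OF inj complex_vector.span_superset])
    ultimately show ?thesis by simp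
  qed
  from fin_dim_of_card_bound[OF F this] C(4)
  show "fin_dim F" "complex_vector.dim F \<le> complex_vector.dim E" by auto
qed

lemma dim_orthogonal_family:
  assumes E: "fin_dim E" and U: "\<And>x. x \<in> X \<Longrightarrow> complex_vector.subspace (U x)"
    and orth: "\<And>x y u v. x \<in> X \<Longrightarrow> y \<in> X \<Longrightarrow> x \<noteq> y \<Longrightarrow> u \<in> U x \<Longrightarrow> v \<in> U y \<Longrightarrow> cinner u v = 0"
    and sp: "complex_vector.span (\<Union>x\<in>X. U x) = E"
  shows "finite {x \<in> X. 0 < complex_vector.dim (U x)}"
    "sum (\<lambda>x. complex_vector.dim (U x)) {x \<in> X. 0 < complex_vector.dim (U x)} = complex_vector.dim E"
proof -
  have sub: "U x \<subseteq> E" if "x \<in> X" for x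
    unfolding sp[symmetric] by (rule order_trans[OF UN_upper[OF that] complex_vector.span_superset])
  have "\<exists>B. finite B \<and> orthonormal B \<and> complex_vector.span B = U x \<and> complex_vector.dim (U x) = card B" if x: "x \<in> X" for x
  proof -
    obtain B where "finite B" "orthonormal B" "complex_vector.span B = U x" "complex_vector.dim (U x) = card B"
      using fin_dim_subset(1)[OF E U[OF x] sub[OF x]] by (rule fin_dimE)
    then show ?thesis by blast
  qed
  then have "\<exists>B. \<forall>x\<in>X. finite (B x) \<and> orthonormal (B x) \<and> complex_vector.span (B x) = U x \<and>
      complex_vector.dim (U x) = card (B x)"
    by (intro bchoice ballI)
  then obtain B where *: "\<forall>x\<in>X. finite (B x) \<and> orthonormal (B x) \<and> complex_vector.span (B x) = U x \<and>
      complex_vector.dim (U x) = card (B x)"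
    by (elim exE)
  have B: "\<And>x. x \<in> X \<Longrightarrow> finite (B x)" "\<And>x. x \<in> X \<Longrightarrow> orthonormal (B x)"
    "\<And>x. x \<in> X \<Longrightarrow> complex_vector.span (B x) = U x" "\<And>x. x \<in> X \<Longrightarrow> complex_vector.dim (U x) = card (B x)"
    using * by blast+
  have BU: "b \<in> U x" if "x \<in> X" "b \<in> B x" for x b
    using B(3)[OF that(1)] complex_vector.span_base[OF that(2)] by simp
  have disj: "B x \<inter> B y = {}" if "x \<in> X" "y \<in> X" "x \<noteq> y" for x y
  proof -
    have False if "b \<in> B x" "b \<in> B y" for b
    proof -
      have "cinner b b = 0"
        by (rule orth[OF \<open>x \<in> X\<close> \<open>y \<in> X\<close> \<open>x \<noteq> y\<close>]) (use BU \<open>x \<in> X\<close> \<open>y \<in> X\<close> that in auto)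
      then show False using orthonormal_nonzero[OF B(2)[OF \<open>x \<in> X\<close>]] that by simp
    qed
    then show ?thesis by blast
  qed
  define UB where "UB = (\<Union>x\<in>X. B x)"
  have on: "orthonormal UB"
    unfolding orthonormal_def
  proof (intro ballI)
    fix a b assume "a \<in> UB" "b \<in> UB"
    then obtain x y where xy: "x \<in> X" "a \<in> B x" "y \<in> X" "b \<in> B y" by (auto simp: UB_def)
    show "cinner a b = (if a = b then 1 else 0)"
    proof (cases "x = y")
      case True
      then show ?thesis using B(2)[OF xy(1)] xy by (auto simp: orthonormal_def)
    next
      case False
      then have "a \<noteq> b" using disj[OF xy(1,3)] xy by auto
      then show ?thesis using orth[OF xy(1,3) False BU[OF xy(1,2)] BU[OF xy(3,4)]] by simp
    qed
  qed
  have "UB \<subseteq> E" using BU sub by (auto simp: UB_def)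
  then have fin: "finite UB" using orthonormal_card_le_dim[OF E on] by simp
  have spUB: "complex_vector.span UB = E"
  proof
    show "complex_vector.span UB \<subseteq> E"
      by (rule complex_vector.span_minimal[OF \<open>UB \<subseteq> E\<close> fin_dim_subspace[OF E]])
    have "U x \<subseteq> complex_vector.span UB" if "x \<in> X" for x
      unfolding B(3)[OF that, symmetric] by (rule complex_vector.span_mono) (use that in \<open>auto simp: UB_def\<close>)
    then show "E \<subseteq> complex_vector.span UB"
      unfolding sp[symmetric] by (intro complex_vector.span_minimal) auto
  qed
  let ?Y = "{x \<in> X. 0 < complex_vector.dim (U x)}"
  have Y: "?Y = {x \<in> X. B x \<noteq> {}}" using B(1,4) by (auto simp: card_gt_0_iff)
  have inj: "inj_on B ?Y"
    unfolding Y by (rule inj_onI) (use disj in force)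
  have "B ` ?Y \<subseteq> Pow UB" by (auto simp: UB_def)
  then have "finite (B ` ?Y)" using fin by (meson finite_Pow_iff finite_subset)
  then show finY: "finite ?Y" using inj by (rule finite_imageD)
  have "complex_vector.dim E = card UB"
    using spUB by (metis complex_vector.dim_span_eq_card_independent on orthonormal_independent)
  also have "UB = (\<Union>x\<in>?Y. B x)" unfolding Y by (auto simp: UB_def)
  also have "card \<dots> = (\<Sum>x\<in>?Y. card (B x))"
    by (rule card_UN_disjoint[OF finY]) (use B(1) disj in auto)
  also have "\<dots> = (\<Sum>x\<in>?Y. complex_vector.dim (U x))"
    by (rule sum.cong) (use B(4) in auto)
  finally show "(\<Sum>x\<in>?Y. complex_vector.dim (U x)) = complex_vector.dim E" by simp
qed

section \<open>Spectral theory of self-adjoint operators with compact resolvent\<close>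

lemma quadratic_nonneg_imp_zero:
  fixes a b :: real
  assumes "\<And>t. 0 \<le> 2 * t * a + t\<^sup>2 * b"
  shows "a = 0"
proof (rule ccontr)
  assume a: "a \<noteq> 0"
  define B where "B = \<bar>b\<bar> + 1"
  \<comment> \<open>A time at which the linear term outweighs the quadratic one.\<close>
  define t where "t = - a / B"
  have B: "0 < B" "b \<le> B" by (auto simp: B_def)
  have "t\<^sup>2 * b \<le> t\<^sup>2 * B" using B by (intro mult_left_mono) auto
  also have "\<dots> = - t * a" using B by (simp add: t_def power2_eq_square)
  finally have "0 \<le> t * a" using assms[of t] by simp
  moreover have "t * a = - (a\<^sup>2 / B)" by (simp add: t_def power2_eq_square)
  moreover have "0 < a\<^sup>2 / B" using a B by simp
  ultimately show False by simp
qed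

lemma dim_pos_iff: "fin_dim E \<Longrightarrow> 0 < complex_vector.dim E \<longleftrightarrow> (\<exists>u\<in>E. u \<noteq> 0)"
proof -
  assume "fin_dim E"
  then obtain B where B: "finite B" "orthonormal B" "complex_vector.span B = E" "complex_vector.dim E = card B"
    by (rule fin_dimE)
  show ?thesis
  proof (cases "B = {}")
    case True
    then show ?thesis using B by auto
  next
    case False
    then obtain b where "b \<in> B" by auto
    then have "b \<in> E" "b \<noteq> 0" using B(3) complex_vector.span_base orthonormal_nonzero[OF B(2)] by auto
    then show ?thesis using B False by (auto simp: card_gt_0_iff)
  qed
qed

text \<open>
  This form covers two situations: a self-adjoint operator with compact resolvent, with \<open>X\<close> the whole
  space and \<open>K\<close> the domain, and the compression of a symmetric operator to an eigenspace, with
  \<open>X = K\<close>. The last assumption is self-adjointness relative to \<open>X\<close>.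
\<close>

locale compact_selfadjoint =
  fixes X K :: "'h::complex_hilbert_space set" and S :: "'h \<Rightarrow> 'h"
  assumes closed_X: "closed X"
    and subspace_X: "complex_vector.subspace X"
    and subspace_K: "complex_vector.subspace K"
    and K_subset: "K \<subseteq> X"
    and S_in: "\<And>u. u \<in> K \<Longrightarrow> S u \<in> X"
    and S_add: "\<And>u v. u \<in> K \<Longrightarrow> v \<in> K \<Longrightarrow> S (u + v) = S u + S v"
    and S_scale: "\<And>a u. u \<in> K \<Longrightarrow> S (a *\<^sub>C u) = a *\<^sub>C S u"
    and symmetric: "\<And>u v. u \<in> K \<Longrightarrow> v \<in> K \<Longrightarrow> cinner (S u) v = cinner u (S v)"
    and relatively_compact: "\<And>C::real. \<exists>Z. compact Z \<and> {u \<in> K. norm u \<le> C \<and> norm (S u) \<le> C} \<subseteq> Z"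
    and maximal: "\<And>p q. p \<in> X \<Longrightarrow> q \<in> X \<Longrightarrow> (\<And>w. w \<in> K \<Longrightarrow> cinner (S w) p = cinner w q) \<Longrightarrow> p \<in> K \<and> S p = q"
begin

abbreviation eig :: "real \<Rightarrow> 'h set" where
  "eig l \<equiv> eigenspace K S (complex_of_real l)"

definition spec :: "real set \<Rightarrow> 'h set" where
  "spec L = complex_vector.span (\<Union>l\<in>L. eig l)"

lemma K_zero: "0 \<in> K" by (rule complex_vector.subspace_0[OF subspace_K])
lemma K_add: "u \<in> K \<Longrightarrow> v \<in> K \<Longrightarrow> u + v \<in> K" by (rule complex_vector.subspace_add[OF subspace_K])
lemma K_diff: "u \<in> K \<Longrightarrow> v \<in> K \<Longrightarrow> u - v \<in> K" by (rule complex_vector.subspace_diff[OF subspace_K])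
lemma K_scale: "u \<in> K \<Longrightarrow> a *\<^sub>C u \<in> K" by (rule complex_vector.subspace_scale[OF subspace_K])

lemma S_zero: "S 0 = 0"
  using S_scale[OF K_zero, of 0] by simp

lemma S_diff: "u \<in> K \<Longrightarrow> v \<in> K \<Longrightarrow> S (u - v) = S u - S v"
  using S_add[of "u - v" v] K_diff[of u v] by simp

lemma S_sum: "(\<And>i. i \<in> I \<Longrightarrow> f i \<in> K) \<Longrightarrow> S (sum f I) = (\<Sum>i\<in>I. S (f i)) \<and> sum f I \<in> K"
  by (induction I rule: infinite_finite_induct) (auto simp: S_zero K_zero S_add K_add)

lemma S_closed:
  assumes u: "\<And>n::nat. u n \<in> K" and l: "u \<longlonglongrightarrow> l" and y: "(\<lambda>n. S (u n)) \<longlonglongrightarrow> y"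
  shows "l \<in> K \<and> S l = y"
proof (rule maximal)
  show "l \<in> X" using closed_X u K_subset l by (meson closed_sequentially subsetD)
  show "y \<in> X" using closed_X S_in[OF u] y by (rule closed_sequentially)
  fix w assume w: "w \<in> K"
  have "(\<lambda>n. cinner (S w) (u n)) \<longlonglongrightarrow> cinner (S w) l" by (intro tendsto_intros cinner.tendsto l)
  moreover have "(\<lambda>n. cinner w (S (u n))) \<longlonglongrightarrow> cinner w y" by (intro tendsto_intros cinner.tendsto y)
  ultimately show "cinner (S w) l = cinner w y"
    using symmetric[OF w u] by (simp add: LIMSEQ_unique)
qed

lemma eig_subspace: "complex_vector.subspace (eig l)"
  unfolding complex_vector.subspace_def eigenspace_def
  by (auto simp: K_zero K_add K_scale S_zero S_add S_scale scaleC_add_right scaleC_scaleC mult.commute)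

lemma eig_K: "u \<in> eig l \<Longrightarrow> u \<in> K" and eig_eq: "u \<in> eig l \<Longrightarrow> S u = complex_of_real l *\<^sub>C u"
  by (auto simp: eigenspace_def)

lemma eig_orth:
  assumes "a \<noteq> b" "u \<in> eig a" "v \<in> eig b"
  shows "cinner u v = 0"
proof -
  have "of_real a * cinner u v = of_real b * cinner u v"
    using symmetric[OF eig_K[OF assms(2)] eig_K[OF assms(3)]] eig_eq[OF assms(2)] eig_eq[OF assms(3)]
    by (simp add: cinner_simps)
  then show ?thesis using assms(1) by simp
qed

lemma spec_subspace: "complex_vector.subspace (spec L)"
  by (simp add: spec_def)

lemma spec_subset: "spec L \<subseteq> K"
  unfolding spec_def by (rule complex_vector.span_minimal[OF _ subspace_K]) (use eig_K in blast)

lemma eig_subset_spec: "l \<in> L \<Longrightarrow> eig l \<subseteq> spec L"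
  unfolding spec_def by (rule order_trans[OF _ complex_vector.span_superset]) blast

lemma spec_mono: "L \<subseteq> M \<Longrightarrow> spec L \<subseteq> spec M"
  unfolding spec_def by (rule complex_vector.span_mono) blast

lemma spec_sum:
  assumes "u \<in> spec L"
  shows "\<exists>M f. finite M \<and> M \<subseteq> L \<and> (\<forall>l\<in>M. f l \<in> eig l) \<and> u = sum f M"
  using assms unfolding spec_def
proof (induction rule: complex_vector.span_induct_alt)
  case base
  show ?case by (intro exI[of _ "{}"]) simp
next
  case (step c x y)
  from step(2) obtain M f where M: "finite M" "M \<subseteq> L" "\<forall>l\<in>M. f l \<in> eig l" "y = sum f M" by (elim exE conjE)
  from step(1) obtain k where k: "k \<in> L" "x \<in> eig k" by blast
  define g where "g l = (if l \<in> M then f l else 0) + (if l = k then c *\<^sub>C x else 0)" for l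
  have "sum g (insert k M) = (\<Sum>l\<in>insert k M. if l \<in> M then f l else 0) + (\<Sum>l\<in>insert k M. if l = k then c *\<^sub>C x else 0)"
    unfolding g_def by (rule sum.distrib)
  also have "(\<Sum>l\<in>insert k M. if l = k then c *\<^sub>C x else 0) = c *\<^sub>C x" using M(1) by (simp add: sum.delta)
  also have "(\<Sum>l\<in>insert k M. if l \<in> M then f l else 0) = (\<Sum>l\<in>M. if l \<in> M then f l else 0)"
    by (rule sum.mono_neutral_right) (use M in auto)
  also have "\<dots> = y" using M(4) by simp
  finally have "c *\<^sub>C x + y = sum g (insert k M)" by simp
  moreover have "\<forall>l\<in>insert k M. g l \<in> eig l"
    using M(3) k(2) eig_subspace unfolding g_def
    by (auto intro!: complex_vector.subspace_add complex_vector.subspace_scale complex_vector.subspace_0)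
  ultimately show ?case using M(1,2) k(1) by (intro exI[of _ "insert k M"] exI[of _ g]) simp
qed

lemma spec_invariant:
  assumes "u \<in> spec L"
  shows "S u \<in> spec L"
proof -
  obtain M f where M: "finite M" "M \<subseteq> L" "\<forall>l\<in>M. f l \<in> eig l" "u = sum f M"
    using spec_sum[OF assms] by (elim exE conjE)
  have "S u = (\<Sum>l\<in>M. S (f l))" using S_sum[of M f] M(3) eig_K unfolding M(4) by blast
  also have "\<dots> \<in> spec L"
  proof (rule complex_vector.subspace_sum[OF spec_subspace])
    fix l assume l: "l \<in> M"
    then have "f l \<in> spec L" using M eig_subset_spec[of l L] by blast
    then show "S (f l) \<in> spec L"
      using eig_eq[of "f l" l] l M(3) complex_vector.subspace_scale[OF spec_subspace] by auto
  qed
  finally show ?thesis .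
qed

lemma spec_bound:
  assumes u: "u \<in> spec L" and L: "\<And>l. l \<in> L \<Longrightarrow> \<bar>l - c\<bar> \<le> r" and r: "0 \<le> r"
  shows "norm (S u - complex_of_real c *\<^sub>C u) \<le> r * norm u"
proof -
  obtain M f where M: "finite M" "M \<subseteq> L" "\<forall>l\<in>M. f l \<in> eig l" "u = sum f M"
    using spec_sum[OF u] by (elim exE conjE)
  have "S u = (\<Sum>l\<in>M. S (f l))" using S_sum[of M f] M(3) eig_K unfolding M(4) by blast
  also have "\<dots> = (\<Sum>l\<in>M. complex_of_real l *\<^sub>C f l)" by (rule sum.cong) (use M(3) eig_eq in auto)
  finally have eq: "S u - complex_of_real c *\<^sub>C u = (\<Sum>l\<in>M. complex_of_real (l - c) *\<^sub>C f l)"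
    unfolding M(4) by (simp add: complex_vector.scale_sum_right sum_subtractf scaleC.diff_left)
  have o1: "pairwise (\<lambda>i j. orthogonal (f i) (f j)) M"
    using M(3) eig_orth by (auto simp: pairwise_def intro!: orthogonal_of_cinner_eq_0)
  have o2: "pairwise (\<lambda>i j. orthogonal (complex_of_real (i - c) *\<^sub>C f i) (complex_of_real (j - c) *\<^sub>C f j)) M"
    using M(3) eig_orth by (auto simp: pairwise_def cinner_simps intro!: orthogonal_of_cinner_eq_0)
  have "(norm (S u - complex_of_real c *\<^sub>C u))\<^sup>2 = (\<Sum>l\<in>M. (\<bar>l - c\<bar> * norm (f l))\<^sup>2)"
    unfolding eq norm_sum_Pythagorean[OF M(1) o2] by (simp only: norm_scaleC norm_of_real)
  also have "\<dots> \<le> (\<Sum>l\<in>M. r\<^sup>2 * (norm (f l))\<^sup>2)"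
    unfolding power_mult_distrib by (intro sum_mono mult_right_mono power_mono) (use L M(2) in auto)
  also have "\<dots> = (r * norm u)\<^sup>2"
    unfolding M(4) power_mult_distrib norm_sum_Pythagorean[OF M(1) o1] by (simp add: sum_distrib_left)
  finally show ?thesis by (rule power2_le_imp_le) (use r in simp)
qed

text \<open>
  On such a subspace the unit ball is relatively compact, while distinct elements of an orthonormal
  set have distance \<open>sqrt 2\<close>; a cover by finitely many balls of radius \<open>1/2\<close> bounds the cardinality.
\<close>

lemma fin_dim_of_bounded:
  assumes F: "complex_vector.subspace F" "F \<subseteq> K" and C: "\<And>u. u \<in> F \<Longrightarrow> norm (S u) \<le> C * norm u"
  shows "fin_dim F"
proof -
  obtain Z where Z: "compact Z" "{u \<in> K. norm u \<le> max 1 C \<and> norm (S u) \<le> max 1 C} \<subseteq> Z"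
    using relatively_compact by blast
  obtain k where k: "finite k" "Z \<subseteq> (\<Union>x\<in>k. ball x (1/2))"
    using Z(1) unfolding compact_eq_totally_bounded by (meson half_gt_zero zero_less_one)
  have "card B \<le> card k" if B: "finite B" "orthonormal B" "B \<subseteq> F" for B
  proof -
    have "\<exists>x\<in>k. dist x b < 1/2" if b: "b \<in> B" for b
    proof -
      have "norm b = 1" using orthonormal_norm B b by blast
      then have "b \<in> {u \<in> K. norm u \<le> max 1 C \<and> norm (S u) \<le> max 1 C}"
        using C[of b] b B(3) F(2) by auto
      then have "b \<in> Z" using Z(2) by (rule subsetD[rotated])
      then obtain x where "x \<in> k" "b \<in> ball x (1/2)" using k(2) by auto
      then show ?thesis by (intro bexI[of _ x]) (simp_all only: mem_ball)
    qed
    then obtain g where g: "\<And>b. b \<in> B \<Longrightarrow> g b \<in> k" "\<And>b. b \<in> B \<Longrightarrow> dist (g b) b < 1/2" by metis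
    have "inj_on g B"
    proof (rule inj_onI)
      fix a b assume ab: "a \<in> B" "b \<in> B" "g a = g b"
      have d: "dist a b < 1" using g(2)[OF ab(1)] g(2)[OF ab(2)] ab(3) dist_triangle_half_r by force
      show "a = b"
      proof (rule ccontr)
        assume "a \<noteq> b"
        then have "cinner a (- b) = 0" using B(2) ab by (simp add: orthonormal_def cinner_simps)
        from norm_add_cinner_eq_0[OF this] have "(norm (a - b))\<^sup>2 = 2"
          using orthonormal_norm[OF B(2)] ab by simp
        moreover have "(norm (a - b))\<^sup>2 < 1" using d by (simp add: dist_norm power_less_one_iff abs_square_less_1)
        ultimately show False by simp
      qed
    qed
    then show ?thesis using g(1) k(1) by (intro card_inj_on_le[of g]) auto
  qed
  from fin_dim_of_card_bound[OF F(1) this] show ?thesis by blast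
qed

lemma spec_fin_dim: "fin_dim (spec {a..b})"
proof (rule fin_dim_of_bounded[OF spec_subspace spec_subset])
  fix u assume "u \<in> spec {a..b}"
  then have "norm (S u - complex_of_real 0 *\<^sub>C u) \<le> (\<bar>a\<bar> + \<bar>b\<bar>) * norm u"
    by (rule spec_bound) auto
  then show "norm (S u) \<le> (\<bar>a\<bar> + \<bar>b\<bar>) * norm u" by simp
qed

lemma eig_fin_dim: "fin_dim (eig l)"
  by (rule fin_dim_subset(1)[OF spec_fin_dim[of l l] eig_subspace eig_subset_spec]) simp

text \<open>
  Minimise \<open>\<parallel>(S - c) y\<parallel>\<close> over the unit vectors \<open>y\<close> orthogonal to the eigenvectors in the window. By
  the parallelogram law the images of a convergent minimising sequence form a Cauchy sequence, so the
  minimum \<open>s\<close> is attained at some \<open>l\<close>. The variational equation, with self-adjointness, gives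
  \<open>(S - c)\<^sup>2 l = s\<^sup>2 l\<close>, so \<open>l\<close> or \<open>(S - c) l + s l\<close> is an eigenvector for \<open>c - s\<close> or \<open>c + s\<close>. If
  \<open>s < r\<close> this contradicts orthogonality.
\<close>

lemma gap:
  assumes x: "x \<in> K" "\<And>l e. \<bar>l - c\<bar> \<le> r \<Longrightarrow> e \<in> eig l \<Longrightarrow> cinner x e = 0"
  shows "r * norm x \<le> norm (S x - complex_of_real c *\<^sub>C x)"
proof (rule ccontr)
  assume neg: "\<not> ?thesis"
  define G where "G = spec {c - r..c + r}"
  define T where "T u = S u - complex_of_real c *\<^sub>C u" for u
  define Y where "Y = {y \<in> K. \<forall>g\<in>G. cinner y g = 0}"
  have G_K: "G \<subseteq> K" unfolding G_def by (rule spec_subset)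
  have T_add: "T (u + v) = T u + T v" if "u \<in> K" "v \<in> K" for u v
    using that by (simp add: T_def S_add scaleC_add_right)
  have T_scale: "T (a *\<^sub>C u) = a *\<^sub>C T u" if "u \<in> K" for a u
    using that by (simp add: T_def S_scale scaleC.diff_right scaleC_scaleC mult.commute)
  have T_diff: "T (u - v) = T u - T v" if "u \<in> K" "v \<in> K" for u v
    using that by (simp add: T_def S_diff scaleC.diff_right)
  have T_sym: "cinner (T u) v = cinner u (T v)" if "u \<in> K" "v \<in> K" for u v
    using that by (simp add: T_def symmetric cinner_simps)
  have T_G: "T g \<in> G" if "g \<in> G" for g
    unfolding T_def using that spec_invariant spec_subspace unfolding G_def
    by (intro complex_vector.subspace_diff complex_vector.subspace_scale) auto
  have Y_K: "Y \<subseteq> K" by (auto simp: Y_def)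
  have Y_scale: "a *\<^sub>C y \<in> Y" if "y \<in> Y" for a y using that by (simp add: Y_def K_scale cinner_simps)
  have Y_add: "y + z \<in> Y" if "y \<in> Y" "z \<in> Y" for y z using that by (simp add: Y_def K_add cinner_simps)
  have Y_diff: "y - z \<in> Y" if "y \<in> Y" "z \<in> Y" for y z using that by (simp add: Y_def K_diff cinner_simps)
  have xY: "x \<in> Y"
  proof -
    have "cinner x g = 0" if "g \<in> G" for g
    proof (rule cinner_span_eq_0[OF _ that[unfolded G_def spec_def]])
      fix b assume "b \<in> (\<Union>l\<in>{c - r..c + r}. eig l)"
      then obtain l where "l \<in> {c - r..c + r}" "b \<in> eig l" by blast
      then show "cinner x b = 0" by (intro x(2)[of l b]) (simp add: abs_le_iff)
    qed
    then show ?thesis using x(1) by (simp add: Y_def)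
  qed
  have x0: "x \<noteq> 0" using neg by auto
  have r0: "0 < r" using neg by (smt (verit) mult_nonpos_nonneg norm_ge_zero)
  define N where "N = (\<lambda>y. norm (T y)) ` {y \<in> Y. norm y = 1}"
  define s where "s = Inf N"
  have bdd: "bdd_below N" by (rule bdd_belowI[of _ 0]) (auto simp: N_def)
  have unit: "norm (T y) / norm y \<in> N" if "y \<in> Y" "y \<noteq> 0" for y
  proof -
    let ?a = "complex_of_real (1 / norm y)"
    have "norm (?a *\<^sub>C y) = 1" "norm (T (?a *\<^sub>C y)) = norm (T y) / norm y"
      using that Y_K T_scale[of y ?a] by (auto simp: norm_scaleC norm_divide)
    then show ?thesis unfolding N_def using Y_scale[OF that(1), of ?a] by (intro image_eqI[of _ _ "?a *\<^sub>C y"]) auto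
  qed
  have low: "s * norm y \<le> norm (T y)" if "y \<in> Y" for y
  proof (cases "y = 0")
    case False
    then have "s \<le> norm (T y) / norm y" unfolding s_def by (intro cInf_lower unit that bdd)
    then show ?thesis using False by (simp add: field_simps)
  qed simp
  have Nne: "N \<noteq> {}" using unit[OF xY x0] by auto
  have s0: "0 \<le> s" unfolding s_def by (rule cInf_greatest[OF Nne]) (auto simp: N_def)
  have sr: "s < r"
  proof -
    have "s \<le> norm (T x) / norm x" unfolding s_def by (intro cInf_lower unit xY x0 bdd)
    also have "\<dots> < r" using neg x0 by (simp add: T_def field_simps)
    finally show ?thesis .
  qed
  have "\<exists>y. y \<in> Y \<and> norm y = 1 \<and> norm (T y) < s + inverse (real (Suc n))" for n
  proof -
    have "Inf N < s + inverse (real (Suc n))" by (simp add: s_def)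
    then obtain a where "a \<in> N" "a < s + inverse (real (Suc n))" using cInf_lessD[OF Nne] by blast
    then show ?thesis by (auto simp: N_def)
  qed
  then obtain y where y: "\<And>n. y n \<in> Y" "\<And>n. norm (y n) = 1" "\<And>n. norm (T (y n)) < s + inverse (real (Suc n))"
    by metis
  define C where "C = s + 1 + \<bar>c\<bar>"
  obtain Z where Z: "compact Z" "{u \<in> K. norm u \<le> C \<and> norm (S u) \<le> C} \<subseteq> Z" using relatively_compact by blast
  have "y n \<in> Z" for n
  proof -
    have "S (y n) = T (y n) + complex_of_real c *\<^sub>C y n" by (simp add: T_def)
    then have "norm (S (y n)) \<le> norm (T (y n)) + \<bar>c\<bar> * norm (y n)"
      by (metis norm_triangle_ineq norm_scaleC norm_of_real)
    moreover have "inverse (real (Suc n)) \<le> 1" by (simp add: inverse_le_1_iff)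
    ultimately have "norm (S (y n)) \<le> C" using y(2,3)[of n] by (simp add: C_def)
    moreover have "norm (y n) \<le> C" using y(2)[of n] s0 by (simp add: C_def)
    ultimately show ?thesis using Z(2) y(1)[of n] Y_K by auto
  qed
  then obtain l \<rho> where \<rho>: "strict_mono \<rho>" and lim: "(y \<circ> \<rho>) \<longlonglongrightarrow> l"
    using Z(1) unfolding compact_def by metis
  define z where "z n = y (\<rho> n)" for n
  define \<epsilon> where "\<epsilon> n = inverse (real (Suc (\<rho> n)))" for n
  have zl: "z \<longlonglongrightarrow> l" using lim by (simp add: z_def[abs_def] o_def)
  have z: "z n \<in> Y" "norm (z n) = 1" "norm (T (z n)) < s + \<epsilon> n" "z n \<in> K" for n
    using y Y_K by (auto simp: z_def \<epsilon>_def)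
  have el: "\<epsilon> \<longlonglongrightarrow> 0"
    using LIMSEQ_subseq_LIMSEQ[OF LIMSEQ_inverse_real_of_nat \<rho>] by (simp add: \<epsilon>_def[abs_def] o_def)
  define a where "a n = 2 * (s + \<epsilon> n)\<^sup>2 - 2 * s\<^sup>2" for n
  have "a \<longlonglongrightarrow> 2 * (s + 0)\<^sup>2 - 2 * s\<^sup>2" unfolding a_def[abs_def] by (intro tendsto_intros el)
  then have al: "a \<longlonglongrightarrow> 0" by simp
  have par: "(norm (u - v))\<^sup>2 = 2 * (norm u)\<^sup>2 + 2 * (norm v)\<^sup>2 - (norm (u + v))\<^sup>2" for u v :: 'h
    by (simp add: power2_norm_eq_inner inner_simps inner_commute)
  have Cau: "(norm (T (z n) - T (z k)))\<^sup>2 \<le> a n + a k + s\<^sup>2 * (norm (z n - z k))\<^sup>2" for n k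
  proof -
    have sq: "(norm (T (z n)))\<^sup>2 \<le> (s + \<epsilon> n)\<^sup>2" for n
      by (rule power_mono) (use z(3)[of n] in auto)
    have "s * norm (z n + z k) \<le> norm (T (z n + z k))" by (rule low[OF Y_add[OF z(1) z(1)]])
    then have "(s * norm (z n + z k))\<^sup>2 \<le> (norm (T (z n + z k)))\<^sup>2"
      by (rule power_mono) (use s0 in simp)
    then have "s\<^sup>2 * (4 - (norm (z n - z k))\<^sup>2) \<le> (norm (T (z n) + T (z k)))\<^sup>2"
      using par[of "z n" "z k"] z(2)[of n] z(2)[of k] T_add[OF z(4) z(4), of n k]
      by (simp add: power_mult_distrib)
    then show ?thesis
      using par[of "T (z n)" "T (z k)"] sq[of n] sq[of k] by (simp add: a_def algebra_simps)
  qed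
  have "Cauchy (\<lambda>n. T (z n))"
  proof (rule metric_CauchyI)
    fix e :: real assume e: "0 < e"
    define e' where "e' = e\<^sup>2 / 4"
    have e': "0 < e'" using e by (simp add: e'_def)
    obtain N1 where N1: "\<And>n. n \<ge> N1 \<Longrightarrow> \<bar>a n\<bar> < e'" using LIMSEQ_D[OF al e'] by auto
    define d where "d = e / (2 * (s + 1))"
    have d: "0 < d" using e s0 by (simp add: d_def)
    obtain N2 where N2: "\<And>n k. n \<ge> N2 \<Longrightarrow> k \<ge> N2 \<Longrightarrow> dist (z n) (z k) < d"
      using metric_CauchyD[OF LIMSEQ_imp_Cauchy[OF zl] d] by blast
    have "dist (T (z n)) (T (z k)) < e" if "n \<ge> max N1 N2" "k \<ge> max N1 N2" for n k
    proof -
      have "s * norm (z n - z k) \<le> (s + 1) * d"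
        using N2[of n k] that s0 d by (intro mult_mono) (auto simp: dist_norm)
      also have "\<dots> = e / 2"
        unfolding d_def using s0 by (simp only: mult.commute[of 2] divide_divide_eq_left[symmetric] times_divide_eq_right) simp
      finally have "(s * norm (z n - z k))\<^sup>2 \<le> (e / 2)\<^sup>2" by (rule power_mono) (use s0 in simp)
      then have "s\<^sup>2 * (norm (z n - z k))\<^sup>2 \<le> e'" by (simp add: power_mult_distrib power_divide e'_def)
      then have "(norm (T (z n) - T (z k)))\<^sup>2 < 3 * e'"
        using Cau[of n k] N1[of n] N1[of k] that by auto
      also have "\<dots> < e\<^sup>2" using e by (simp add: e'_def)
      finally have "norm (T (z n) - T (z k)) < e" by (rule power2_less_imp_less) (use e in simp)
      then show ?thesis by (simp add: dist_norm)
    qed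
    then show "\<exists>M. \<forall>m\<ge>M. \<forall>n\<ge>M. dist (T (z m)) (T (z n)) < e" by blast
  qed
  then obtain p where p: "(\<lambda>n. T (z n)) \<longlonglongrightarrow> p" using Cauchy_convergent convergentD by blast
  have "(\<lambda>n. T (z n) + complex_of_real c *\<^sub>C z n) \<longlonglongrightarrow> p + complex_of_real c *\<^sub>C l"
    by (intro tendsto_add p scaleC.tendsto tendsto_const zl)
  then have "(\<lambda>n. S (z n)) \<longlonglongrightarrow> p + complex_of_real c *\<^sub>C l" by (simp add: T_def)
  then have lK: "l \<in> K" and Sl: "S l = p + complex_of_real c *\<^sub>C l" using S_closed[OF z(4) zl] by auto
  have Tl: "T l = p" by (simp add: T_def Sl)
  have l1: "norm l = 1" using tendsto_norm[OF zl] z(2) by (simp add: LIMSEQ_const_iff)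
  have lG: "cinner l g = 0" if "g \<in> G" for g
  proof -
    have "(\<lambda>n. cinner (z n) g) \<longlonglongrightarrow> cinner l g" by (intro cinner.tendsto zl tendsto_const)
    moreover have "cinner (z n) g = 0" for n using z(1)[of n] that by (simp add: Y_def)
    ultimately show ?thesis by (simp add: LIMSEQ_const_iff)
  qed
  have lY: "l \<in> Y" using lK lG by (simp add: Y_def)
  have "norm p \<le> s + 0"
    by (rule LIMSEQ_le[OF tendsto_norm[OF p] tendsto_add[OF tendsto_const el]]) (use z(3) less_imp_le in blast)
  then have ps: "norm p = s" using low[OF lY] by (simp add: Tl l1)
  have sqn: "(norm (u + t *\<^sub>R v))\<^sup>2 = (norm u)\<^sup>2 + 2 * t * (u \<bullet> v) + t\<^sup>2 * (norm v)\<^sup>2" for u v :: 'h and t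
    unfolding power2_norm_eq_inner by (simp add: inner_simps inner_commute power2_eq_square algebra_simps)
  have var: "p \<bullet> T w = s\<^sup>2 * (l \<bullet> w)" if w: "w \<in> Y" for w
  proof -
    have "0 \<le> 2 * t * (p \<bullet> T w - s\<^sup>2 * (l \<bullet> w)) + t\<^sup>2 * ((norm (T w))\<^sup>2 - s\<^sup>2 * (norm w)\<^sup>2)" for t
    proof -
      have wK: "w \<in> K" using w Y_K by auto
      have eq: "T (l + t *\<^sub>R w) = p + t *\<^sub>R T w"
        using T_add[OF lK K_scale[OF wK]] T_scale[OF wK] by (simp add: scaleC_of_real[symmetric] Tl)
      have "l + t *\<^sub>R w \<in> Y" using Y_add[OF lY Y_scale[OF w]] by (simp add: scaleC_of_real[symmetric])
      from low[OF this] have "(s * norm (l + t *\<^sub>R w))\<^sup>2 \<le> (norm (p + t *\<^sub>R T w))\<^sup>2"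
        unfolding eq by (rule power_mono) (use s0 in simp)
      moreover have "(norm (p + t *\<^sub>R T w))\<^sup>2 = s\<^sup>2 + 2 * t * (p \<bullet> T w) + t\<^sup>2 * (norm (T w))\<^sup>2"
        using sqn[of p t "T w"] ps by simp
      moreover have "(norm (l + t *\<^sub>R w))\<^sup>2 = (norm l)\<^sup>2 + 2 * t * (l \<bullet> w) + t\<^sup>2 * (norm w)\<^sup>2"
        by (rule sqn)
      ultimately show ?thesis by (simp add: power_mult_distrib l1 algebra_simps)
    qed
    then show ?thesis using quadratic_nonneg_imp_zero by fastforce
  qed
  have varC: "cinner p (T w) = of_real (s\<^sup>2) * cinner l w" if w: "w \<in> Y" for w
  proof (rule complex_eqI)
    show "Re (cinner p (T w)) = Re (of_real (s\<^sup>2) * cinner l w)"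
      using var[OF w] by (simp add: inner_eq_Re_cinner)
    have "p \<bullet> T (\<i> *\<^sub>C w) = s\<^sup>2 * (l \<bullet> (\<i> *\<^sub>C w))" by (rule var[OF Y_scale[OF w]])
    then show "Im (cinner p (T w)) = Im (of_real (s\<^sup>2) * cinner l w)"
      using w Y_K by (simp add: inner_eq_Re_cinner T_scale subset_iff cinner_simps)
  qed
  have pG: "cinner p g = 0" if "g \<in> G" for g
    using T_sym[OF lK, of g] lG[OF T_G[OF that]] that G_K Tl by auto
  have all: "cinner p (T w) = of_real (s\<^sup>2) * cinner l w" if w: "w \<in> K" for w
  proof -
    obtain g where g: "g \<in> G" "\<And>e. e \<in> G \<Longrightarrow> cinner (w - g) e = 0"
      using orth_decomp[OF spec_fin_dim] unfolding G_def by blast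
    have gK: "g \<in> K" using g(1) G_K by auto
    have "w - g \<in> Y" using g w gK by (simp add: Y_def K_diff)
    from varC[OF this] have "cinner p (T w - T g) = of_real (s\<^sup>2) * cinner l (w - g)"
      by (simp add: T_diff w gK)
    then show ?thesis using pG[OF T_G[OF g(1)]] lG[OF g(1)] by (simp add: cinner_simps)
  qed
  have lX: "l \<in> X" using lK K_subset by auto
  have pX: "p \<in> X" unfolding Tl[symmetric] T_def
    using S_in[OF lK] lX subspace_X by (intro complex_vector.subspace_diff complex_vector.subspace_scale)
  have "p \<in> K \<and> S p = of_real (s\<^sup>2) *\<^sub>C l + of_real c *\<^sub>C p"
  proof (rule maximal[OF pX])
    show "of_real (s\<^sup>2) *\<^sub>C l + of_real c *\<^sub>C p \<in> X"
      using lX pX subspace_X by (intro complex_vector.subspace_add complex_vector.subspace_scale)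
    fix w assume w: "w \<in> K"
    have "cnj (cinner p (T w)) = cnj (of_real (s\<^sup>2) * cinner l w)" by (simp only: all[OF w])
    then have "cinner (T w) p = of_real (s\<^sup>2) * cinner w l" by (simp add: cinner_commute[symmetric])
    moreover have "S w = T w + of_real c *\<^sub>C w" by (simp add: T_def)
    ultimately show "cinner (S w) p = cinner w (of_real (s\<^sup>2) *\<^sub>C l + of_real c *\<^sub>C p)"
      by (simp add: cinner_simps)
  qed
  then have pK: "p \<in> K" and Sp: "S p = of_real (s\<^sup>2) *\<^sub>C l + of_real c *\<^sub>C p" by auto
  define h where "h = p + of_real s *\<^sub>C l"
  have "S h = of_real (c + s) *\<^sub>C h"
    using S_add[OF pK K_scale[OF lK]] S_scale[OF lK] Sp Sl
    by (simp add: h_def scaleC_add_right scaleC_add_left scaleC_scaleC power2_eq_square mult.commute distrib_left distrib_right)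
  then have "h \<in> eig (c + s)" using pK lK by (simp add: eigenspace_def h_def K_add K_scale)
  then have hG: "h \<in> G" unfolding G_def using eig_subset_spec[of "c + s" "{c - r..c + r}"] s0 sr by auto
  have "cinner h h = cinner p h + of_real s * cinner l h"
    by (subst (1) h_def) (simp only: cinner_add_left cinner_scaleC_left)
  then have "cinner h h = 0" using pG[OF hG] lG[OF hG] by simp
  then have "p = - (of_real s *\<^sub>C l)" by (simp add: h_def add_eq_0_iff)
  then have "S l = of_real (c - s) *\<^sub>C l" using Sl by (simp add: scaleC.diff_left)
  then have "l \<in> eig (c - s)" using lK by (simp add: eigenspace_def)
  then have "l \<in> G" unfolding G_def using eig_subset_spec[of "c - s" "{c - r..c + r}"] s0 sr by auto
  then have "cinner l l = 0" by (rule lG)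
  then show False using l1 by simp
qed

lemma eig_isolated: "\<exists>r>0. \<forall>l. \<bar>l - c\<bar> \<le> r \<longrightarrow> l \<noteq> c \<longrightarrow> eig l = {0}"
proof -
  define F where "F = {l \<in> {c - 1..c + 1}. 0 < complex_vector.dim (eig l)}"
  have "finite F" unfolding F_def
    by (rule dim_orthogonal_family(1)[OF spec_fin_dim]) (auto simp: spec_def eig_subspace eig_orth)
  from finite_set_avoid[OF this, of c] obtain d where d: "d > 0" "\<forall>l\<in>F. l \<noteq> c \<longrightarrow> d \<le> dist c l" by blast
  have "eig l = {0}" if "\<bar>l - c\<bar> \<le> min 1 (d/2)" "l \<noteq> c" for l
  proof -
    have "dist c l < d" using d(1) that(1) by (simp add: dist_real_def abs_minus_commute)
    then have "l \<notin> F" using d(2) that(2) by auto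
    then have "\<not> 0 < complex_vector.dim (eig l)" using that(1) by (auto simp: F_def)
    then have "\<forall>u\<in>eig l. u = 0" using dim_pos_iff[OF eig_fin_dim, of l] by simp
    then show ?thesis using complex_vector.subspace_0[OF eig_subspace, of l] by auto
  qed
  then show ?thesis using d(1) by (intro exI[of _ "min 1 (d/2)"]) auto
qed

lemma gap_isolated:
  assumes "\<And>l. \<bar>l - c\<bar> \<le> r \<Longrightarrow> l \<noteq> c \<Longrightarrow> eig l = {0}"
    and "x \<in> K" "\<And>e. e \<in> eig c \<Longrightarrow> cinner x e = 0"
  shows "r * norm x \<le> norm (S x - complex_of_real c *\<^sub>C x)"
proof (rule gap[OF assms(2)])
  fix l e assume l: "\<bar>l - c\<bar> \<le> r" and e: "e \<in> eig l"
  show "cinner x e = 0"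
  proof (cases "l = c")
    case True
    then show ?thesis using assms(3) e by simp
  next
    case False
    then have "e = 0" using assms(1)[OF l] e by blast
    then show ?thesis by (simp add: cinner.zero_right)
  qed
qed

text \<open>
  The remainder \<open>y\<close> of an orthogonal decomposition satisfies the gap inequality for every \<open>r\<close>.
\<close>

lemma spec_UNIV:
  assumes "fin_dim K"
  shows "spec UNIV = K"
proof
  show "K \<subseteq> spec UNIV"
  proof
    fix u assume u: "u \<in> K"
    obtain p where p: "p \<in> spec UNIV" "\<And>e. e \<in> spec UNIV \<Longrightarrow> cinner (u - p) e = 0"
      using orth_decomp[OF fin_dim_subset(1)[OF assms spec_subspace spec_subset]] by blast
    have y: "u - p \<in> K" using u p(1) spec_subset K_diff by blast
    have "r * norm (u - p) \<le> norm (S (u - p) - complex_of_real 0 *\<^sub>C (u - p))" for r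
      by (rule gap[OF y]) (use p(2) eig_subset_spec[of _ UNIV] in blast)
    from this[of "(norm (S (u - p)) + 1) / norm (u - p)"] have "u - p = 0"
      by (cases "u - p = 0") auto
    then show "u \<in> spec UNIV" using p(1) by simp
  qed
qed (rule spec_subset)

end

section \<open>Uniform boundedness and relative bounds\<close>

text \<open>
  By Baire's theorem one of the closed sets on which the whole family is bounded by \<open>n\<close> contains a
  ball.
\<close>

lemma uniform_boundedness:
  fixes F :: "('a::{real_normed_vector, complete_space} \<Rightarrow> 'b::real_normed_vector) set"
  assumes lin: "\<And>f. f \<in> F \<Longrightarrow> bounded_linear f"
    and pw: "\<And>x. \<exists>M. \<forall>f\<in>F. norm (f x) \<le> M"
  shows "\<exists>C\<ge>0. \<forall>f\<in>F. \<forall>x. norm (f x) \<le> C * norm x"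
proof -
  define E where "E n = {x. \<forall>f\<in>F. norm (f x) \<le> real n}" for n
  have clo: "closed (E n)" for n
  proof -
    have "closed {x. norm (f x) \<le> real n}" if "f \<in> F" for f
      by (intro closed_Collect_le continuous_intros bounded_linear.continuous_on[OF lin[OF that]])
    then have "closed (\<Inter>f\<in>F. {x. norm (f x) \<le> real n})" by blast
    moreover have "(\<Inter>f\<in>F. {x. norm (f x) \<le> real n}) = E n" by (auto simp: E_def)
    ultimately show ?thesis by simp
  qed
  have cover: "(\<Union>n. E n) = UNIV"
  proof -
    have "\<exists>n. x \<in> E n" for x
    proof -
      obtain M where "\<forall>f\<in>F. norm (f x) \<le> M" using pw by blast
      moreover obtain n where "M \<le> real n" using real_arch_simple by blast
      ultimately have "x \<in> E n" by (auto simp: E_def intro: order_trans)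
      then show ?thesis by blast
    qed
    then show ?thesis by blast
  qed
  have "\<exists>n. interior (E n) \<noteq> {}"
  proof (rule ccontr)
    assume "\<not> (\<exists>n. interior (E n) \<noteq> {})"
    then have empty: "interior (E n) = {}" for n by blast
    have "Met_TC.mtopology interior_of (\<Union>(range E)) = {}"
    proof (rule Met_TC.metric_Baire_category_alt)
      show "Met_TC.mcomplete TYPE('a)" by (simp add: complete_UNIV)
    qed (use clo empty in auto)
    then show False using cover by simp
  qed
  then obtain n x e where e: "0 < e" "ball x e \<subseteq> E n" unfolding mem_interior[symmetric] by (metis ex_in_conv mem_interior)
  have "norm (f y) \<le> 4 * real n / e * norm y" if f: "f \<in> F" for f y
  proof (cases "y = 0")
    case True
    then show ?thesis using linear_simps(3)[OF lin[OF f]] by simp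
  next
    case False
    define c where "c = e / (2 * norm y)"
    have c: "0 < c" using e False by (simp add: c_def)
    have "norm (c *\<^sub>R y) = e / 2" using False e by (simp add: c_def)
    then have "x + c *\<^sub>R y \<in> ball x e" "x \<in> ball x e" using e by (auto simp: dist_norm)
    then have "x + c *\<^sub>R y \<in> E n" "x \<in> E n" using e(2) by blast+
    then have "norm (f (x + c *\<^sub>R y)) \<le> real n" "norm (f x) \<le> real n"
      using f by (auto simp: E_def)
    moreover have "f (x + c *\<^sub>R y) = f x + c *\<^sub>R f y"
      using linear_simps(1,5)[OF lin[OF f]] by simp
    ultimately have "norm (c *\<^sub>R f y) \<le> 2 * real n"
      using norm_triangle_ineq4[of "f x + c *\<^sub>R f y" "f x"] by simp
    then have "norm (f y) \<le> 2 * real n / c" using c by (simp add: field_simps)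
    also have "\<dots> = 4 * real n / e * norm y" using e False by (simp add: c_def field_simps)
    finally show ?thesis .
  qed
  then show ?thesis using e by (intro exI[of _ "4 * real n / e"]) auto
qed

lemma weakly_bounded_imp_bounded:
  fixes x :: "'i \<Rightarrow> 'h::complex_hilbert_space"
  assumes "\<And>v. \<exists>M. \<forall>i\<in>I. cmod (cinner (x i) v) \<le> M"
  shows "\<exists>C\<ge>0. \<forall>i\<in>I. norm (x i) \<le> C"
proof -
  have "\<exists>C\<ge>0. \<forall>f\<in>(\<lambda>i. cinner (x i)) ` I. \<forall>v. norm (f v) \<le> C * norm v"
  proof (rule uniform_boundedness)
    fix f assume "f \<in> (\<lambda>i. cinner (x i)) ` I"
    then show "bounded_linear f" by (auto intro: cinner.bounded_linear_right)
  next
    fix v show "\<exists>M. \<forall>f\<in>(\<lambda>i. cinner (x i)) ` I. cmod (f v) \<le> M" using assms[of v] by simp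
  qed
  then obtain C where C: "C \<ge> 0" "\<And>i v. i \<in> I \<Longrightarrow> cmod (cinner (x i) v) \<le> C * norm v" by auto
  have "norm (x i) \<le> C" if "i \<in> I" for i
  proof (cases "x i = 0")
    case False
    have "norm (x i) * norm (x i) \<le> C * norm (x i)"
      using C(2)[OF that, of "x i"] by (simp add: cinner_self power2_eq_square norm_mult)
    then show ?thesis using False by (simp add: mult_le_cancel_right)
  qed (use C in simp)
  then show ?thesis using C(1) by blast
qed

text \<open>
  The radius in the hypothesis may depend on the test vector \<open>v\<close>. A sequence of indices tending to
  \<open>\<sigma> = 0\<close> along which the norms are unbounded would still be weakly bounded.
\<close>

lemma weakly_bounded_near:
  fixes x :: "'i \<Rightarrow> 'h::complex_hilbert_space" and \<sigma> :: "'i \<Rightarrow> real"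
  assumes "\<And>v. \<exists>d>0. \<exists>M. \<forall>i\<in>I. \<sigma> i < d \<longrightarrow> cmod (cinner (x i) v) \<le> M"
  shows "\<exists>d>0. \<exists>C\<ge>0. \<forall>i\<in>I. \<sigma> i < d \<longrightarrow> norm (x i) \<le> C"
proof (rule ccontr)
  assume neg: "\<not> ?thesis"
  have "\<exists>i\<in>I. \<sigma> i < inverse (real (Suc n)) \<and> real n < norm (x i)" for n
  proof -
    have "0 < inverse (real (Suc n))" "0 \<le> real n" by auto
    then show ?thesis using neg by (meson not_le)
  qed
  then obtain i where i: "\<And>n. i n \<in> I" "\<And>n. \<sigma> (i n) < inverse (real (Suc n))" "\<And>n. real n < norm (x (i n))"
    by metis
  have "\<exists>C\<ge>0. \<forall>n\<in>UNIV. norm (x (i n)) \<le> C"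
  proof (rule weakly_bounded_imp_bounded)
    fix v
    obtain d M where d: "d > 0" "\<forall>i\<in>I. \<sigma> i < d \<longrightarrow> cmod (cinner (x i) v) \<le> M" using assms by blast
    obtain N where N: "inverse (real (Suc N)) < d" using reals_Archimedean[OF d(1)] by blast
    have late: "cmod (cinner (x (i n)) v) \<le> M" if "n \<ge> N" for n
    proof -
      have "inverse (real (Suc n)) \<le> inverse (real (Suc N))" using that by (intro le_imp_inverse_le) auto
      then have "\<sigma> (i n) < d" using i(2)[of n] N by linarith
      then show ?thesis using d(2) i(1)[of n] by blast
    qed
    have "cmod (cinner (x (i n)) v) \<le> \<bar>M\<bar> + (\<Sum>k<N. cmod (cinner (x (i k)) v))" for n
    proof (cases "n < N")
      case True
      then have "cmod (cinner (x (i n)) v) \<le> (\<Sum>k<N. cmod (cinner (x (i k)) v))"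
        by (intro member_le_sum) auto
      then show ?thesis by simp
    next
      case False
      have "0 \<le> (\<Sum>k<N. cmod (cinner (x (i k)) v))" by (rule sum_nonneg) simp
      then show ?thesis using late[of n] False by simp
    qed
    then show "\<exists>M. \<forall>n\<in>UNIV. cmod (cinner (x (i n)) v) \<le> M" by blast
  qed
  then obtain C where "\<And>n. norm (x (i n)) \<le> C" by blast
  moreover obtain n where "C \<le> real n" using real_arch_simple by blast
  ultimately show False using i(3)[of n] by (meson leD order_trans)
qed

lemma selfadjoint_symmetric:
  assumes "selfadjoint_op V T" "u \<in> V" "v \<in> V"
  shows "cinner (T u) v = cinner u (T v)"
proof -
  have "(v, T v) \<in> adjoint_graph V T" using assms by (auto simp: selfadjoint_op_def)
  then show ?thesis using assms(2) by (simp add: adjoint_graph_def)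
qed

lemma resolvent_props:
  assumes "z \<in> resolvent_set V T"
  shows "resolvent V T z h \<in> V" "u \<in> V \<Longrightarrow> resolvent V T z (T u - z *\<^sub>C u) = u"
    "bounded_linear (resolvent V T z)"
proof -
  have b: "bij_betw (\<lambda>u. T u - z *\<^sub>C u) V UNIV" and "bounded_linear (resolvent V T z)"
    using assms by (auto simp: resolvent_set_def)
  then show "bounded_linear (resolvent V T z)" by simp
  show "resolvent V T z h \<in> V"
    unfolding resolvent_def by (rule inv_into_into) (use b in \<open>auto simp: bij_betw_def\<close>)
  show "resolvent V T z (T u - z *\<^sub>C u) = u" if "u \<in> V"
    unfolding resolvent_def using inv_into_f_f[OF bij_betw_imp_inj_on[OF b] that] by simp
qed

lemma compact_selfadjoint_of_compact_resolvent:
  assumes sa: "selfadjoint_op V T" and cr: "compact_resolvent V T"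
  shows "compact_selfadjoint UNIV V T"
proof
  have lin: "linear_on_dom V T" using sa by (simp add: selfadjoint_op_def)
  show "complex_vector.subspace V" using lin by (simp add: linear_on_dom_def)
  show "T (u + v) = T u + T v" if "u \<in> V" "v \<in> V" for u v using lin that by (simp add: linear_on_dom_def)
  show "T (a *\<^sub>C u) = a *\<^sub>C T u" if "u \<in> V" for a u using lin that by (simp add: linear_on_dom_def)
  show "cinner (T u) v = cinner u (T v)" if "u \<in> V" "v \<in> V" for u v
    by (rule selfadjoint_symmetric[OF sa that])
  show "p \<in> V \<and> T p = q" if "\<And>w. w \<in> V \<Longrightarrow> cinner (T w) p = cinner w q" for p q
  proof -
    have "(p, q) \<in> adjoint_graph V T" using that by (simp add: adjoint_graph_def)
    then show ?thesis using sa by (auto simp: selfadjoint_op_def)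
  qed
  obtain z where z: "z \<in> resolvent_set V T" "compact_op (resolvent V T z)"
    using cr by (auto simp: compact_resolvent_def)
  define R where "R = resolvent V T z"
  show "\<exists>Z. compact Z \<and> {u \<in> V. norm u \<le> C \<and> norm (T u) \<le> C} \<subseteq> Z" for C
  proof (intro exI conjI subsetI)
    define M where "M = \<bar>C\<bar> + cmod z * \<bar>C\<bar> + 1"
    have M: "0 < M" by (simp add: M_def add_nonneg_pos)
    show "compact ((\<lambda>x. M *\<^sub>R x) ` closure (R ` cball 0 1))"
      using z(2) by (intro compact_scaling) (simp add: compact_op_def R_def)
    fix u assume u: "u \<in> {u \<in> V. norm u \<le> C \<and> norm (T u) \<le> C}"
    define h where "h = T u - z *\<^sub>C u"
    have "norm h \<le> norm (T u) + cmod z * norm u"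
      unfolding h_def using norm_triangle_ineq4[of "T u" "z *\<^sub>C u"] by (simp add: norm_scaleC)
    also have "\<dots> \<le> \<bar>C\<bar> + cmod z * \<bar>C\<bar>" using u by (intro add_mono mult_left_mono) auto
    finally have "norm ((1 / M) *\<^sub>R h) \<le> 1" using M by (simp add: M_def)
    then have "R ((1 / M) *\<^sub>R h) \<in> closure (R ` cball 0 1)" by (intro subsetD[OF closure_subset] imageI) simp
    moreover have "u = M *\<^sub>R R ((1 / M) *\<^sub>R h)"
      using resolvent_props(2,3)[OF z(1)] u M by (simp add: R_def h_def linear_simps(5))
    ultimately show "u \<in> (\<lambda>x. M *\<^sub>R x) ` closure (R ` cball 0 1)" by blast
  qed
qed auto

lemma norm_le_of_dense:
  assumes "closure V = UNIV" "0 \<le> C" "\<And>v. v \<in> V \<Longrightarrow> cmod (cinner y v) \<le> C * norm v"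
  shows "norm y \<le> C"
proof -
  have "y \<in> closure V" using assms(1) by simp
  then obtain v where v: "\<And>n. v n \<in> V" "v \<longlonglongrightarrow> y" unfolding closure_sequential by blast
  have "cmod (cinner y y) \<le> C * norm y"
    by (rule LIMSEQ_le[of "\<lambda>n. cmod (cinner y (v n))" _ "\<lambda>n. C * norm (v n)"])
      (use v assms(3) in \<open>auto intro!: tendsto_intros cinner.tendsto\<close>)
  then have "norm y * norm y \<le> C * norm y" by (simp add: cinner_self power2_eq_square norm_mult)
  then show ?thesis using assms(2) by (cases "y = 0") (simp_all add: mult_le_cancel_right)
qed

text \<open>
  The argument of Hellinger and Toeplitz: with \<open>R\<close> the resolvent of \<open>T\<close>, symmetry turns the functionals
  \<open>h \<mapsto> \<langle>Y R h, v\<rangle>\<close> into \<open>h \<mapsto> \<langle>R h, Y v\<rangle>\<close>, which are bounded although \<open>Y R\<close> is not known to be.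
  Uniform boundedness over the unit vectors \<open>v\<close> of the domain bounds \<open>Y R\<close>, for all indices at once.
\<close>

lemma relative_bound:
  fixes Y :: "'i \<Rightarrow> 'h::complex_hilbert_space \<Rightarrow> 'h"
  assumes sa: "selfadjoint_op V T" and z: "z \<in> resolvent_set V T"
    and sym: "\<And>i u v. i \<in> I \<Longrightarrow> u \<in> V \<Longrightarrow> v \<in> V \<Longrightarrow> cinner (Y i u) v = cinner u (Y i v)"
    and bd: "\<And>u. u \<in> V \<Longrightarrow> \<exists>M. \<forall>i\<in>I. norm (Y i u) \<le> M"
  shows "\<exists>C\<ge>0. \<forall>i\<in>I. \<forall>u\<in>V. norm (Y i u) \<le> C * (norm u + norm (T u))"
proof -
  define R where "R = resolvent V T z"
  note R = resolvent_props[OF z, folded R_def]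
  define U where "U = {v \<in> V. norm v \<le> 1}"
  define f where "f = (\<lambda>(i, v) h. cinner (R h) (Y i v))"
  have V: "complex_vector.subspace V" and den: "closure V = UNIV"
    using sa by (auto simp: selfadjoint_op_def linear_on_dom_def)
  have "\<exists>C\<ge>0. \<forall>g\<in>f ` (I \<times> U). \<forall>h. norm (g h) \<le> C * norm h"
  proof (rule uniform_boundedness)
    fix g assume "g \<in> f ` (I \<times> U)"
    then show "bounded_linear g"
      by (auto simp: f_def intro: bounded_linear_compose[OF cinner.bounded_linear_left R(3)])
  next
    fix h
    obtain M where M: "\<forall>i\<in>I. norm (Y i (R h)) \<le> M" using bd[OF R(1)] by blast
    have "norm (f (i, v) h) \<le> M" if "i \<in> I" "v \<in> U" for i v
    proof -
      have "f (i, v) h = cinner (Y i (R h)) v" using that sym R(1) by (simp add: f_def U_def)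
      also have "cmod \<dots> \<le> norm (Y i (R h)) * norm v" by (rule cmod_cinner_le)
      also have "\<dots> \<le> M * 1" using M that by (intro mult_mono) (auto simp: U_def intro: order_trans[OF norm_ge_zero])
      finally show ?thesis by simp
    qed
    then show "\<exists>M. \<forall>g\<in>f ` (I \<times> U). norm (g h) \<le> M" by blast
  qed
  then obtain C where C: "C \<ge> 0" "\<And>i v h. i \<in> I \<Longrightarrow> v \<in> U \<Longrightarrow> cmod (f (i, v) h) \<le> C * norm h" by auto
  have est: "norm (Y i (R h)) \<le> C * norm h" if i: "i \<in> I" for i h
  proof (rule norm_le_of_dense[OF den])
    fix v assume v: "v \<in> V"
    show "cmod (cinner (Y i (R h)) v) \<le> C * norm h * norm v"
    proof (cases "v = 0")
      case False
      let ?w = "complex_of_real (1 / norm v) *\<^sub>C v"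
      have w: "?w \<in> U" using v V False by (simp add: U_def norm_scaleC norm_divide complex_vector.subspace_scale)
      then have "cmod (cinner (Y i (R h)) ?w) \<le> C * norm h"
        using C(2)[OF i w, of h] sym[OF i R(1), of ?w h] by (simp add: f_def U_def)
      then show ?thesis using False by (simp add: cinner_scaleC_right norm_mult norm_divide field_simps)
    qed (simp add: cinner.zero_right)
  qed (use C in simp)
  have "norm (Y i u) \<le> C * (1 + cmod z) * (norm u + norm (T u))" if "i \<in> I" "u \<in> V" for i u
  proof -
    have "norm (Y i u) \<le> C * norm (T u - z *\<^sub>C u)" using est[OF that(1), of "T u - z *\<^sub>C u"] R(2)[OF that(2)] by simp
    also have "norm (T u - z *\<^sub>C u) \<le> norm (T u) + cmod z * norm u"
      using norm_triangle_ineq4[of "T u" "z *\<^sub>C u"] by (simp add: norm_scaleC)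
    also have "\<dots> \<le> (1 + cmod z) * (norm u + norm (T u))" by (simp add: algebra_simps)
    finally show ?thesis using C(1) by (simp add: mult.assoc mult_left_mono)
  qed
  then show ?thesis using C(1) by (intro exI[of _ "C * (1 + cmod z)"]) auto
qed

text \<open>
  As for weak boundedness, the radius may depend on the vector \<open>u\<close>.
\<close>

lemma relative_bound_near:
  fixes Y :: "'i \<Rightarrow> 'h::complex_hilbert_space \<Rightarrow> 'h" and \<sigma> :: "'i \<Rightarrow> real"
  assumes sa: "selfadjoint_op V T" and z: "z \<in> resolvent_set V T"
    and sym: "\<And>i u v. i \<in> I \<Longrightarrow> u \<in> V \<Longrightarrow> v \<in> V \<Longrightarrow> cinner (Y i u) v = cinner u (Y i v)"
    and bd: "\<And>u. u \<in> V \<Longrightarrow> \<exists>d>0. \<exists>M. \<forall>i\<in>I. \<sigma> i < d \<longrightarrow> norm (Y i u) \<le> M"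
  shows "\<exists>d>0. \<exists>C\<ge>0. \<forall>i\<in>I. \<sigma> i < d \<longrightarrow> (\<forall>u\<in>V. norm (Y i u) \<le> C * (norm u + norm (T u)))"
proof (rule ccontr)
  assume neg: "\<not> ?thesis"
  have "\<exists>i\<in>I. \<sigma> i < inverse (real (Suc n)) \<and> (\<exists>u\<in>V. real n * (norm u + norm (T u)) < norm (Y i u))" for n
  proof -
    have "0 < inverse (real (Suc n))" "0 \<le> real n" by auto
    then show ?thesis using neg by (meson not_le)
  qed
  then obtain i where i: "\<And>n. i n \<in> I" "\<And>n. \<sigma> (i n) < inverse (real (Suc n))"
    "\<And>n. \<exists>u\<in>V. real n * (norm u + norm (T u)) < norm (Y (i n) u)"
    by metis
  have "\<exists>C\<ge>0. \<forall>n\<in>UNIV. \<forall>u\<in>V. norm (Y (i n) u) \<le> C * (norm u + norm (T u))"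
  proof (rule relative_bound[OF sa z])
    show "cinner (Y (i n) u) v = cinner u (Y (i n) v)" if "u \<in> V" "v \<in> V" for n u v
      by (rule sym[OF i(1) that])
    fix u assume u: "u \<in> V"
    obtain d M where d: "d > 0" "\<forall>i\<in>I. \<sigma> i < d \<longrightarrow> norm (Y i u) \<le> M" using bd[OF u] by blast
    obtain N where N: "inverse (real (Suc N)) < d" using reals_Archimedean[OF d(1)] by blast
    have late: "norm (Y (i n) u) \<le> M" if "n \<ge> N" for n
    proof -
      have "inverse (real (Suc n)) \<le> inverse (real (Suc N))" using that by (intro le_imp_inverse_le) auto
      then have "\<sigma> (i n) < d" using i(2)[of n] N by linarith
      then show ?thesis using d(2) i(1)[of n] by blast
    qed
    have "norm (Y (i n) u) \<le> \<bar>M\<bar> + (\<Sum>k<N. norm (Y (i k) u))" for n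
    proof (cases "n < N")
      case True
      then have "norm (Y (i n) u) \<le> (\<Sum>k<N. norm (Y (i k) u))"
        by (intro member_le_sum) auto
      then show ?thesis by simp
    next
      case False
      have "0 \<le> (\<Sum>k<N. norm (Y (i k) u))" by (rule sum_nonneg) simp
      then show ?thesis using late[of n] False by simp
    qed
    then show "\<exists>M. \<forall>n\<in>UNIV. norm (Y (i n) u) \<le> M" by blast
  qed
  then obtain C where C: "\<And>n u. u \<in> V \<Longrightarrow> norm (Y (i n) u) \<le> C * (norm u + norm (T u))" by auto
  obtain n where n: "C \<le> real n" using real_arch_simple by blast
  obtain u where u: "u \<in> V" "real n * (norm u + norm (T u)) < norm (Y (i n) u)" using i(3) by blast
  have "C * (norm u + norm (T u)) \<le> real n * (norm u + norm (T u))" using n by (intro mult_right_mono) auto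
  then show False using C[OF u(1), of n] u(2) by simp
qed

section \<open>From weakly to strongly differentiable curves\<close>

lemma powr_small:
  fixes \<alpha> e :: real
  assumes "0 < \<alpha>" "0 < e"
  shows "\<exists>d>0. \<forall>h. \<bar>h\<bar> < d \<longrightarrow> \<bar>h\<bar> powr \<alpha> \<le> e"
proof (intro exI[of _ "e powr (1 / \<alpha>)"] conjI allI impI)
  fix h :: real assume "\<bar>h\<bar> < e powr (1 / \<alpha>)"
  then have "\<bar>h\<bar> powr \<alpha> \<le> (e powr (1 / \<alpha>)) powr \<alpha>" using assms by (intro powr_mono2) auto
  also have "\<dots> = e" using assms by (simp add: powr_powr)
  finally show "\<bar>h\<bar> powr \<alpha> \<le> e" .
qed (use assms in simp)

lemma C_holder_1:
  assumes "C_holder 1 \<alpha> f"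
  shows "(f has_vector_derivative vector_derivative f (at t)) (at t)"
    and "\<exists>d>0. \<exists>M\<ge>0. \<forall>t. \<bar>t - s\<bar> < d \<longrightarrow>
      norm (vector_derivative f (at t) - vector_derivative f (at s)) \<le> M * \<bar>t - s\<bar> powr \<alpha>"
proof -
  have "f differentiable (at t)" for t using assms by (simp add: C_holder_def nth_deriv_def)
  then show "(f has_vector_derivative vector_derivative f (at t)) (at t)" for t
    by (simp add: vector_derivative_works)
  let ?g = "\<lambda>t. vector_derivative f (at t)"
  have "\<forall>p::real \<times> real. \<exists>U M. open U \<and> p \<in> U \<and>
        (\<forall>(t, r)\<in>U. t \<noteq> r \<longrightarrow> norm (?g t - ?g r) / \<bar>t - r\<bar> powr \<alpha> \<le> M)"
    using assms by (simp add: C_holder_def nth_deriv_def)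
  from this[rule_format, of "(s, s)"] obtain U M where U: "open U" "(s, s) \<in> U"
    and M: "\<forall>(t, r)\<in>U. t \<noteq> r \<longrightarrow> norm (?g t - ?g r) / \<bar>t - r\<bar> powr \<alpha> \<le> M"
    by (elim exE conjE)
  obtain A B where "open A" "open B" "(s, s) \<in> A \<times> B" "A \<times> B \<subseteq> U"
    using U by (rule open_prod_elim)
  then have AB: "open A" "open B" "s \<in> A" "s \<in> B" "A \<times> B \<subseteq> U" by auto
  obtain d where d: "d > 0" "ball s d \<subseteq> A" using AB by (meson open_contains_ball)
  have "norm (?g t - ?g s) \<le> max 0 M * \<bar>t - s\<bar> powr \<alpha>" if "\<bar>t - s\<bar> < d" for t
  proof (cases "t = s")
    case False
    have "t \<in> ball s d" using that by (simp add: dist_real_def abs_minus_commute)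
    then have tU: "(t, s) \<in> U" using d(2) AB by blast
    have "norm (?g t - ?g s) / \<bar>t - s\<bar> powr \<alpha> \<le> M"
      using bspec[OF M tU] False by simp
    then have "norm (?g t - ?g s) \<le> M * \<bar>t - s\<bar> powr \<alpha>" using False by (simp add: field_simps)
    also have "\<dots> \<le> max 0 M * \<bar>t - s\<bar> powr \<alpha>" by (intro mult_right_mono) auto
    finally show ?thesis .
  qed simp
  then show "\<exists>d>0. \<exists>M\<ge>0. \<forall>t. \<bar>t - s\<bar> < d \<longrightarrow> norm (?g t - ?g s) \<le> M * \<bar>t - s\<bar> powr \<alpha>"
    using d(1) by (intro exI[of _ d] conjI exI[of _ "max 0 M"]) auto
qed

lemma linearization:
  fixes f :: "real \<Rightarrow> 'b::real_normed_vector"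
  assumes f': "\<And>x. (f has_vector_derivative f' x) (at x)"
    and B: "\<And>x. \<bar>x - s\<bar> \<le> \<bar>t - s\<bar> \<Longrightarrow> norm (f' x - f' s) \<le> B"
  shows "norm (f t - f s - (t - s) *\<^sub>R f' s) \<le> \<bar>t - s\<bar> * B"
proof -
  have seg: "\<bar>x - s\<bar> \<le> \<bar>t - s\<bar>" if "x \<in> closed_segment s t" for x
    using that by (auto simp: closed_segment_eq_real_ivl split: if_splits)
  have "norm (f t - f s - (t - s) *\<^sub>R f' s) \<le> norm (t - s) * B"
    by (rule vector_differentiable_bound_linearization[of "closed_segment s t"])
      (use seg B f' in \<open>auto intro: has_vector_derivative_at_within\<close>)
  then show ?thesis by simp
qed

text \<open>
  The difference quotients at \<open>h\<close> and \<open>k\<close> differ weakly by \<open>O(\<bar>h\<bar>\<^sup>\<alpha> + \<bar>k\<bar>\<^sup>\<alpha>)\<close>, hence also in norm by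
  uniform boundedness, and completeness provides their limit. This is where \<open>\<alpha> > 0\<close> is used.
\<close>

lemma weakly_C1_holder_imp_derivative:
  fixes f :: "real \<Rightarrow> 'h::complex_hilbert_space"
  assumes \<alpha>: "0 < \<alpha>" and f: "\<And>v. C_holder 1 \<alpha> (\<lambda>t. cinner (f t) v)"
  shows "(f has_vector_derivative vector_derivative f (at s)) (at s)"
proof -
  define q where "q h = (1 / h) *\<^sub>R (f (s + h) - f s)" for h
  have weak: "\<exists>d>0. \<exists>M\<ge>0. \<forall>h. h \<noteq> 0 \<longrightarrow> \<bar>h\<bar> < d \<longrightarrow>
      cmod (cinner (q h) v - vector_derivative (\<lambda>t. cinner (f t) v) (at s)) \<le> M * \<bar>h\<bar> powr \<alpha>" for v
  proof -
    define g where "g = (\<lambda>t. cinner (f t) v)"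
    define g' where "g' t = vector_derivative g (at t)" for t
    note ch = C_holder_1[OF f[of v], folded g_def, folded g'_def]
    obtain d M where d: "d > 0" "M \<ge> 0" "\<forall>t. \<bar>t - s\<bar> < d \<longrightarrow> cmod (g' t - g' s) \<le> M * \<bar>t - s\<bar> powr \<alpha>"
      using ch(2) by blast
    have "cmod (cinner (q h) v - g' s) \<le> M * \<bar>h\<bar> powr \<alpha>" if h: "h \<noteq> 0" "\<bar>h\<bar> < d" for h
    proof -
      have "cmod (g (s + h) - g s - (s + h - s) *\<^sub>R g' s) \<le> \<bar>s + h - s\<bar> * (M * \<bar>h\<bar> powr \<alpha>)"
      proof (rule linearization[OF ch(1)])
        fix x assume x: "\<bar>x - s\<bar> \<le> \<bar>s + h - s\<bar>"
        then have "cmod (g' x - g' s) \<le> M * \<bar>x - s\<bar> powr \<alpha>" using d(3) h by auto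
        also have "\<dots> \<le> M * \<bar>h\<bar> powr \<alpha>" using x d(2) \<alpha> by (intro mult_left_mono powr_mono2) auto
        finally show "cmod (g' x - g' s) \<le> M * \<bar>h\<bar> powr \<alpha>" .
      qed
      moreover have "g (s + h) - g s - (s + h - s) *\<^sub>R g' s = h *\<^sub>R (cinner (q h) v - g' s)"
        using h by (simp add: q_def g_def cinner.scaleR_left cinner.diff_left scaleR_diff_right)
      ultimately show ?thesis using h by simp
    qed
    then show ?thesis using d(1,2) unfolding g_def g'_def by blast
  qed
  define I where "I = {(h::real, k::real). h \<noteq> 0 \<and> k \<noteq> 0}"
  define \<sigma> where "\<sigma> = (\<lambda>(h::real, k::real). \<bar>h\<bar> + \<bar>k\<bar>)"
  \<comment> \<open>Normalised differences of difference quotients, indexed by the two increments.\<close>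
  define x where "x = (\<lambda>(h, k). (1 / (\<bar>h\<bar> powr \<alpha> + \<bar>k\<bar> powr \<alpha>)) *\<^sub>R (q h - q k))"
  have "\<exists>d>0. \<exists>C\<ge>0. \<forall>i\<in>I. \<sigma> i < d \<longrightarrow> norm (x i) \<le> C"
  proof (rule weakly_bounded_near)
    fix v
    define L where "L = vector_derivative (\<lambda>t. cinner (f t) v) (at s)"
    obtain d M where d: "d > 0" "M \<ge> 0"
      and M: "\<And>h. h \<noteq> 0 \<Longrightarrow> \<bar>h\<bar> < d \<Longrightarrow> cmod (cinner (q h) v - L) \<le> M * \<bar>h\<bar> powr \<alpha>"
      using weak[of v] unfolding L_def by blast
    have "cmod (cinner (x (h, k)) v) \<le> M" if hk: "h \<noteq> 0" "k \<noteq> 0" "\<bar>h\<bar> + \<bar>k\<bar> < d" for h k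
    proof -
      define S where "S = \<bar>h\<bar> powr \<alpha> + \<bar>k\<bar> powr \<alpha>"
      have S: "0 < S" using hk by (simp add: S_def add_pos_pos)
      have hk': "\<bar>h\<bar> < d" "\<bar>k\<bar> < d" using hk by linarith+
      have "cmod (cinner (q h) v - cinner (q k) v) \<le> cmod (cinner (q h) v - L) + cmod (cinner (q k) v - L)"
        using norm_triangle_ineq4[of "cinner (q h) v - L" "cinner (q k) v - L"] by simp
      also have "cmod (cinner (q h) v - L) + cmod (cinner (q k) v - L) \<le> M * S"
        using M[OF hk(1) hk'(1)] M[OF hk(2) hk'(2)] by (simp add: S_def distrib_left)
      finally have "cmod (cinner (q h) v - cinner (q k) v) / S \<le> M" using S by (simp add: field_simps)
      then show ?thesis using S by (simp add: x_def S_def[symmetric] cinner.scaleR_left cinner.diff_left)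
    qed
    then show "\<exists>d>0. \<exists>M. \<forall>i\<in>I. \<sigma> i < d \<longrightarrow> cmod (cinner (x i) v) \<le> M"
      using d(1) by (intro exI[of _ d] conjI exI[of _ M]) (auto simp: I_def \<sigma>_def)
  qed
  then obtain d C where d: "d > 0" "C \<ge> 0" and C: "\<forall>i\<in>I. \<sigma> i < d \<longrightarrow> norm (x i) \<le> C" by blast
  have qq: "norm (q h - q k) \<le> C * (\<bar>h\<bar> powr \<alpha> + \<bar>k\<bar> powr \<alpha>)" if hk: "h \<noteq> 0" "k \<noteq> 0" "\<bar>h\<bar> + \<bar>k\<bar> < d" for h k
  proof -
    define S where "S = \<bar>h\<bar> powr \<alpha> + \<bar>k\<bar> powr \<alpha>"
    have S: "0 < S" using hk by (simp add: S_def add_pos_pos)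
    have "norm (x (h, k)) \<le> C" using C hk by (simp add: I_def \<sigma>_def)
    moreover have "norm (x (h, k)) = norm (q h - q k) / S" using S by (simp add: x_def S_def[symmetric])
    ultimately show ?thesis using S by (simp add: pos_divide_le_eq S_def)
  qed
  define k where "k n = inverse (real (Suc n))" for n
  have k0: "k n \<noteq> 0" "0 < k n" for n by (auto simp: k_def)
  have kl: "k \<longlonglongrightarrow> 0" unfolding k_def[abs_def] by (rule LIMSEQ_inverse_real_of_nat)
  have kp: "(\<lambda>n. \<bar>k n\<bar> powr \<alpha>) \<longlonglongrightarrow> 0"
    by (rule tendsto_zero_powrI[OF tendsto_rabs_zero[OF kl] tendsto_const]) (use \<alpha> in auto)
  have "Cauchy (\<lambda>n. q (k n))"
  proof (rule metric_CauchyI)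
    fix e :: real assume e: "0 < e"
    define e' where "e' = e / (2 * (C + 1))"
    have e': "0 < e'" using e d by (simp add: e'_def)
    obtain N1 where N1: "\<And>n. n \<ge> N1 \<Longrightarrow> \<bar>k n\<bar> powr \<alpha> < e'" using LIMSEQ_D[OF kp e'] by auto
    obtain N2 where N2: "\<And>n. n \<ge> N2 \<Longrightarrow> \<bar>k n\<bar> < d / 2" using LIMSEQ_D[OF kl, of "d/2"] d by auto
    have "dist (q (k n)) (q (k m)) < e" if nm: "n \<ge> max N1 N2" "m \<ge> max N1 N2" for n m
    proof -
      have "norm (q (k n) - q (k m)) \<le> C * (\<bar>k n\<bar> powr \<alpha> + \<bar>k m\<bar> powr \<alpha>)"
        using N2[of n] N2[of m] nm k0 by (intro qq) auto
      also have "\<dots> \<le> C * (2 * e')" using N1[of n] N1[of m] nm d by (intro mult_left_mono) auto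
      also have "\<dots> < (C + 1) * (2 * e')" using e' d by simp
      also have "\<dots> = e" using d unfolding e'_def by (simp add: nonzero_divide_eq_eq add_nonneg_eq_0_iff)
      finally show ?thesis by (simp add: dist_norm)
    qed
    then show "\<exists>M. \<forall>m\<ge>M. \<forall>n\<ge>M. dist (q (k m)) (q (k n)) < e" by blast
  qed
  then obtain L where L: "(\<lambda>n. q (k n)) \<longlonglongrightarrow> L" using Cauchy_convergent convergentD by blast
  have qL: "norm (q h - L) \<le> C * \<bar>h\<bar> powr \<alpha>" if h: "h \<noteq> 0" "\<bar>h\<bar> < d / 2" for h
  proof -
    obtain N2 where N2: "\<And>n. n \<ge> N2 \<Longrightarrow> \<bar>k n\<bar> < d / 2" using LIMSEQ_D[OF kl, of "d/2"] d by auto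
    have "norm (q h - L) \<le> C * (\<bar>h\<bar> powr \<alpha> + 0)"
    proof (rule LIMSEQ_le)
      show "(\<lambda>n. norm (q h - q (k n))) \<longlonglongrightarrow> norm (q h - L)" by (intro tendsto_intros L)
      show "(\<lambda>n. C * (\<bar>h\<bar> powr \<alpha> + \<bar>k n\<bar> powr \<alpha>)) \<longlonglongrightarrow> C * (\<bar>h\<bar> powr \<alpha> + 0)" by (intro tendsto_intros kp)
      have "norm (q h - q (k n)) \<le> C * (\<bar>h\<bar> powr \<alpha> + \<bar>k n\<bar> powr \<alpha>)" if "n \<ge> N2" for n
        using N2[OF that] h k0 by (intro qq) auto
      then show "\<exists>N. \<forall>n\<ge>N. norm (q h - q (k n)) \<le> C * (\<bar>h\<bar> powr \<alpha> + \<bar>k n\<bar> powr \<alpha>)" by blast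
    qed
    then show ?thesis by simp
  qed
  have "(f has_vector_derivative L) (at s)"
    unfolding has_vector_derivative_def has_derivative_at_alt
  proof (intro conjI allI impI)
    show "bounded_linear (\<lambda>x. x *\<^sub>R L)" by (rule bounded_linear_scaleR_left)
    fix e :: real assume e: "0 < e"
    obtain d' where d': "d' > 0" "\<forall>h. \<bar>h\<bar> < d' \<longrightarrow> \<bar>h\<bar> powr \<alpha> \<le> e / (C + 1)"
      using powr_small[OF \<alpha>, of "e / (C + 1)"] e d by auto
    have "norm (f y - f s - (y - s) *\<^sub>R L) \<le> e * norm (y - s)" if y: "norm (y - s) < min d' (d/2)" for y
    proof (cases "y = s")
      case False
      define h where "h = y - s"
      have h: "h \<noteq> 0" "\<bar>h\<bar> < d'" "\<bar>h\<bar> < d / 2" using False y by (auto simp: h_def)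
      have "norm (q h - L) \<le> C * \<bar>h\<bar> powr \<alpha>" by (rule qL[OF h(1,3)])
      also have "\<dots> \<le> C * (e / (C + 1))" using d'(2) h d by (intro mult_left_mono) auto
      also have "\<dots> \<le> e" using e d by (simp add: field_simps)
      finally have *: "norm (q h - L) \<le> e" .
      have "f y - f s - (y - s) *\<^sub>R L = h *\<^sub>R (q h - L)"
        using h by (simp add: q_def h_def[symmetric] scaleR_diff_right) (simp add: h_def)
      then show ?thesis using mult_right_mono[OF *, of "\<bar>h\<bar>"] by (simp add: h_def[symmetric] mult.commute)
    qed simp
    then show "\<exists>d>0. \<forall>y. norm (y - s) < d \<longrightarrow> norm (f y - f s - (y - s) *\<^sub>R L) \<le> e * norm (y - s)"
      using d' d by (intro exI[of _ "min d' (d/2)"]) auto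
  qed
  then show ?thesis using vector_derivative_at by metis
qed

text \<open>
  Here \<open>D\<close> is the derivative of \<open>A\<close>; both depend continuously on time in the sense of operators from
  the domain, with its graph norm, to the Hilbert space.
\<close>

locale selfadjoint_curve =
  fixes V :: "'h::complex_hilbert_space set" and A D :: "real \<Rightarrow> 'h \<Rightarrow> 'h"
  assumes csa: "\<And>t. compact_selfadjoint UNIV V (A t)"
    and D_add: "\<And>t u v. u \<in> V \<Longrightarrow> v \<in> V \<Longrightarrow> D t (u + v) = D t u + D t v"
    and D_scale: "\<And>t a u. u \<in> V \<Longrightarrow> D t (a *\<^sub>C u) = a *\<^sub>C D t u"
    and D_sym: "\<And>t u v. u \<in> V \<Longrightarrow> v \<in> V \<Longrightarrow> cinner (D t u) v = cinner u (D t v)"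
    and D_bound: "\<And>t. \<exists>C\<ge>0. \<forall>u\<in>V. norm (D t u) \<le> C * (norm u + norm (A t u))"
    and C1: "\<And>t0 e. 0 < e \<Longrightarrow> \<exists>d>0. \<forall>t. \<bar>t - t0\<bar> < d \<longrightarrow> (\<forall>u\<in>V.
       norm (D t u - D t0 u) \<le> e * (norm u + norm (A t0 u)) \<and>
       norm (A t u - A t0 u - (t - t0) *\<^sub>R D t0 u) \<le> e * \<bar>t - t0\<bar> * (norm u + norm (A t0 u)))"

lemma selfadjoint_curve_of_C1_holder:
  fixes A :: "real \<Rightarrow> 'h::complex_hilbert_space \<Rightarrow> 'h"
  assumes \<alpha>: "0 < \<alpha>" and sa: "\<And>t. selfadjoint_op V (A t)" and C: "C_holder_curve 1 \<alpha> V A"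
    and cr: "\<And>t. compact_resolvent V (A t)"
  shows "selfadjoint_curve V A (\<lambda>t u. vector_derivative (\<lambda>t. A t u) (at t))"
proof -
  define D where "D t u = vector_derivative (\<lambda>t. A t u) (at t)" for t u
  have csa: "compact_selfadjoint UNIV V (A t)" for t
    by (rule compact_selfadjoint_of_compact_resolvent[OF sa cr])
  have ch: "C_holder 1 \<alpha> (\<lambda>t. cinner (A t u) v)" if "u \<in> V" for u v
    using C that by (simp add: C_holder_curve_def)
  have der: "((\<lambda>t. A t u) has_vector_derivative D t u) (at t)" if "u \<in> V" for t u
    unfolding D_def by (rule weakly_C1_holder_imp_derivative[OF \<alpha> ch[OF that]])
  have derw: "((\<lambda>t. cinner (A t u) v) has_vector_derivative cinner (D t u) v) (at t)" if "u \<in> V" for t u v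
    by (rule bounded_linear.has_vector_derivative[OF cinner.bounded_linear_left der[OF that]])
  have derw': "((\<lambda>t. cinner v (A t u)) has_vector_derivative cinner v (D t u)) (at t)" if "u \<in> V" for t u v
    by (rule bounded_linear.has_vector_derivative[OF cinner.bounded_linear_right der[OF that]])
  have V: "u + v \<in> V" "a *\<^sub>C u \<in> V" if "u \<in> V" "v \<in> V" for u v a
    using compact_selfadjoint.K_add[OF csa] compact_selfadjoint.K_scale[OF csa] that by auto
  have D_add: "D t (u + v) = D t u + D t v" if "u \<in> V" "v \<in> V" for t u v
  proof -
    have "((\<lambda>t. A t (u + v)) has_vector_derivative D t u + D t v) (at t)"
      using has_vector_derivative_add[OF der[OF that(1)] der[OF that(2)]]
        compact_selfadjoint.S_add[OF csa that] by simp
    then show ?thesis using der[OF V(1)[OF that]] by (rule vector_derivative_unique_at[rotated])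
  qed
  have D_scale: "D t (a *\<^sub>C u) = a *\<^sub>C D t u" if "u \<in> V" for t u a
  proof -
    have "((\<lambda>t. A t (a *\<^sub>C u)) has_vector_derivative a *\<^sub>C D t u) (at t)"
      using bounded_linear.has_vector_derivative[OF scaleC.bounded_linear_right der[OF that]]
        compact_selfadjoint.S_scale[OF csa that] by simp
    then show ?thesis using der[OF V(2)[OF that that]] by (rule vector_derivative_unique_at[rotated])
  qed
  have D_sym: "cinner (D t u) v = cinner u (D t v)" if "u \<in> V" "v \<in> V" for t u v
  proof -
    have "((\<lambda>t. cinner (A t u) v) has_vector_derivative cinner u (D t v)) (at t)"
      using derw'[OF that(2), of u t] selfadjoint_symmetric[OF sa that] by simp
    then show ?thesis using derw[OF that(1)] by (rule vector_derivative_unique_at[rotated])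
  qed
  obtain z where z: "\<And>t. z t \<in> resolvent_set V (A t)"
    using cr unfolding compact_resolvent_def by metis
  have D_bound: "\<exists>C\<ge>0. \<forall>u\<in>V. norm (D t u) \<le> C * (norm u + norm (A t u))" for t
  proof -
    have "\<exists>C\<ge>0. \<forall>i\<in>{()}. \<forall>u\<in>V. norm (D t u) \<le> C * (norm u + norm (A t u))"
      by (rule relative_bound[OF sa z]) (use D_sym in auto)
    then show ?thesis by simp
  qed
  have holder: "\<exists>d>0. \<exists>C\<ge>0. \<forall>t. \<bar>t - t0\<bar> < d \<longrightarrow>
      (\<forall>u\<in>V. norm (D t u - D t0 u) \<le> C * \<bar>t - t0\<bar> powr \<alpha> * (norm u + norm (A t0 u)))" for t0
  proof -
    define Y where "Y t u = (1 / \<bar>t - t0\<bar> powr \<alpha>) *\<^sub>R (D t u - D t0 u)" for t u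
    have "\<exists>d>0. \<exists>C\<ge>0. \<forall>t\<in>- {t0}. \<bar>t - t0\<bar> < d \<longrightarrow> (\<forall>u\<in>V. norm (Y t u) \<le> C * (norm u + norm (A t0 u)))"
    proof (rule relative_bound_near[OF sa z])
      show "cinner (Y t u) v = cinner u (Y t v)" if "u \<in> V" "v \<in> V" for t u v
        using D_sym[OF that] by (simp add: Y_def cinner.scaleR_left cinner.scaleR_right cinner.diff_left cinner.diff_right)
      fix u assume u: "u \<in> V"
      have "\<exists>d>0. \<exists>C\<ge>0. \<forall>t\<in>- {t0}. \<bar>t - t0\<bar> < d \<longrightarrow> norm (Y t u) \<le> C"
      proof (rule weakly_bounded_near)
        fix v
        have eq: "vector_derivative (\<lambda>t. cinner (A t u) v) (at t) = cinner (D t u) v" for t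
          by (rule vector_derivative_at[OF derw[OF u]])
        obtain d M where d: "d > 0" "M \<ge> 0" "\<forall>t. \<bar>t - t0\<bar> < d \<longrightarrow>
            cmod (cinner (D t u) v - cinner (D t0 u) v) \<le> M * \<bar>t - t0\<bar> powr \<alpha>"
          using C_holder_1(2)[OF ch[OF u, of v], of t0] unfolding eq by blast
        have "cmod (cinner (Y t u) v) \<le> M" if "t \<in> - {t0}" "\<bar>t - t0\<bar> < d" for t
        proof -
          have "cmod (cinner (Y t u) v) = cmod (cinner (D t u) v - cinner (D t0 u) v) / \<bar>t - t0\<bar> powr \<alpha>"
            by (simp add: Y_def cinner.scaleR_left cinner.diff_left)
          then show ?thesis using d(3)[rule_format, OF that(2)] that(1) by (simp add: pos_divide_le_eq)
        qed
        then show "\<exists>d>0. \<exists>M. \<forall>t\<in>- {t0}. \<bar>t - t0\<bar> < d \<longrightarrow> cmod (cinner (Y t u) v) \<le> M"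
          using d(1) by blast
      qed
      then show "\<exists>d>0. \<exists>M. \<forall>t\<in>- {t0}. \<bar>t - t0\<bar> < d \<longrightarrow> norm (Y t u) \<le> M" by blast
    qed
    then obtain d C where d: "d > 0" "C \<ge> 0"
      "\<forall>t\<in>- {t0}. \<bar>t - t0\<bar> < d \<longrightarrow> (\<forall>u\<in>V. norm (Y t u) \<le> C * (norm u + norm (A t0 u)))" by blast
    have "norm (D t u - D t0 u) \<le> C * \<bar>t - t0\<bar> powr \<alpha> * (norm u + norm (A t0 u))"
      if t: "\<bar>t - t0\<bar> < d" and u: "u \<in> V" for t u
    proof (cases "t = t0")
      case False
      then have "norm (Y t u) \<le> C * (norm u + norm (A t0 u))" using d(3) t u by blast
      moreover have "norm (Y t u) = norm (D t u - D t0 u) / \<bar>t - t0\<bar> powr \<alpha>" by (simp add: Y_def)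
      ultimately show ?thesis using False by (simp add: pos_divide_le_eq mult_ac)
    qed simp
    then show ?thesis using d(1,2) by blast
  qed
  have C1: "\<exists>d>0. \<forall>t. \<bar>t - t0\<bar> < d \<longrightarrow> (\<forall>u\<in>V.
       norm (D t u - D t0 u) \<le> e * (norm u + norm (A t0 u)) \<and>
       norm (A t u - A t0 u - (t - t0) *\<^sub>R D t0 u) \<le> e * \<bar>t - t0\<bar> * (norm u + norm (A t0 u)))"
    if e: "0 < e" for t0 e
  proof -
    obtain d C where d: "d > 0" "C \<ge> 0" and C: "\<And>t u. \<bar>t - t0\<bar> < d \<Longrightarrow> u \<in> V \<Longrightarrow>
      norm (D t u - D t0 u) \<le> C * \<bar>t - t0\<bar> powr \<alpha> * (norm u + norm (A t0 u))"
      using holder by meson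
    obtain d' where d': "d' > 0" "\<forall>h. \<bar>h\<bar> < d' \<longrightarrow> \<bar>h\<bar> powr \<alpha> \<le> e / (C + 1)"
      using powr_small[OF \<alpha>, of "e / (C + 1)"] e d by auto
    have 1: "norm (D t u - D t0 u) \<le> e * (norm u + norm (A t0 u))" if t: "\<bar>t - t0\<bar> < min d d'" and u: "u \<in> V" for t u
    proof -
      have "C * \<bar>t - t0\<bar> powr \<alpha> \<le> C * (e / (C + 1))" using d'(2) t d by (intro mult_left_mono) auto
      also have "\<dots> \<le> e" using e d by (simp add: field_simps)
      finally have "C * \<bar>t - t0\<bar> powr \<alpha> * (norm u + norm (A t0 u)) \<le> e * (norm u + norm (A t0 u))"
        by (rule mult_right_mono) simp
      then show ?thesis using C[of t u] t u by simp
    qed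
    have 2: "norm (A t u - A t0 u - (t - t0) *\<^sub>R D t0 u) \<le> e * \<bar>t - t0\<bar> * (norm u + norm (A t0 u))"
      if t: "\<bar>t - t0\<bar> < min d d'" and u: "u \<in> V" for t u
    proof -
      have "norm (A t u - A t0 u - (t - t0) *\<^sub>R D t0 u) \<le> \<bar>t - t0\<bar> * (e * (norm u + norm (A t0 u)))"
        by (rule linearization[OF der[OF u]]) (use 1 t u in auto)
      then show ?thesis by (simp add: mult_ac)
    qed
    show ?thesis using 1 2 d(1) d'(1) by (intro exI[of _ "min d d'"]) auto
  qed
  have "selfadjoint_curve V A D"
    by (rule selfadjoint_curve.intro) (fact csa D_add D_scale D_sym D_bound C1)+
  then show ?thesis by (simp add: D_def[abs_def])
qed

section \<open>The multiset of eigenvalues and eigenvalue derivatives\<close>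

lemma finite_separated:
  fixes M :: "real set"
  assumes "finite M"
  shows "\<exists>d>0. \<forall>x\<in>M. \<forall>y\<in>M. x \<noteq> y \<longrightarrow> 2 * d \<le> \<bar>x - y\<bar>"
proof -
  have "finite ((\<lambda>(x, y). x - y) ` (M \<times> M))" using assms by simp
  from finite_set_avoid[OF this, of 0] obtain d where
    d: "d > 0" "\<forall>z\<in>(\<lambda>(x, y). x - y) ` (M \<times> M). z \<noteq> 0 \<longrightarrow> d \<le> dist 0 z" by blast
  have "2 * (d/2) \<le> \<bar>x - y\<bar>" if "x \<in> M" "y \<in> M" "x \<noteq> y" for x y
    using d(2)[rule_format, of "x - y"] that by force
  then show ?thesis using d(1) by (intro exI[of _ "d/2"]) auto
qed

context selfadjoint_curve
begin

abbreviation eig :: "real \<Rightarrow> real \<Rightarrow> 'h set" where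
  "eig t l \<equiv> eigenspace V (A t) (complex_of_real l)"

abbreviation spec :: "real \<Rightarrow> real set \<Rightarrow> 'h set" where
  "spec t L \<equiv> compact_selfadjoint.spec V (A t) L"

text \<open>
  The eigenspace, for the eigenvalue \<open>m\<close>, of the compression of \<open>D t\<close> to the \<open>l\<close>-eigenspace of \<open>A t\<close>.
\<close>

definition pair_space :: "real \<Rightarrow> real \<Rightarrow> real \<Rightarrow> 'h set" where
  "pair_space t l m = {u \<in> eig t l. \<forall>v\<in>eig t l. cinner (D t u - complex_of_real m *\<^sub>C u) v = 0}"

definition mult :: "real \<Rightarrow> real \<times> real \<Rightarrow> nat" where
  "mult t p = complex_vector.dim (pair_space t (fst p) (snd p))"

text \<open>
  All compactness needed is inherited from \<open>A t\<close>, since its graph norm is equivalent to the norm on an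
  eigenspace.
\<close>

lemma compression:
  "\<exists>P. compact_selfadjoint (eig t l) (eig t l) P \<and>
    (\<forall>u. \<forall>v\<in>eig t l. cinner (P u) v = cinner (D t u) v) \<and>
    (\<forall>m. eigenspace (eig t l) P (complex_of_real m) = pair_space t l m)"
proof -
  interpret S: compact_selfadjoint UNIV V "A t" by (rule csa)
  define E where "E = eig t l"
  have EV: "E \<subseteq> V" by (auto simp: E_def eigenspace_def)
  have sE: "complex_vector.subspace E" unfolding E_def by (rule S.eig_subspace)
  have fE: "fin_dim E" unfolding E_def by (rule S.eig_fin_dim)
  obtain B where B: "finite B" "orthonormal B" "complex_vector.span B = E" "complex_vector.dim E = card B"
    using fE by (rule fin_dimE)
  define P where "P u = proj B (D t u)" for u
  have PE: "P u \<in> E" for u unfolding P_def using proj_in_span[of B] B(3) by simp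
  have PD: "cinner (P u) v = cinner (D t u) v" if "v \<in> E" for u v
    using proj_orth[OF B(1,2), of v "D t u"] that B(3) by (simp add: P_def cinner.diff_left)
  have PD': "cinner v (P u) = cinner v (D t u)" if "v \<in> E" for u v
    using PD[OF that, of u] by (metis cinner_commute)
  have cs: "compact_selfadjoint E E P"
  proof
    show "closed E"
      unfolding closed_sequential_limits
    proof (intro allI impI)
      fix x y assume "(\<forall>n. x n \<in> E) \<and> x \<longlonglongrightarrow> y"
      then have x: "\<And>n. x n \<in> E" and xl: "x \<longlonglongrightarrow> y" by auto
      have "(\<lambda>n. A t (x n)) = (\<lambda>n. complex_of_real l *\<^sub>C x n)" using x by (auto simp: E_def eigenspace_def)
      then have "(\<lambda>n. A t (x n)) \<longlonglongrightarrow> complex_of_real l *\<^sub>C y"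
        by (simp only:) (intro scaleC.tendsto tendsto_const xl)
      with S.S_closed[OF _ xl this] x EV show "y \<in> E" by (auto simp: E_def eigenspace_def)
    qed
    show "\<exists>Z. compact Z \<and> {u \<in> E. norm u \<le> C \<and> norm (P u) \<le> C} \<subseteq> Z" for C
    proof -
      define C' where "C' = \<bar>C\<bar> + \<bar>l\<bar> * \<bar>C\<bar>"
      obtain Z where Z: "compact Z" "{u \<in> V. norm u \<le> C' \<and> norm (A t u) \<le> C'} \<subseteq> Z"
        using S.relatively_compact by blast
      have "u \<in> Z" if "u \<in> E" "norm u \<le> C" for u
      proof -
        have "norm u \<le> \<bar>C\<bar>" using that by simp
        then have "norm u \<le> C'" by (simp add: C'_def add_increasing2)
        moreover have "norm (A t u) = \<bar>l\<bar> * norm u" using that by (simp add: E_def eigenspace_def norm_scaleC)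
        then have "norm (A t u) \<le> C'" using \<open>norm u \<le> \<bar>C\<bar>\<close> by (simp add: C'_def mult_left_mono add_increasing)
        ultimately show ?thesis using Z(2) that(1) EV by blast
      qed
      then show ?thesis using Z(1) by blast
    qed
    show "P (u + v) = P u + P v" if "u \<in> E" "v \<in> E" for u v
      using that EV by (simp add: P_def D_add proj_add subset_iff)
    show "P (a *\<^sub>C u) = a *\<^sub>C P u" if "u \<in> E" for a u
      using that EV by (simp add: P_def D_scale proj_scale subset_iff)
    show sym: "cinner (P u) v = cinner u (P v)" if "u \<in> E" "v \<in> E" for u v
      using PD[OF that(2)] PD'[OF that(1)] D_sym[of u v t] that EV by (simp add: subset_iff)
    show "p \<in> E \<and> P p = q" if "p \<in> E" "q \<in> E" "\<And>w. w \<in> E \<Longrightarrow> cinner (P w) p = cinner w q" for p q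
    proof -
      let ?w = "P p - q"
      have w: "?w \<in> E" using PE that(2) sE by (intro complex_vector.subspace_diff)
      have wV: "?w \<in> V" and pV: "p \<in> V" using w that(1) EV by auto
      have "cinner ?w (P p) = cinner ?w (D t p)" by (rule PD'[OF w])
      also have "\<dots> = cinner (D t ?w) p" by (rule D_sym[OF wV pV, symmetric])
      also have "\<dots> = cinner (P ?w) p" by (rule PD[OF that(1), symmetric])
      also have "\<dots> = cinner ?w q" by (rule that(3)[OF w])
      finally have "cinner ?w (P p) = cinner ?w q" .
      then have "cinner ?w ?w = 0" by (simp add: cinner.diff_right)
      then show ?thesis using that(1) by simp
    qed
  qed (use sE PE in auto)
  have "eigenspace E P (complex_of_real m) = pair_space t l m" for m
  proof -
    have "P u = complex_of_real m *\<^sub>C u \<longleftrightarrow> (\<forall>v\<in>E. cinner (D t u - complex_of_real m *\<^sub>C u) v = 0)" if u: "u \<in> E" for u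
    proof
      assume "P u = complex_of_real m *\<^sub>C u"
      then show "\<forall>v\<in>E. cinner (D t u - complex_of_real m *\<^sub>C u) v = 0"
        using PD[of _ u] by (simp add: cinner.diff_left)
    next
      assume *: "\<forall>v\<in>E. cinner (D t u - complex_of_real m *\<^sub>C u) v = 0"
      have w: "P u - complex_of_real m *\<^sub>C u \<in> E"
        using PE u sE by (intro complex_vector.subspace_diff complex_vector.subspace_scale)
      have "cinner (P u - complex_of_real m *\<^sub>C u) (P u - complex_of_real m *\<^sub>C u) = 0"
        using bspec[OF * w] PD[OF w, of u] by (simp add: cinner.diff_left)
      then show "P u = complex_of_real m *\<^sub>C u" by simp
    qed
    then show ?thesis by (auto simp: eigenspace_def[of E P] pair_space_def E_def[symmetric])
  qed
  note eq = this
  show ?thesis unfolding E_def[symmetric] using cs PD eq by (intro exI[of _ P] conjI allI ballI)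
qed

lemma pair_space_subset: "pair_space t l m \<subseteq> eig t l"
  by (auto simp: pair_space_def)

lemma eig_subset: "eig t l \<subseteq> V"
  by (auto simp: eigenspace_def)

lemma pair_space_subspace: "complex_vector.subspace (pair_space t l m)"
proof -
  obtain P where P: "compact_selfadjoint (eig t l) (eig t l) P"
    "\<forall>u. \<forall>v\<in>eig t l. cinner (P u) v = cinner (D t u) v"
    "\<forall>m. eigenspace (eig t l) P (complex_of_real m) = pair_space t l m"
    using compression[of t l] by (elim exE conjE)
  show ?thesis using compact_selfadjoint.eig_subspace[OF P(1), of m] P(3) by simp
qed

lemma eig_fin_dim: "fin_dim (eig t l)"
  by (rule compact_selfadjoint.eig_fin_dim[OF csa])

lemma pair_space_fin_dim: "fin_dim (pair_space t l m)"
  by (rule fin_dim_subset(1)[OF eig_fin_dim pair_space_subspace pair_space_subset])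

lemma pair_space_orth:
  assumes "u \<in> pair_space t l m" "v \<in> pair_space t l' m'" "(l, m) \<noteq> (l', m')"
  shows "cinner u v = 0"
proof (cases "l = l'")
  case True
  obtain P where P: "compact_selfadjoint (eig t l) (eig t l) P"
    "\<forall>u. \<forall>v\<in>eig t l. cinner (P u) v = cinner (D t u) v"
    "\<forall>m. eigenspace (eig t l) P (complex_of_real m) = pair_space t l m"
    using compression[of t l] by (elim exE conjE)
  show ?thesis
    by (rule compact_selfadjoint.eig_orth[OF P(1), of m m']) (use assms True P(3) in auto)
next
  case False
  show ?thesis
    by (rule compact_selfadjoint.eig_orth[OF csa False]) (use assms pair_space_subset in auto)
qed

lemma span_pair_space: "complex_vector.span (\<Union>m. pair_space t l m) = eig t l"
proof -
  obtain P where P: "compact_selfadjoint (eig t l) (eig t l) P"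
    "\<forall>u. \<forall>v\<in>eig t l. cinner (P u) v = cinner (D t u) v"
    "\<forall>m. eigenspace (eig t l) P (complex_of_real m) = pair_space t l m"
    using compression[of t l] by (elim exE conjE)
  show ?thesis
    using compact_selfadjoint.spec_UNIV[OF P(1) eig_fin_dim] P(3)
    by (simp add: compact_selfadjoint.spec_def[OF P(1)])
qed

lemma spec_span_pair_space:
  "complex_vector.span (\<Union>p\<in>L \<times> UNIV. pair_space t (fst p) (snd p)) = spec t L"
proof -
  have sp: "spec t L = complex_vector.span (\<Union>l\<in>L. eig t l)"
    by (rule compact_selfadjoint.spec_def[OF csa])
  show ?thesis
    unfolding sp
  proof (rule complex_vector.span_eq[THEN iffD2], intro conjI)
    have sub: "pair_space t l m \<subseteq> complex_vector.span (\<Union>l\<in>L. eig t l)" if "l \<in> L" for l m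
      using order_trans[OF pair_space_subset] complex_vector.span_superset[of "\<Union>l\<in>L. eig t l"] that by blast
    show "(\<Union>p\<in>L \<times> UNIV. pair_space t (fst p) (snd p)) \<subseteq> complex_vector.span (\<Union>l\<in>L. eig t l)"
      by (rule UN_least, rule sub) auto
    have "eig t l \<subseteq> complex_vector.span (\<Union>p\<in>L \<times> UNIV. pair_space t (fst p) (snd p))" if "l \<in> L" for l
      unfolding span_pair_space[symmetric] by (rule complex_vector.span_mono) (use that in force)
    then show "(\<Union>l\<in>L. eig t l) \<subseteq> complex_vector.span (\<Union>p\<in>L \<times> UNIV. pair_space t (fst p) (snd p))" by blast
  qed
qed

lemma spec_fin_dim: "L \<subseteq> {a..b} \<Longrightarrow> fin_dim (spec t L)"
  by (rule fin_dim_subset(1)[OF compact_selfadjoint.spec_fin_dim[OF csa]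
        compact_selfadjoint.spec_subspace[OF csa] compact_selfadjoint.spec_mono[OF csa]])

text \<open>
  The pair spaces decompose the eigenspaces orthogonally, so counting pairs over a window of
  eigenvalues is computing a dimension.
\<close>

lemma sum_mult:
  assumes "L \<subseteq> {a..b}"
  shows "finite {p \<in> L \<times> UNIV. 0 < mult t p}"
    and "sum (mult t) {p \<in> L \<times> UNIV. 0 < mult t p} = complex_vector.dim (spec t L)"
proof -
  have orth: "cinner u v = 0"
    if "p \<noteq> q" "u \<in> pair_space t (fst p) (snd p)" "v \<in> pair_space t (fst q) (snd q)" for p q u v
    using pair_space_orth[OF that(2,3)] that(1) by (simp add: prod_eq_iff)
  show "finite {p \<in> L \<times> UNIV. 0 < mult t p}"
    unfolding mult_def
    by (rule dim_orthogonal_family(1)[OF spec_fin_dim[OF assms] pair_space_subspace orth spec_span_pair_space])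
  show "sum (mult t) {p \<in> L \<times> UNIV. 0 < mult t p} = complex_vector.dim (spec t L)"
    unfolding mult_def
    by (rule dim_orthogonal_family(2)[OF spec_fin_dim[OF assms] pair_space_subspace orth spec_span_pair_space])
qed

lemma mult_pos_iff: "0 < mult t (l, m) \<longleftrightarrow> (\<exists>u\<in>pair_space t l m. norm u = 1)"
proof -
  have *: "0 < mult t (l, m) \<longleftrightarrow> (\<exists>u\<in>pair_space t l m. u \<noteq> 0)"
    unfolding mult_def using dim_pos_iff[OF pair_space_fin_dim, of t l m] by simp
  show ?thesis
    unfolding *
  proof
    assume "\<exists>u\<in>pair_space t l m. u \<noteq> 0"
    then obtain u where u: "u \<in> pair_space t l m" "u \<noteq> 0" by (elim bexE)
    show "\<exists>u\<in>pair_space t l m. norm u = 1"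
    proof (rule bexI)
      show "norm (complex_of_real (1 / norm u) *\<^sub>C u) = 1" using u(2) by (simp add: norm_scaleC norm_divide)
      show "complex_of_real (1 / norm u) *\<^sub>C u \<in> pair_space t l m"
        by (rule complex_vector.subspace_scale[OF pair_space_subspace u(1)])
    qed
  next
    assume "\<exists>u\<in>pair_space t l m. norm u = 1"
    then obtain u where u: "u \<in> pair_space t l m" "norm u = 1" by (elim bexE)
    then have "u \<noteq> 0" by auto
    then show "\<exists>u\<in>pair_space t l m. u \<noteq> 0" using u(1) by (rule rev_bexI[rotated])
  qed
qed

text \<open>
  The graph norms of \<open>A t\<close> and \<open>A t0\<close> are equivalent, with constant \<open>2\<close>, for \<open>t\<close> close to \<open>t0\<close>.
\<close>

lemma comparison:
  "\<exists>d>0. \<exists>C\<ge>0. (\<forall>u\<in>V. norm (D t0 u) \<le> C * (norm u + norm (A t0 u))) \<and>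
    (\<forall>t. \<bar>t - t0\<bar> < d \<longrightarrow> (\<forall>u\<in>V.
      norm u + norm (A t0 u) \<le> 2 * (norm u + norm (A t u)) \<and>
      norm (A t u - A t0 u) \<le> (C + 1) * \<bar>t - t0\<bar> * (norm u + norm (A t0 u)) \<and>
      norm (D t u) \<le> 2 * (C + 1) * (norm u + norm (A t u))))"
proof -
  obtain C where C: "0 \<le> C" and CV: "\<forall>u\<in>V. norm (D t0 u) \<le> C * (norm u + norm (A t0 u))"
    using D_bound[of t0] by (elim exE conjE)
  have C': "norm (D t0 u) \<le> C * (norm u + norm (A t0 u))" if "u \<in> V" for u using CV that by (rule bspec)
  obtain d1 where d1: "0 < d1" and dV: "\<forall>t. \<bar>t - t0\<bar> < d1 \<longrightarrow> (\<forall>u\<in>V.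
       norm (D t u - D t0 u) \<le> 1 * (norm u + norm (A t0 u)) \<and>
       norm (A t u - A t0 u - (t - t0) *\<^sub>R D t0 u) \<le> 1 * \<bar>t - t0\<bar> * (norm u + norm (A t0 u)))"
    using C1[OF zero_less_one, of t0] by (elim exE conjE)
  have d1': "norm (D t u - D t0 u) \<le> norm u + norm (A t0 u)"
    "norm (A t u - A t0 u - (t - t0) *\<^sub>R D t0 u) \<le> \<bar>t - t0\<bar> * (norm u + norm (A t0 u))"
    if "\<bar>t - t0\<bar> < d1" "u \<in> V" for t u
    using dV[rule_format, OF that] by simp_all
  define d where "d = min d1 (1 / (2 * (C + 1)))"
  have d: "0 < d" using d1 C by (simp add: d_def)
  have est: "norm (A t u - A t0 u) \<le> (C + 1) * \<bar>t - t0\<bar> * (norm u + norm (A t0 u))"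
    if "\<bar>t - t0\<bar> < d" "u \<in> V" for t u
  proof -
    have "norm (A t u - A t0 u) \<le> norm (A t u - A t0 u - (t - t0) *\<^sub>R D t0 u) + norm ((t - t0) *\<^sub>R D t0 u)"
      using norm_triangle_ineq[of "A t u - A t0 u - (t - t0) *\<^sub>R D t0 u" "(t - t0) *\<^sub>R D t0 u"]
      by (simp only: diff_add_cancel)
    also have "\<dots> \<le> \<bar>t - t0\<bar> * (norm u + norm (A t0 u)) + \<bar>t - t0\<bar> * (C * (norm u + norm (A t0 u)))"
      using d1'(2)[of t u] C'[of u] that by (intro add_mono) (auto simp: d_def mult_left_mono)
    also have "\<dots> = (C + 1) * \<bar>t - t0\<bar> * (norm u + norm (A t0 u))" by (simp add: algebra_simps)
    finally show ?thesis .
  qed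
  have g: "norm u + norm (A t0 u) \<le> 2 * (norm u + norm (A t u))" if "\<bar>t - t0\<bar> < d" "u \<in> V" for t u
  proof -
    have "\<bar>t - t0\<bar> \<le> 1 / (2 * (C + 1))" using that by (simp add: d_def)
    then have "(C + 1) * \<bar>t - t0\<bar> \<le> 1 / 2" using C by (simp add: field_simps)
    then have "(C + 1) * \<bar>t - t0\<bar> * (norm u + norm (A t0 u)) \<le> 1 / 2 * (norm u + norm (A t0 u))"
      by (rule mult_right_mono) simp
    then have "norm (A t u - A t0 u) \<le> 1 / 2 * (norm u + norm (A t0 u))" using est[OF that] by linarith
    moreover have "norm (A t0 u) \<le> norm (A t u) + norm (A t u - A t0 u)"
      by (metis norm_minus_commute norm_triangle_sub)
    ultimately show ?thesis by simp
  qed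
  have "norm (D t u) \<le> 2 * (C + 1) * (norm u + norm (A t u))" if "\<bar>t - t0\<bar> < d" "u \<in> V" for t u
  proof -
    have "norm (D t u) \<le> norm (D t0 u) + norm (D t u - D t0 u)" by (rule norm_triangle_sub)
    also have "\<dots> \<le> (C + 1) * (norm u + norm (A t0 u))"
      using C'[OF that(2)] d1'(1)[of t u] that by (simp add: d_def algebra_simps)
    also have "\<dots> \<le> (C + 1) * (2 * (norm u + norm (A t u)))" using g[OF that] C by (intro mult_left_mono) auto
    finally show ?thesis by (simp only: ac_simps)
  qed
  then show ?thesis
    using d C CV g est by (intro exI[of _ d] conjI exI[of _ C]) simp_all
qed

section \<open>First-order splitting of an eigenvalue\<close>

text \<open>
  The spans of the eigenvectors near \<open>l0\<close> at times \<open>t\<close> and \<open>t0\<close> have the same dimension: vectors of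
  either span almost satisfy the eigenvalue equation of the other operator, so by the gap inequality
  neither contains a nonzero vector orthogonal to the other span. Testing the eigenvalue equation at
  time \<open>t\<close> against the projection \<open>y\<close> of \<open>u\<close> to the \<open>l0\<close>-eigenspace shows that the eigenvalues move by
  at most \<open>O(t - t0)\<close>, and so do the eigenvectors off that eigenspace.
\<close>

lemma strip:
  assumes r0: "0 < r0" and iso: "\<forall>l. \<bar>l - l0\<bar> \<le> r0 \<longrightarrow> l \<noteq> l0 \<longrightarrow> eig t0 l = {0}"
  shows "\<exists>d>0. \<exists>K\<ge>0. (\<forall>y\<in>eig t0 l0. norm (D t0 y) \<le> K * norm y) \<and>
    (\<forall>t. \<bar>t - t0\<bar> < d \<longrightarrow>
      complex_vector.dim (spec t {l0 - r0/2..l0 + r0/2}) = complex_vector.dim (eig t0 l0) \<and>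
      (\<forall>u\<in>spec t {l0 - r0/2..l0 + r0/2}.
        norm u + norm (A t0 u) \<le> K * norm u \<and> norm (D t0 u) \<le> K * norm u \<and>
        norm (A t u - complex_of_real l0 *\<^sub>C u) \<le> K * \<bar>t - t0\<bar> * norm u \<and>
        (\<forall>y\<in>eig t0 l0. (\<forall>e\<in>eig t0 l0. cinner (u - y) e = 0) \<longrightarrow> norm (u - y) \<le> K * \<bar>t - t0\<bar> * norm u)))"
proof -
  define E where "E = eig t0 l0"
  define r where "r = r0/2"
  define G where "G t = spec t {l0 - r..l0 + r}" for t
  have r: "0 < r" "r0 = 2 * r" using r0 by (auto simp: r_def)
  have EV: "E \<subseteq> V" unfolding E_def by (rule eig_subset)
  have GV: "G t \<subseteq> V" for t unfolding G_def by (rule compact_selfadjoint.spec_subset[OF csa])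
  have sE: "complex_vector.subspace E" unfolding E_def by (rule compact_selfadjoint.eig_subspace[OF csa])
  have sG: "complex_vector.subspace (G t)" for t unfolding G_def by (rule compact_selfadjoint.spec_subspace[OF csa])
  have fE: "fin_dim E" unfolding E_def by (rule eig_fin_dim)
  have fG: "fin_dim (G t)" for t unfolding G_def by (rule spec_fin_dim[OF order_refl])
  have AE: "A t0 y = complex_of_real l0 *\<^sub>C y" if "y \<in> E" for y using that by (simp add: E_def eigenspace_def)
  obtain d1 C where d1: "0 < d1" and C: "0 \<le> C" and C0: "\<forall>u\<in>V. norm (D t0 u) \<le> C * (norm u + norm (A t0 u))"
    and Ct: "\<forall>t. \<bar>t - t0\<bar> < d1 \<longrightarrow> (\<forall>u\<in>V.
      norm u + norm (A t0 u) \<le> 2 * (norm u + norm (A t u)) \<and>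
      norm (A t u - A t0 u) \<le> (C + 1) * \<bar>t - t0\<bar> * (norm u + norm (A t0 u)) \<and>
      norm (D t u) \<le> 2 * (C + 1) * (norm u + norm (A t u)))"
    using comparison[of t0] by (elim exE conjE)
  define K0 where "K0 = 2 * (1 + \<bar>l0\<bar> + r)"
  define C1 where "C1 = (C + 1) * K0"
  define K where "K = K0 + C * K0 + 2 * C1 + 3 * C1 / r0"
  have K0: "0 < K0" using r by (simp add: K0_def)
  have C1: "0 < C1" using K0 C by (simp add: C1_def)
  have Kge: "K0 \<le> K" "C * K0 \<le> K" "2 * C1 \<le> K" "3 * C1 / r0 \<le> K" "0 \<le> K"
    using K0 C1 C r0 by (auto simp: K_def)
  define d where "d = min d1 (r / (2 * C1))"
  have d: "0 < d" using d1 r C1 by (simp add: d_def)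
  have normA: "norm (A t u) \<le> norm (A t u - complex_of_real l0 *\<^sub>C u) + \<bar>l0\<bar> * norm u" for t u
    using norm_triangle_ineq[of "A t u - complex_of_real l0 *\<^sub>C u" "complex_of_real l0 *\<^sub>C u"]
    by (simp add: norm_scaleC)
  have gE: "norm y + norm (A t0 y) \<le> K0 * norm y" if "y \<in> E" for y
  proof -
    have "norm y + norm (A t0 y) = (1 + \<bar>l0\<bar>) * norm y" by (simp add: AE[OF that] norm_scaleC algebra_simps)
    also have "\<dots> \<le> K0 * norm y" using r by (intro mult_right_mono) (auto simp: K0_def)
    finally show ?thesis .
  qed
  have DV: "norm (D t0 u) \<le> K * norm u" if "u \<in> V" "norm u + norm (A t0 u) \<le> K0 * norm u" for u
  proof -
    have "norm (D t0 u) \<le> C * (norm u + norm (A t0 u))" using C0 that(1) by blast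
    also have "\<dots> \<le> C * (K0 * norm u)" using that(2) C by (rule mult_left_mono)
    also have "\<dots> \<le> K * norm u" using Kge(2) by (simp add: mult.assoc[symmetric] mult_right_mono)
    finally show ?thesis .
  qed
  have main: "complex_vector.dim (G t) = complex_vector.dim E \<and>
      (\<forall>u\<in>G t. norm u + norm (A t0 u) \<le> K * norm u \<and> norm (D t0 u) \<le> K * norm u \<and>
        norm (A t u - complex_of_real l0 *\<^sub>C u) \<le> K * \<bar>t - t0\<bar> * norm u \<and>
        (\<forall>y\<in>E. (\<forall>e\<in>E. cinner (u - y) e = 0) \<longrightarrow> norm (u - y) \<le> K * \<bar>t - t0\<bar> * norm u))"
    if t: "\<bar>t - t0\<bar> < d" for t
  proof -
    define h where "h = \<bar>t - t0\<bar>"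
    have h: "0 \<le> h" "h < d1" "h < r / (2 * C1)" using t by (auto simp: h_def d_def)
    have hC: "C1 * h \<le> r / 2" using h(3) C1 by (simp add: field_simps)
    have cmp: "norm u + norm (A t0 u) \<le> 2 * (norm u + norm (A t u))"
      "norm (A t u - A t0 u) \<le> (C + 1) * h * (norm u + norm (A t0 u))" if "u \<in> V" for u
      using Ct[rule_format, OF _ that] h(2) by (simp_all add: h_def)
    have pert: "norm (A t u - A t0 u) \<le> C1 * h * norm u" if "u \<in> V" "norm u + norm (A t0 u) \<le> K0 * norm u" for u
    proof -
      have "norm (A t u - A t0 u) \<le> (C + 1) * h * (norm u + norm (A t0 u))" by (rule cmp(2)[OF that(1)])
      also have "\<dots> \<le> (C + 1) * h * (K0 * norm u)" using that(2) C h by (intro mult_left_mono) auto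
      finally show ?thesis by (simp add: C1_def mult_ac)
    qed
    have G1: "norm (A t u - complex_of_real l0 *\<^sub>C u) \<le> r * norm u" if "u \<in> G t" for u
      by (rule compact_selfadjoint.spec_bound[OF csa that[unfolded G_def]]) (use r in auto)
    have gG: "norm u + norm (A t0 u) \<le> K0 * norm u" if "u \<in> G t" for u
    proof -
      have "norm (A t u) \<le> (\<bar>l0\<bar> + r) * norm u" using normA[of t u] G1[OF that] by (simp add: algebra_simps)
      moreover have "u \<in> V" using that GV by blast
      ultimately show ?thesis using cmp(1)[of u] by (simp add: K0_def algebra_simps)
    qed
    have pG: "norm (A t u - A t0 u) \<le> C1 * h * norm u" if "u \<in> G t" for u
      by (rule pert[OF subsetD[OF GV that] gG[OF that]])
    have pE: "norm (A t u - A t0 u) \<le> C1 * h * norm u" if "u \<in> E" for u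
      by (rule pert[OF subsetD[OF EV that] gE[OF that]])
    have gap0: "r0 * norm (u - y) \<le> norm (A t0 u - complex_of_real l0 *\<^sub>C u)"
      if "u \<in> V" "y \<in> E" "\<forall>e\<in>E. cinner (u - y) e = 0" for u y
    proof -
      have yV: "y \<in> V" using that EV by auto
      have "r0 * norm (u - y) \<le> norm (A t0 (u - y) - complex_of_real l0 *\<^sub>C (u - y))"
        by (rule compact_selfadjoint.gap_isolated[OF csa iso[rule_format] compact_selfadjoint.K_diff[OF csa that(1) yV]])
          (use that(3) in \<open>auto simp: E_def\<close>)
      also have "A t0 (u - y) - complex_of_real l0 *\<^sub>C (u - y) = A t0 u - complex_of_real l0 *\<^sub>C u"
        by (simp add: compact_selfadjoint.S_diff[OF csa that(1) yV] AE[OF that(2)] scaleC.diff_right)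
      finally show ?thesis .
    qed
    have diff0: "norm (A t0 u - complex_of_real l0 *\<^sub>C u) \<le> norm (A t u - complex_of_real l0 *\<^sub>C u) + C1 * h * norm u"
      if "norm (A t u - A t0 u) \<le> C1 * h * norm u" for u
      using norm_triangle_ineq4[of "A t u - complex_of_real l0 *\<^sub>C u" "A t u - A t0 u"] that by simp
    have dimEG: "complex_vector.dim E \<le> complex_vector.dim (G t)"
    proof (rule dim_le_of_orth_trivial(2)[OF sE fG])
      fix u assume u: "u \<in> E" "\<And>e. e \<in> G t \<Longrightarrow> cinner u e = 0"
      have "r * norm u \<le> norm (A t u - complex_of_real l0 *\<^sub>C u)"
      proof (rule compact_selfadjoint.gap[OF csa])
        show "u \<in> V" using u EV by auto
        fix l e assume "\<bar>l - l0\<bar> \<le> r" "e \<in> eig t l"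
        then show "cinner u e = 0"
          using compact_selfadjoint.eig_subset_spec[OF csa, of l "{l0 - r..l0 + r}" t] u(2)
          unfolding G_def by (auto simp: abs_le_iff subset_iff)
      qed
      also have "\<dots> \<le> C1 * h * norm u" using pE[OF u(1)] AE[OF u(1)] by simp
      also have "\<dots> \<le> r / 2 * norm u" using hC by (intro mult_right_mono) auto
      finally show "u = 0" using r by simp
    qed
    have dimGE: "complex_vector.dim (G t) \<le> complex_vector.dim E"
    proof (rule dim_le_of_orth_trivial(2)[OF sG fE])
      fix u assume u: "u \<in> G t" "\<And>e. e \<in> E \<Longrightarrow> cinner u e = 0"
      have "r0 * norm (u - 0) \<le> norm (A t0 u - complex_of_real l0 *\<^sub>C u)"
        by (rule gap0) (use u GV complex_vector.subspace_0[OF sE] in auto)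
      also have "\<dots> \<le> r * norm u + C1 * h * norm u" using diff0[OF pG[OF u(1)]] G1[OF u(1)] by simp
      also have "\<dots> \<le> r * norm u + r / 2 * norm u" using hC by (intro add_left_mono mult_right_mono) auto
      finally have "r / 2 * norm u \<le> 0" using r(2) by (simp add: algebra_simps)
      then show "u = 0" using r by (simp add: mult_le_0_iff)
    qed
    have eigdist: "\<bar>l - l0\<bar> \<le> 2 * C1 * h" if l: "\<bar>l - l0\<bar> \<le> r" and u: "u \<in> eig t l" "u \<noteq> 0" for l u
    proof -
      have uV: "u \<in> V" using u eig_subset by blast
      have uG: "u \<in> G t" unfolding G_def
        using compact_selfadjoint.eig_subset_spec[OF csa, of l "{l0 - r..l0 + r}" t] l u by (auto simp: abs_le_iff)
      obtain y where y: "y \<in> E" "\<And>e. e \<in> E \<Longrightarrow> cinner (u - y) e = 0"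
        using orth_decomp[OF fE, of u] by blast
      have "r0 * norm (u - y) \<le> r * norm u + r / 2 * norm u"
        using gap0[OF uV y(1) ballI[OF y(2)]] diff0[OF pG[OF uG]] G1[OF uG] mult_right_mono[OF hC, of "norm u"] by simp
      then have x: "norm (u - y) \<le> 3/4 * norm u" using r by (simp add: field_simps)
      have uy: "cinner u y = cinner y y" using y(2)[OF y(1)] by (simp add: cinner.diff_left)
      have "cinner (u - y) y = 0" by (rule y(2)[OF y(1)])
      from norm_add_cinner_eq_0[OF this] have pyth: "(norm u)\<^sup>2 = (norm (u - y))\<^sup>2 + (norm y)\<^sup>2" by simp
      have "(norm (u - y))\<^sup>2 \<le> (3/4 * norm u)\<^sup>2" using x by (rule power_mono) simp
      then have "(norm (u - y))\<^sup>2 \<le> 9/16 * (norm u)\<^sup>2" by (simp add: power_mult_distrib power_divide)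
      then have "1/4 * (norm u)\<^sup>2 \<le> (norm y)\<^sup>2" using pyth zero_le_power2[of "norm y"] by linarith
      then have "(1/2 * norm u)\<^sup>2 \<le> (norm y)\<^sup>2" by (simp add: power_mult_distrib power_divide)
      then have ny: "1/2 * norm u \<le> norm y" by (rule power2_le_imp_le) simp
      have "cinner (A t u - A t0 u) y = complex_of_real (l - l0) * cinner y y"
      proof -
        have "cinner (A t0 u) y = cinner u (A t0 y)"
          by (rule compact_selfadjoint.symmetric[OF csa uV]) (use y(1) EV in auto)
        then show ?thesis using u(1) AE[OF y(1)] uy
          by (simp add: eigenspace_def cinner_simps algebra_simps)
      qed
      then have "\<bar>l - l0\<bar> * (norm y * norm y) = cmod (cinner (A t u - A t0 u) y)"
        by (simp add: cinner_self norm_mult power2_eq_square del: of_real_diff)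
      also have "\<dots> \<le> C1 * h * norm u * norm y"
        using cmod_cinner_le[of "A t u - A t0 u" y] mult_right_mono[OF pG[OF uG], of "norm y"] by simp
      also have "\<dots> \<le> C1 * h * (2 * norm y) * norm y"
        using ny C1 h by (intro mult_right_mono mult_left_mono) auto
      finally have "\<bar>l - l0\<bar> * (norm y * norm y) \<le> 2 * C1 * h * (norm y * norm y)" by (simp add: mult_ac)
      moreover have "0 < norm y * norm y" using ny u(2) by (auto simp: zero_less_mult_iff)
      ultimately show ?thesis by (simp add: mult_le_cancel_right)
    qed
    have G2: "norm (A t u - complex_of_real l0 *\<^sub>C u) \<le> 2 * C1 * h * norm u" if "u \<in> G t" for u
    proof -
      define L where "L = {l. \<bar>l - l0\<bar> \<le> 2 * C1 * h}"
      have "eig t l \<subseteq> spec t L" if l: "l \<in> {l0 - r..l0 + r}" for l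
      proof
        fix u assume u: "u \<in> eig t l"
        show "u \<in> spec t L"
        proof (cases "u = 0")
          case True
          then show ?thesis using complex_vector.subspace_0[OF compact_selfadjoint.spec_subspace[OF csa]] by simp
        next
          case False
          then have "l \<in> L" using eigdist[of l u] u l by (auto simp: L_def abs_le_iff)
          then show ?thesis using compact_selfadjoint.eig_subset_spec[OF csa, of l L t] u by blast
        qed
      qed
      then have "G t \<subseteq> spec t L"
        unfolding G_def compact_selfadjoint.spec_def[OF csa, of t "{l0 - r..l0 + r}"]
        by (intro complex_vector.span_minimal compact_selfadjoint.spec_subspace[OF csa] UN_least)
      then have "u \<in> spec t L" using that by blast
      then show ?thesis by (rule compact_selfadjoint.spec_bound[OF csa]) (use C1 h in \<open>auto simp: L_def\<close>)
    qed
    have G3: "norm (u - y) \<le> 3 * C1 / r0 * h * norm u"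
      if "u \<in> G t" "y \<in> E" "\<forall>e\<in>E. cinner (u - y) e = 0" for u y
    proof -
      have "r0 * norm (u - y) \<le> 2 * C1 * h * norm u + C1 * h * norm u"
        using gap0[OF subsetD[OF GV that(1)] that(2,3)] diff0[OF pG[OF that(1)]] G2[OF that(1)] by linarith
      then show ?thesis using r0 by (simp add: field_simps)
    qed
    show ?thesis
    proof (intro conjI ballI impI)
      show "complex_vector.dim (G t) = complex_vector.dim E" using dimEG dimGE by simp
      fix u assume u: "u \<in> G t"
      have uV: "u \<in> V" using u GV by auto
      show "norm u + norm (A t0 u) \<le> K * norm u"
        using gG[OF u] mult_right_mono[OF Kge(1), of "norm u"] by simp
      show "norm (D t0 u) \<le> K * norm u" by (rule DV[OF uV gG[OF u]])
      have "2 * C1 * h * norm u \<le> K * h * norm u" using Kge(3) h by (intro mult_right_mono) auto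
      then show "norm (A t u - complex_of_real l0 *\<^sub>C u) \<le> K * \<bar>t - t0\<bar> * norm u"
        using G2[OF u] by (simp add: h_def)
      fix y assume y: "y \<in> E" "\<forall>e\<in>E. cinner (u - y) e = 0"
      have "3 * C1 / r0 * h * norm u \<le> K * h * norm u" using Kge(4) h by (intro mult_right_mono) auto
      then show "norm (u - y) \<le> K * \<bar>t - t0\<bar> * norm u"
        using G3[OF u y] by (simp add: h_def)
    qed
  qed
  have DE: "\<forall>y\<in>E. norm (D t0 y) \<le> K * norm y" by (intro ballI DV gE subsetD[OF EV])
  show ?thesis
    unfolding E_def[symmetric] r_def[symmetric] G_def[symmetric]
    by (rule exI[of _ d], rule conjI[OF d], rule exI[of _ K], rule conjI[OF Kge(5)], rule conjI[OF DE],
        intro allI impI, rule main)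
qed

lemma finite_derivatives: "finite {m. 0 < mult t (l, m)}"
  and sum_derivatives: "(\<Sum>m | 0 < mult t (l, m). mult t (l, m)) = complex_vector.dim (eig t l)"
proof -
  have L: "{l} \<subseteq> {l..l}" by simp
  let ?Q = "{p \<in> {l} \<times> UNIV. 0 < mult t p}"
  have Q: "?Q = Pair l ` {m. 0 < mult t (l, m)}" by auto
  show fin: "finite {m. 0 < mult t (l, m)}"
    using sum_mult(1)[OF L, of t] unfolding Q by (rule finite_imageD) (simp add: inj_on_def)
  have "sum (mult t) ?Q = (\<Sum>m | 0 < mult t (l, m). mult t (l, m))"
    unfolding Q by (subst sum.reindex) (simp_all add: inj_on_def o_def)
  moreover have "spec t {l} = eig t l"
    using compact_selfadjoint.eig_subspace[OF csa, of t l]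
    by (simp add: compact_selfadjoint.spec_def[OF csa] complex_vector.span_eq_iff)
  ultimately show "(\<Sum>m | 0 < mult t (l, m). mult t (l, m)) = complex_vector.dim (eig t l)"
    using sum_mult(2)[OF L, of t] by simp
qed

lemma pair_space_trivial: "\<not> 0 < mult t (l, m) \<Longrightarrow> pair_space t l m = {0}"
  using dim_pos_iff[OF pair_space_fin_dim, of t l m]
    complex_vector.subspace_0[OF pair_space_subspace, of t l m]
  by (auto simp: mult_def)

text \<open>
  At time \<open>t\<close>, the pairs with eigenvalue near \<open>l0\<close> form groups along the lines with the slopes \<open>\<mu>\<close> that
  occur at \<open>(t0, l0)\<close>, and each group has the multiplicity of its slope. The tolerance \<open>\<beta>\<close> for the
  eigenvalues is relative to \<open>\<bar>t - t0\<bar>\<close>, the tolerance \<open>\<epsilon>\<close> for the slopes is absolute.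
\<close>

definition splits :: "real \<Rightarrow> real \<Rightarrow> real \<Rightarrow> real \<Rightarrow> real \<Rightarrow> real \<Rightarrow> bool" where
  "splits t0 l0 r \<beta> \<epsilon> t \<longleftrightarrow>
    (\<forall>l m. \<bar>l - l0\<bar> \<le> r \<longrightarrow> 0 < mult t (l, m) \<longrightarrow>
      (\<exists>\<mu>. 0 < mult t0 (l0, \<mu>) \<and> \<bar>l - l0 - (t - t0) * \<mu>\<bar> \<le> \<beta> * \<bar>t - t0\<bar> \<and> \<bar>m - \<mu>\<bar> \<le> \<epsilon>)) \<and>
    (\<forall>\<mu>. 0 < mult t0 (l0, \<mu>) \<longrightarrow>
      finite {p \<in> {l. \<bar>l - l0\<bar> \<le> r \<and> \<bar>l - l0 - (t - t0) * \<mu>\<bar> \<le> \<beta> * \<bar>t - t0\<bar>} \<times> UNIV. 0 < mult t p} \<and>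
      sum (mult t) {p \<in> {l. \<bar>l - l0\<bar> \<le> r \<and> \<bar>l - l0 - (t - t0) * \<mu>\<bar> \<le> \<beta> * \<bar>t - t0\<bar>} \<times> UNIV. 0 < mult t p}
        = mult t0 (l0, \<mu>))"

text \<open>
  Let \<open>h = t - t0\<close>, let \<open>u\<close> lie in the span at time \<open>t\<close> of the eigenvectors near \<open>l0\<close>, let \<open>y\<close> be its
  projection to the \<open>l0\<close>-eigenspace \<open>E\<close> of \<open>A t0\<close>, and \<open>P\<close> the compression of \<open>D t0\<close> to \<open>E\<close>. Then \<open>P y\<close>
  is up to a small error the projection of \<open>(A t - l0) u / h\<close> (the fact \<open>refined\<close>). If \<open>u\<close> is an
  eigenvector for \<open>l\<close>, then \<open>y\<close> is an approximate eigenvector of \<open>P\<close> for \<open>(l - l0) / h\<close>, which therefore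
  is close to an eigenvalue of \<open>P\<close>. If \<open>u\<close> is in the span \<open>spec t (L \<mu>)\<close> of the eigenvectors whose
  quotient is close to \<open>\<mu>\<close>, then \<open>u\<close> is close to the pair space of \<open>\<mu>\<close> (the fact \<open>close\<close>). Hence the
  dimension of \<open>spec t (L \<mu>)\<close> is at most the multiplicity of \<open>\<mu>\<close>; as both sides have the same sum over
  \<open>\<mu>\<close> by lemma \<open>strip\<close>, they agree. Slopes at time \<open>t\<close> are values \<open>\<langle>D t u, u\<rangle>\<close> and by closeness
  approximate \<open>\<mu>\<close>.
\<close>

lemma splitting:
  "\<exists>r>0. (\<forall>l. \<bar>l - l0\<bar> \<le> r \<longrightarrow> l \<noteq> l0 \<longrightarrow> eig t0 l = {0}) \<and>
    (\<forall>\<epsilon>>0. \<exists>\<beta>>0. \<beta> \<le> \<epsilon> \<and> (\<exists>d>0. \<forall>t. t \<noteq> t0 \<longrightarrow> \<bar>t - t0\<bar> < d \<longrightarrow> splits t0 l0 r \<beta> \<epsilon> t))"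
proof -
  define E where "E = eig t0 l0"
  define M where "M = {m. 0 < mult t0 (l0, m)}"
  define W where "W m = pair_space t0 l0 m" for m
  obtain r0 where r0: "0 < r0" and iso: "\<forall>l. \<bar>l - l0\<bar> \<le> r0 \<longrightarrow> l \<noteq> l0 \<longrightarrow> eig t0 l = {0}"
    using compact_selfadjoint.eig_isolated[OF csa, of l0 t0] by (elim exE conjE)
  define r where "r = r0/2"
  define G where "G t = spec t {l0 - r..l0 + r}" for t
  have r: "0 < r" "r \<le> r0" using r0 by (auto simp: r_def)
  have EV: "E \<subseteq> V" unfolding E_def by (rule eig_subset)
  have GV: "G t \<subseteq> V" for t unfolding G_def by (rule compact_selfadjoint.spec_subset[OF csa])
  have sE: "complex_vector.subspace E" unfolding E_def by (rule compact_selfadjoint.eig_subspace[OF csa])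
  have fE: "fin_dim E" unfolding E_def by (rule eig_fin_dim)
  have fW: "fin_dim (W m)" for m unfolding W_def by (rule pair_space_fin_dim)
  have WE: "W m \<subseteq> E" for m unfolding W_def E_def by (rule pair_space_subset)
  have AE: "A t0 y = complex_of_real l0 *\<^sub>C y" if "y \<in> E" for y using that by (simp add: E_def eigenspace_def)
  obtain P where cP: "compact_selfadjoint E E P"
    and PD: "\<forall>u. \<forall>v\<in>E. cinner (P u) v = cinner (D t0 u) v"
    and PW: "\<forall>m. eigenspace E P (complex_of_real m) = W m"
    using compression[of t0 l0] unfolding E_def W_def by (elim exE conjE)
  have finM: "finite M" unfolding M_def by (rule finite_derivatives)
  have W0: "W m = {0}" if "m \<notin> M" for m using that unfolding M_def W_def by (intro pair_space_trivial) simp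
  obtain \<rho> where \<rho>: "0 < \<rho>" and sep: "\<forall>x\<in>M. \<forall>y\<in>M. x \<noteq> y \<longrightarrow> 2 * \<rho> \<le> \<bar>x - y\<bar>"
    using finite_separated[OF finM] by (elim exE conjE)
  define Mb where "Mb = (\<Sum>m\<in>M. \<bar>m\<bar>)"
  have Mb: "0 \<le> Mb" "\<And>m. m \<in> M \<Longrightarrow> \<bar>m\<bar> \<le> Mb"
    unfolding Mb_def using finM by (auto intro: sum_nonneg member_le_sum)
  obtain d1 K where d1: "0 < d1" and K: "0 \<le> K" and DE: "\<forall>y\<in>E. norm (D t0 y) \<le> K * norm y"
    and strip: "\<forall>t. \<bar>t - t0\<bar> < d1 \<longrightarrow> complex_vector.dim (G t) = complex_vector.dim E \<and>
      (\<forall>u\<in>G t. norm u + norm (A t0 u) \<le> K * norm u \<and> norm (D t0 u) \<le> K * norm u \<and>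
        norm (A t u - complex_of_real l0 *\<^sub>C u) \<le> K * \<bar>t - t0\<bar> * norm u \<and>
        (\<forall>y\<in>E. (\<forall>e\<in>E. cinner (u - y) e = 0) \<longrightarrow> norm (u - y) \<le> K * \<bar>t - t0\<bar> * norm u))"
    using strip[OF r0 iso] unfolding E_def[symmetric] r_def[symmetric] G_def[symmetric]
    by (elim exE conjE)
  define \<Gamma> where "\<Gamma> = 1 + (2 * K + Mb) * (3 / \<rho>)"
  have \<Gamma>: "1 \<le> \<Gamma>" using K Mb \<rho> by (simp add: \<Gamma>_def)
  have main: "\<exists>\<beta>>0. \<beta> \<le> \<epsilon> \<and> (\<exists>d>0. \<forall>t. t \<noteq> t0 \<longrightarrow> \<bar>t - t0\<bar> < d \<longrightarrow> splits t0 l0 r \<beta> \<epsilon> t)" if \<epsilon>: "0 < \<epsilon>" for \<epsilon>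
  proof -
    \<comment> \<open>\<open>\<Gamma>\<close> is the factor by which the half-width \<open>\<beta>\<close> of the windows enters the error of the slopes; \<open>\<beta> \<le> \<rho> / 6\<close> makes \<open>\<sigma> \<le> 1/2\<close> and the windows disjoint.\<close>
    define \<beta> where "\<beta> = min (\<rho> / 6) (\<epsilon> / \<Gamma>)"
    define \<kappa> where "\<kappa> = \<beta> / 4"
    define \<eta> where "\<eta> = \<kappa> / (2 * (K + 1))"
    define \<sigma> where "\<sigma> = 3 * \<beta> / \<rho>"
    have \<beta>: "0 < \<beta>" "\<beta> \<le> \<rho> / 6" "\<beta> * \<Gamma> \<le> \<epsilon>"
      using \<rho> \<epsilon> \<Gamma> by (auto simp: \<beta>_def min_def field_simps)
    have "\<beta> * 1 \<le> \<beta> * \<Gamma>" using \<beta>(1) \<Gamma> by (intro mult_left_mono) auto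
    then have \<beta>\<epsilon>: "\<beta> \<le> \<epsilon>" using \<beta>(3) by simp
    have \<kappa>: "0 < \<kappa>" "\<kappa> \<le> \<beta>" using \<beta> by (auto simp: \<kappa>_def)
    have \<eta>: "0 < \<eta>" using \<kappa> K by (simp add: \<eta>_def)
    have \<eta>K: "\<eta> * K \<le> \<kappa> / 2"
    proof -
      have "\<eta> * K \<le> \<eta> * (K + 1)" using \<eta> by simp
      also have "\<dots> = \<kappa> / 2" using K by (simp add: \<eta>_def field_simps add_nonneg_eq_0_iff)
      finally show ?thesis .
    qed
    have \<sigma>: "0 < \<sigma>" "\<sigma> \<le> 1/2" using \<beta> \<rho> by (auto simp: \<sigma>_def field_simps)
    obtain d2 where d2: "0 < d2" and C1': "\<forall>t. \<bar>t - t0\<bar> < d2 \<longrightarrow> (\<forall>u\<in>V.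
       norm (D t u - D t0 u) \<le> \<eta> * (norm u + norm (A t0 u)) \<and>
       norm (A t u - A t0 u - (t - t0) *\<^sub>R D t0 u) \<le> \<eta> * \<bar>t - t0\<bar> * (norm u + norm (A t0 u)))"
      using C1[OF \<eta>, of t0] by (elim exE conjE)
    define d where "d = min (min d1 d2) (min (1 / (2 * (K + 1))) (min (\<beta> / (\<rho> * (K + 1))) (\<kappa> / (2 * (K * K + 1)))))"
    have KK: "0 < K * K + 1" using K by (simp add: add_nonneg_pos)
    have d: "0 < d" using d1 d2 K \<beta> \<rho> \<kappa> KK by (simp add: d_def)
    have step: "splits t0 l0 r \<beta> \<epsilon> t"
      if t: "t \<noteq> t0" "\<bar>t - t0\<bar> < d" for t
    proof -
      define h where "h = t - t0"
      have h0: "h \<noteq> 0" "0 < \<bar>h\<bar>" using t by (auto simp: h_def)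
      have td: "\<bar>t - t0\<bar> < d1" "\<bar>t - t0\<bar> < d2" using t(2) by (auto simp: d_def)
      have small: "\<bar>h\<bar> \<le> 1 / (2 * (K + 1))" "\<bar>h\<bar> \<le> \<beta> / (\<rho> * (K + 1))" "\<bar>h\<bar> \<le> \<kappa> / (2 * (K * K + 1))"
        using t(2) by (auto simp: d_def h_def)
      have "(K + 1) * \<bar>h\<bar> \<le> 1/2" using small(1) K by (simp add: field_simps)
      then have Kh1: "K * \<bar>h\<bar> \<le> 1/2" using abs_ge_zero[of h] by (simp add: distrib_right)
      have "0 < \<rho> * (K + 1)" using \<rho> K by simp
      with small(2) have "\<bar>h\<bar> * (\<rho> * (K + 1)) \<le> \<beta>" by (simp only: pos_le_divide_eq)
      then have "(K + 1) * \<bar>h\<bar> \<le> \<beta> / \<rho>" unfolding pos_le_divide_eq[OF \<rho>] by (simp only: ac_simps)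
      then have Kh2: "K * \<bar>h\<bar> \<le> \<beta> / \<rho>" using abs_ge_zero[of h] by (simp add: distrib_right)
      have "0 < 2 * (K * K + 1)" using KK by simp
      with small(3) have "\<bar>h\<bar> * (2 * (K * K + 1)) \<le> \<kappa>" by (simp only: pos_le_divide_eq)
      then have "(K * K + 1) * \<bar>h\<bar> \<le> \<kappa> / 2" by (simp add: mult_ac)
      then have Kh3: "K * K * \<bar>h\<bar> \<le> \<kappa> / 2" using abs_ge_zero[of h] by (simp add: distrib_right)
      note st = strip[rule_format, OF td(1)]
      have dimG: "complex_vector.dim (G t) = complex_vector.dim E" using st by (rule conjunct1)
      have G: "norm u + norm (A t0 u) \<le> K * norm u" "norm (D t0 u) \<le> K * norm u" if "u \<in> G t" for u
        using bspec[OF conjunct2[OF st] that] by blast+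
      have Gy: "norm (u - y) \<le> K * \<bar>h\<bar> * norm u" if "u \<in> G t" "y \<in> E" "\<forall>e\<in>E. cinner (u - y) e = 0" for u y
        using bspec[OF conjunct2[OF st] that(1)] that(2,3) unfolding h_def by blast
      have NC: "norm (D t u - D t0 u) \<le> \<eta> * (norm u + norm (A t0 u))"
        "norm (A t u - A t0 u - h *\<^sub>R D t0 u) \<le> \<eta> * \<bar>h\<bar> * (norm u + norm (A t0 u))" if "u \<in> V" for u
        using C1'[rule_format, OF td(2) that] by (simp_all add: h_def)
      have refined: "cmod (cinner (D t0 y) v - complex_of_real (1 / h) * cinner (A t u - complex_of_real l0 *\<^sub>C u) v)
          \<le> \<kappa> * norm u * norm v"
        if u: "u \<in> G t" and y: "y \<in> E" "\<forall>e\<in>E. cinner (u - y) e = 0" and v: "v \<in> E" for u y v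
      proof -
        have uV: "u \<in> V" and yV: "y \<in> V" and vV: "v \<in> V" using u y v GV EV by auto
        define \<tau> where "\<tau> = A t u - A t0 u - h *\<^sub>R D t0 u"
        have "cinner (A t0 u) v = complex_of_real l0 * cinner u v"
          using compact_selfadjoint.symmetric[OF csa uV vV, of t0] AE[OF v] by (simp add: cinner_scaleC_right)
        then have "cinner (A t u - complex_of_real l0 *\<^sub>C u) v = cinner (A t u - A t0 u) v"
          by (simp add: cinner.diff_left cinner_scaleC_left)
        also have "A t u - A t0 u = h *\<^sub>R D t0 u + \<tau>" by (simp add: \<tau>_def)
        finally have "complex_of_real (1 / h) * cinner (A t u - complex_of_real l0 *\<^sub>C u) v
            = cinner (D t0 u) v + complex_of_real (1 / h) * cinner \<tau> v"
          using h0 by (simp add: cinner_add_left cinner.scaleR_left scaleR_conv_of_real distrib_left)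
        moreover have "cinner (D t0 u) v = cinner (D t0 y) v + cinner (u - y) (D t0 v)"
          using D_sym[OF uV vV, of t0] D_sym[OF yV vV, of t0] by (simp add: cinner.diff_left)
        ultimately have "cinner (D t0 y) v - complex_of_real (1 / h) * cinner (A t u - complex_of_real l0 *\<^sub>C u) v
            = - cinner (u - y) (D t0 v) - complex_of_real (1 / h) * cinner \<tau> v" by simp
        then have "cmod (cinner (D t0 y) v - complex_of_real (1 / h) * cinner (A t u - complex_of_real l0 *\<^sub>C u) v)
            \<le> cmod (cinner (u - y) (D t0 v)) + cmod (complex_of_real (1 / h) * cinner \<tau> v)"
          by (metis norm_minus_cancel norm_triangle_ineq4)
        also have "cmod (cinner (u - y) (D t0 v)) \<le> \<kappa> / 2 * norm u * norm v"
        proof -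
          have "cmod (cinner (u - y) (D t0 v)) \<le> norm (u - y) * norm (D t0 v)" by (rule cmod_cinner_le)
          also have "\<dots> \<le> (K * \<bar>h\<bar> * norm u) * (K * norm v)"
            using Gy[OF u y] DE v K by (intro mult_mono) auto
          also have "\<dots> = K * K * \<bar>h\<bar> * (norm u * norm v)" by (simp add: mult_ac)
          also have "\<dots> \<le> \<kappa> / 2 * (norm u * norm v)" using Kh3 by (rule mult_right_mono) simp
          finally show ?thesis by (simp add: mult_ac)
        qed
        also have "cmod (complex_of_real (1 / h) * cinner \<tau> v) \<le> \<kappa> / 2 * norm u * norm v"
        proof -
          have "norm \<tau> \<le> \<eta> * \<bar>h\<bar> * (norm u + norm (A t0 u))" unfolding \<tau>_def by (rule NC(2)[OF uV])
          also have "\<dots> \<le> \<eta> * \<bar>h\<bar> * (K * norm u)" using G(1)[OF u] \<eta> by (intro mult_left_mono) auto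
          also have "\<dots> = \<bar>h\<bar> * (\<eta> * K * norm u)" by (simp add: mult_ac)
          also have "\<dots> \<le> \<bar>h\<bar> * (\<kappa> / 2 * norm u)" using \<eta>K by (intro mult_left_mono mult_right_mono) auto
          finally have "norm \<tau> * norm v \<le> \<bar>h\<bar> * (\<kappa> / 2 * norm u) * norm v" by (rule mult_right_mono) simp
          then have "cmod (cinner \<tau> v) \<le> \<bar>h\<bar> * (\<kappa> / 2 * norm u * norm v)"
            using cmod_cinner_le[of \<tau> v] by (simp add: mult_ac)
          then have "cmod (cinner \<tau> v) / \<bar>h\<bar> \<le> \<kappa> / 2 * norm u * norm v"
            using h0 by (simp add: pos_divide_le_eq mult_ac)
          then show ?thesis by (simp add: norm_mult norm_divide)
        qed
        finally show ?thesis by simp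
      qed
      have approx: "norm (P y - complex_of_real c *\<^sub>C y) \<le> (\<kappa> + \<theta>) * norm u"
        if \<theta>: "0 \<le> \<theta>" and u: "u \<in> G t" and y: "y \<in> E" "\<forall>e\<in>E. cinner (u - y) e = 0"
          and c: "\<And>v. v \<in> E \<Longrightarrow> cmod (complex_of_real (1 / h) * cinner (A t u - complex_of_real l0 *\<^sub>C u) v
              - complex_of_real c * cinner u v) \<le> \<theta> * norm u * norm v" for u y c \<theta>
      proof -
        define v where "v = P y - complex_of_real c *\<^sub>C y"
        have v: "v \<in> E" unfolding v_def
          by (intro complex_vector.subspace_diff[OF sE] complex_vector.subspace_scale[OF sE] y(1)
              compact_selfadjoint.S_in[OF cP])
        have "cinner v v = cinner (D t0 y) v - complex_of_real c * cinner y v"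
          using PD v by (subst (1) v_def) (simp add: cinner.diff_left cinner_scaleC_left)
        also have "cinner y v = cinner u v" using y(2) v by (simp add: cinner.diff_left)
        finally have "cmod (cinner v v) \<le> \<kappa> * norm u * norm v + \<theta> * norm u * norm v"
          using norm_triangle_ineq[of "cinner (D t0 y) v - complex_of_real (1 / h) * cinner (A t u - complex_of_real l0 *\<^sub>C u) v"
              "complex_of_real (1 / h) * cinner (A t u - complex_of_real l0 *\<^sub>C u) v - complex_of_real c * cinner u v"]
            refined[OF u y v] c[OF v] by simp
        then have "norm v * norm v \<le> (\<kappa> + \<theta>) * norm u * norm v"
          by (simp add: cinner_self norm_mult power2_eq_square algebra_simps)
        then have "norm v \<le> (\<kappa> + \<theta>) * norm u"
          using \<theta> \<kappa>(1) by (cases "v = 0") (simp_all add: mult_le_cancel_right)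
        then show ?thesis unfolding v_def .
      qed
      have window: "\<exists>\<mu>\<in>M. \<bar>l - l0 - h * \<mu>\<bar> \<le> \<beta> * \<bar>h\<bar>"
        if l: "\<bar>l - l0\<bar> \<le> r" and u: "u \<in> eig t l" "u \<noteq> 0" for l u
      proof (rule ccontr)
        assume neg: "\<not> ?thesis"
        define \<nu> where "\<nu> = (l - l0) / h"
        have h\<nu>: "h * \<nu> = l - l0" using h0 by (simp add: \<nu>_def)
        have far: "\<beta> < \<bar>\<nu> - \<mu>\<bar>" if "\<mu> \<in> M" for \<mu>
        proof -
          have "\<beta> * \<bar>h\<bar> < \<bar>l - l0 - h * \<mu>\<bar>" using neg that by force
          also have "l - l0 - h * \<mu> = h * (\<nu> - \<mu>)" using h\<nu> by (simp add: right_diff_distrib)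
          finally have "\<beta> * \<bar>h\<bar> < \<bar>\<nu> - \<mu>\<bar> * \<bar>h\<bar>" by (simp add: abs_mult mult.commute)
          then show ?thesis using h0(2) by (simp add: mult_less_cancel_right)
        qed
        have uG: "u \<in> G t" unfolding G_def
          using compact_selfadjoint.eig_subset_spec[OF csa, of l "{l0 - r..l0 + r}" t] l u by (auto simp: abs_le_iff)
        obtain y where y: "y \<in> E" "\<forall>e\<in>E. cinner (u - y) e = 0"
          using orth_decomp[OF fE, of u] by (elim bexE)
        have "norm (P y - complex_of_real \<nu> *\<^sub>C y) \<le> (\<kappa> + 0) * norm u"
        proof (rule approx[OF order_refl uG y])
          fix v
          have "A t u - complex_of_real l0 *\<^sub>C u = complex_of_real (l - l0) *\<^sub>C u"
            using u(1) by (simp add: eigenspace_def scaleC.diff_left)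
          then show "cmod (complex_of_real (1 / h) * cinner (A t u - complex_of_real l0 *\<^sub>C u) v
              - complex_of_real \<nu> * cinner u v) \<le> 0 * norm u * norm v"
            by (simp add: cinner_scaleC_left \<nu>_def)
        qed
        moreover have "\<beta> * norm y \<le> norm (P y - complex_of_real \<nu> *\<^sub>C y)"
        proof (rule compact_selfadjoint.gap[OF cP y(1)])
          fix l' e assume l': "\<bar>l' - \<nu>\<bar> \<le> \<beta>" and e: "e \<in> eigenspace E P (complex_of_real l')"
          have "l' \<notin> M" using far[of l'] l' by (auto simp: abs_minus_commute)
          then have "e = 0" using e PW W0 by auto
          then show "cinner y e = 0" by (simp add: cinner.zero_right)
        qed
        ultimately have 1: "\<beta> * norm y \<le> \<kappa> * norm u" by simp
        have "norm (u - y) \<le> 1/2 * norm u"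
          by (rule order_trans[OF Gy[OF uG y] mult_right_mono[OF Kh1]]) simp
        then have "norm u \<le> 2 * norm y" using norm_triangle_sub[of u y] by simp
        then have "\<kappa> * norm u \<le> \<kappa> * (2 * norm y)" using \<kappa> by (intro mult_left_mono) auto
        then have "\<beta> * norm y \<le> \<beta> / 2 * norm y" using 1 by (simp add: \<kappa>_def)
        then have "norm y \<le> 0" using \<beta>(1) by (simp add: mult_le_cancel_right)
        then show False using \<open>norm u \<le> 2 * norm y\<close> u(2) by simp
      qed
      define L where "L \<mu> = {l. \<bar>l - l0\<bar> \<le> r \<and> \<bar>l - l0 - h * \<mu>\<bar> \<le> \<beta> * \<bar>h\<bar>}" for \<mu>
      have Lsub: "L \<mu> \<subseteq> {l0 - r..l0 + r}" for \<mu> by (auto simp: L_def abs_le_iff)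
      have LG: "spec t (L \<mu>) \<subseteq> G t" for \<mu>
        unfolding G_def by (rule compact_selfadjoint.spec_mono[OF csa Lsub])
      have close: "\<exists>y2\<in>W \<mu>. norm (u - y2) \<le> \<sigma> * norm u \<and> (\<forall>w\<in>W \<mu>. cinner (u - y2) w = 0)"
        if \<mu>: "\<mu> \<in> M" and u: "u \<in> spec t (L \<mu>)" for \<mu> u
      proof -
        have uG: "u \<in> G t" using u LG by blast
        obtain y where y: "y \<in> E" "\<forall>e\<in>E. cinner (u - y) e = 0"
          using orth_decomp[OF fE, of u] by (elim bexE)
        have bnd: "norm (A t u - complex_of_real (l0 + h * \<mu>) *\<^sub>C u) \<le> \<beta> * \<bar>h\<bar> * norm u"
          by (rule compact_selfadjoint.spec_bound[OF csa u]) (use \<beta> in \<open>auto simp: L_def algebra_simps\<close>)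
        have "norm (P y - complex_of_real \<mu> *\<^sub>C y) \<le> (\<kappa> + \<beta>) * norm u"
        proof (rule approx[OF less_imp_le[OF \<beta>(1)] uG y])
          fix v
          define x where "x = A t u - complex_of_real (l0 + h * \<mu>) *\<^sub>C u"
          have "A t u - complex_of_real l0 *\<^sub>C u = x + complex_of_real (h * \<mu>) *\<^sub>C u"
            by (simp add: x_def scaleC_add_left)
          then have "complex_of_real (1 / h) * cinner (A t u - complex_of_real l0 *\<^sub>C u) v
              - complex_of_real \<mu> * cinner u v = complex_of_real (1 / h) * cinner x v"
            using h0 by (simp add: cinner_add_left cinner_scaleC_left distrib_left)
          moreover have "cmod (complex_of_real (1 / h) * cinner x v) \<le> \<beta> * norm u * norm v"
          proof -
            have "cmod (cinner x v) \<le> \<beta> * \<bar>h\<bar> * norm u * norm v"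
              using cmod_cinner_le[of x v] mult_right_mono[OF bnd[folded x_def], of "norm v"] by simp
            then have "cmod (cinner x v) / \<bar>h\<bar> \<le> \<beta> * norm u * norm v"
              using h0 by (simp add: pos_divide_le_eq mult_ac)
            then show ?thesis by (simp add: norm_mult norm_divide)
          qed
          ultimately show "cmod (complex_of_real (1 / h) * cinner (A t u - complex_of_real l0 *\<^sub>C u) v
              - complex_of_real \<mu> * cinner u v) \<le> \<beta> * norm u * norm v" by simp
        qed
        also have "\<dots> \<le> 2 * \<beta> * norm u" using \<kappa> by (intro mult_right_mono) auto
        finally have Py: "norm (P y - complex_of_real \<mu> *\<^sub>C y) \<le> 2 * \<beta> * norm u" .
        obtain y2 where y2: "y2 \<in> W \<mu>" "\<forall>w\<in>W \<mu>. cinner (y - y2) w = 0"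
          using orth_decomp[OF fW, of \<mu> y] by (elim bexE)
        have y2E: "y2 \<in> E" using y2(1) WE by blast
        have "P y2 = complex_of_real \<mu> *\<^sub>C y2" using y2(1) PW[rule_format, of \<mu>] by (auto simp: eigenspace_def[of E P])
        then have eq: "P (y - y2) - complex_of_real \<mu> *\<^sub>C (y - y2) = P y - complex_of_real \<mu> *\<^sub>C y"
          by (simp add: compact_selfadjoint.S_diff[OF cP y(1) y2E] scaleC.diff_right)
        have "\<rho> * norm (y - y2) \<le> norm (P (y - y2) - complex_of_real \<mu> *\<^sub>C (y - y2))"
        proof (rule compact_selfadjoint.gap_isolated[OF cP])
          fix l' assume l': "\<bar>l' - \<mu>\<bar> \<le> \<rho>" "l' \<noteq> \<mu>"
          have "l' \<notin> M" using sep[rule_format, OF _ \<mu> l'(2)] l'(1) \<rho> by force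
          then show "eigenspace E P (complex_of_real l') = {0}" using PW W0 by simp
        next
          show "y - y2 \<in> E" by (rule complex_vector.subspace_diff[OF sE y(1) y2E])
          show "cinner (y - y2) e = 0" if "e \<in> eigenspace E P (complex_of_real \<mu>)" for e
            using that y2(2) PW by simp
        qed
        then have "\<rho> * norm (y - y2) \<le> 2 * \<beta> * norm u" using Py eq by simp
        then have a: "norm (y - y2) \<le> 2 * \<beta> / \<rho> * norm u" using \<rho> by (simp add: field_simps)
        have b: "norm (u - y) \<le> \<beta> / \<rho> * norm u"
          by (rule order_trans[OF Gy[OF uG y] mult_right_mono[OF Kh2]]) simp
        have "norm (u - y2) \<le> norm (u - y) + norm (y - y2)"
          using norm_triangle_ineq[of "u - y" "y - y2"] by simp
        also have "\<dots> \<le> \<beta> / \<rho> * norm u + 2 * \<beta> / \<rho> * norm u" by (rule add_mono[OF b a])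
        also have "\<dots> = \<sigma> * norm u" using \<rho> by (simp add: \<sigma>_def field_simps)
        finally have "norm (u - y2) \<le> \<sigma> * norm u" .
        moreover have "cinner (u - y2) w = 0" if "w \<in> W \<mu>" for w
        proof -
          have "cinner (u - y) w = 0" "cinner (y - y2) w = 0" using y(2) y2(2) that WE by auto
          moreover have "u - y2 = (u - y) + (y - y2)" by simp
          ultimately show ?thesis by (simp only: cinner_add_left add_0)
        qed
        ultimately show ?thesis using y2(1) by blast
      qed
      have dimle: "complex_vector.dim (spec t (L \<mu>)) \<le> complex_vector.dim (W \<mu>)" if \<mu>: "\<mu> \<in> M" for \<mu>
      proof (rule dim_le_of_orth_trivial(2)[OF compact_selfadjoint.spec_subspace[OF csa] fW])
        fix u assume u: "u \<in> spec t (L \<mu>)" "\<And>e. e \<in> W \<mu> \<Longrightarrow> cinner u e = 0"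
        obtain y2 where y2: "y2 \<in> W \<mu>" "norm (u - y2) \<le> \<sigma> * norm u" "\<forall>w\<in>W \<mu>. cinner (u - y2) w = 0"
          using close[OF \<mu> u(1)] by (elim bexE conjE)
        have "cinner y2 y2 = 0" using u(2)[OF y2(1)] bspec[OF y2(3) y2(1)] by (simp add: cinner.diff_left)
        then have "norm u \<le> \<sigma> * norm u" using y2(2) by simp
        also have "\<dots> \<le> 1/2 * norm u" using \<sigma>(2) by (rule mult_right_mono) simp
        finally show "u = 0" by simp
      qed
      have deriv: "\<bar>m - \<mu>\<bar> \<le> \<epsilon>" if \<mu>: "\<mu> \<in> M" and l: "l \<in> L \<mu>" and m: "0 < mult t (l, m)" for \<mu> l m
      proof -
        obtain u where u: "u \<in> pair_space t l m" "norm u = 1" using m mult_pos_iff by blast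
        have ue: "u \<in> eig t l" using u(1) pair_space_subset by blast
        have uV: "u \<in> V" using ue eig_subset by blast
        have us: "u \<in> spec t (L \<mu>)" using compact_selfadjoint.eig_subset_spec[OF csa l] ue by blast
        have uG: "u \<in> G t" using us LG by blast
        obtain y where y: "y \<in> W \<mu>" "norm (u - y) \<le> \<sigma> * norm u" "\<forall>w\<in>W \<mu>. cinner (u - y) w = 0"
          using close[OF \<mu> us] by (elim bexE conjE)
        have yE: "y \<in> E" and yV: "y \<in> V" using y(1) WE EV by auto
        have "cinner (u - y) y = 0" using y(1,3) by blast
        from norm_add_cinner_eq_0[OF this] have pyth: "1 = (norm (u - y))\<^sup>2 + (norm y)\<^sup>2" using u(2) by simp
        have "(norm (u - y))\<^sup>2 \<le> \<sigma>\<^sup>2" using y(2) u(2) by (intro power_mono) auto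
        moreover have "\<sigma>\<^sup>2 \<le> \<sigma>" using \<sigma> by (simp add: power2_eq_square mult_left_le)
        moreover have e: "1 - (norm y)\<^sup>2 = (norm (u - y))\<^sup>2" using pyth by simp
        ultimately have ny: "\<bar>1 - (norm y)\<^sup>2\<bar> \<le> \<sigma>" unfolding e by simp
        have "(norm y)\<^sup>2 \<le> 1" using pyth zero_le_power2[of "norm (u - y)"] by linarith
        then have ny1: "norm y \<le> 1" by (simp add: abs_square_le_1)
        have "cinner (D t u - complex_of_real m *\<^sub>C u) u = 0" using u(1) ue by (auto simp: pair_space_def)
        then have a: "cinner (D t u) u = complex_of_real m"
          using u(2) by (simp add: cinner.diff_left cinner_scaleC_left cinner_self)
        have "cinner (D t0 y - complex_of_real \<mu> *\<^sub>C y) y = 0"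
          using y(1) yE by (auto simp: W_def pair_space_def E_def)
        then have b: "cinner (D t0 y) y = complex_of_real (\<mu> * (norm y)\<^sup>2)"
          by (simp add: cinner.diff_left cinner_scaleC_left cinner_self)
        have c: "cinner (D t0 y) y = cinner (D t0 u) u - cinner (D t0 u) (u - y) - cinner (u - y) (D t0 y)"
          using D_sym[OF uV yV, of t0] D_sym[OF yV yV, of t0] by (simp add: cinner.diff_left cinner.diff_right)
        have rearrange: "x - (z - p - q) = x - z + (p + q)" for x z p q :: complex by simp
        have "complex_of_real (m - \<mu> * (norm y)\<^sup>2) = cinner (D t u) u - cinner (D t0 y) y"
          by (simp only: a b of_real_diff)
        also have "\<dots> = cinner (D t u - D t0 u) u + (cinner (D t0 u) (u - y) + cinner (u - y) (D t0 y))"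
          by (subst c) (simp only: rearrange cinner.diff_left[of "D t u"])
        finally have "complex_of_real (m - \<mu> * (norm y)\<^sup>2) =
            cinner (D t u - D t0 u) u + (cinner (D t0 u) (u - y) + cinner (u - y) (D t0 y))" .
        then have "cmod (complex_of_real (m - \<mu> * (norm y)\<^sup>2)) \<le> cmod (cinner (D t u - D t0 u) u)
            + (cmod (cinner (D t0 u) (u - y)) + cmod (cinner (u - y) (D t0 y)))"
          by (simp only:) (intro norm_triangle_mono norm_triangle_ineq order_refl)
        also have "cmod (cinner (D t u - D t0 u) u) \<le> \<beta>"
        proof -
          have "cmod (cinner (D t u - D t0 u) u) \<le> norm (D t u - D t0 u)" using cmod_cinner_le[of _ u] u(2) by simp
          also have "\<dots> \<le> \<eta> * (norm u + norm (A t0 u))" by (rule NC(1)[OF uV])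
          also have "\<dots> \<le> \<eta> * (K * 1)" using G(1)[OF uG] \<eta> u(2) by (intro mult_left_mono) auto
          also have "\<dots> \<le> \<beta>" using \<eta>K \<kappa> by simp
          finally show ?thesis .
        qed
        also have "cmod (cinner (D t0 u) (u - y)) \<le> K * \<sigma>"
          using order_trans[OF cmod_cinner_le[of "D t0 u" "u - y"] mult_mono[OF G(2)[OF uG] y(2)]] u(2) K by simp
        also have "cmod (cinner (u - y) (D t0 y)) \<le> \<sigma> * K"
        proof -
          have "norm (D t0 y) \<le> K * norm y" using DE yE by blast
          also have "\<dots> \<le> K * 1" using ny1 K by (rule mult_left_mono)
          finally have "norm (D t0 y) \<le> K" by simp
          then show ?thesis
            using order_trans[OF cmod_cinner_le[of "u - y" "D t0 y"] mult_mono[OF y(2)]] u(2) \<sigma> by simp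
        qed
        finally have "\<bar>m - \<mu> * (norm y)\<^sup>2\<bar> \<le> \<beta> + 2 * K * \<sigma>" by (simp add: norm_of_real del: of_real_diff of_real_mult)
        moreover have "\<bar>\<mu> * (norm y)\<^sup>2 - \<mu>\<bar> \<le> Mb * \<sigma>"
        proof -
          have "\<mu> * (norm y)\<^sup>2 - \<mu> = - (\<mu> * (1 - (norm y)\<^sup>2))" by (simp add: algebra_simps)
          then have "\<bar>\<mu> * (norm y)\<^sup>2 - \<mu>\<bar> = \<bar>\<mu>\<bar> * \<bar>1 - (norm y)\<^sup>2\<bar>" by (simp add: abs_mult)
          also have "\<dots> \<le> Mb * \<sigma>" using Mb(2)[OF \<mu>] ny Mb(1) by (intro mult_mono) auto
          finally show ?thesis .
        qed
        ultimately have "\<bar>m - \<mu>\<bar> \<le> \<beta> + 2 * K * \<sigma> + Mb * \<sigma>" by linarith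
        also have "\<dots> = \<beta> * \<Gamma>" by (simp add: \<Gamma>_def \<sigma>_def algebra_simps)
        finally show ?thesis using \<beta>(3) by simp
      qed
      define Q where "Q \<mu> = {p \<in> L \<mu> \<times> UNIV. 0 < mult t p}" for \<mu>
      define QQ where "QQ = {p \<in> {l0 - r..l0 + r} \<times> UNIV. 0 < mult t p}"
      have Q: "finite (Q \<mu>)" "sum (mult t) (Q \<mu>) = complex_vector.dim (spec t (L \<mu>))" for \<mu>
        unfolding Q_def using sum_mult[OF Lsub[of \<mu>], of t] by auto
      have win: "\<exists>\<mu>\<in>M. l \<in> L \<mu>" if l: "\<bar>l - l0\<bar> \<le> r" and m: "0 < mult t (l, m)" for l m
      proof -
        obtain u where u: "u \<in> pair_space t l m" "norm u = 1" using m mult_pos_iff by blast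
        have "u \<in> eig t l" "u \<noteq> 0" using u pair_space_subset by auto
        from window[OF l this] show ?thesis using l by (auto simp: L_def)
      qed
      have QU: "QQ = (\<Union>\<mu>\<in>M. Q \<mu>)"
      proof
        show "QQ \<subseteq> (\<Union>\<mu>\<in>M. Q \<mu>)"
        proof
          fix p assume p: "p \<in> QQ"
          then have "\<bar>fst p - l0\<bar> \<le> r" "0 < mult t (fst p, snd p)" by (auto simp: QQ_def abs_le_iff)
          from win[OF this] show "p \<in> (\<Union>\<mu>\<in>M. Q \<mu>)" using p by (auto simp: Q_def QQ_def)
        qed
        show "(\<Union>\<mu>\<in>M. Q \<mu>) \<subseteq> QQ" using Lsub by (auto simp: Q_def QQ_def)
      qed
      have Qdisj: "Q \<mu> \<inter> Q \<mu>' = {}" if "\<mu> \<in> M" "\<mu>' \<in> M" "\<mu> \<noteq> \<mu>'" for \<mu> \<mu>'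
      proof (rule ccontr)
        assume "Q \<mu> \<inter> Q \<mu>' \<noteq> {}"
        then obtain l where "l \<in> L \<mu>" "l \<in> L \<mu>'" by (auto simp: Q_def)
        then have "\<bar>(l - l0 - h * \<mu>) - (l - l0 - h * \<mu>')\<bar> \<le> 2 * \<beta> * \<bar>h\<bar>"
          by (auto simp: L_def intro: order_trans[OF abs_triangle_ineq4])
        also have "(l - l0 - h * \<mu>) - (l - l0 - h * \<mu>') = h * (\<mu>' - \<mu>)" by (simp add: algebra_simps)
        finally have "\<bar>\<mu>' - \<mu>\<bar> * \<bar>h\<bar> \<le> 2 * \<beta> * \<bar>h\<bar>" by (simp add: abs_mult mult.commute)
        then have "\<bar>\<mu>' - \<mu>\<bar> \<le> 2 * \<beta>" using h0(2) by (simp add: mult_le_cancel_right)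
        moreover have "2 * \<rho> \<le> \<bar>\<mu>' - \<mu>\<bar>" using sep that by auto
        ultimately show False using \<beta>(2) \<rho> by simp
      qed
      have "(\<Sum>\<mu>\<in>M. sum (mult t) (Q \<mu>)) = sum (mult t) QQ"
        unfolding QU by (rule sum.UNION_disjoint[symmetric]) (use finM Q Qdisj in auto)
      also have "\<dots> = complex_vector.dim (G t)" unfolding QQ_def G_def by (rule sum_mult(2)[OF order_refl])
      also have "\<dots> = (\<Sum>\<mu>\<in>M. mult t0 (l0, \<mu>))"
        unfolding dimG E_def M_def by (rule sum_derivatives[symmetric])
      finally have total: "(\<Sum>\<mu>\<in>M. sum (mult t) (Q \<mu>)) = (\<Sum>\<mu>\<in>M. mult t0 (l0, \<mu>))" .
      have le: "sum (mult t) (Q \<mu>) \<le> mult t0 (l0, \<mu>)" if "\<mu> \<in> M" for \<mu>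
        using dimle[OF that] Q(2) by (simp add: mult_def W_def)
      have eq: "sum (mult t) (Q \<mu>) = mult t0 (l0, \<mu>)" if \<mu>: "\<mu> \<in> M" for \<mu>
      proof (rule ccontr)
        assume "sum (mult t) (Q \<mu>) \<noteq> mult t0 (l0, \<mu>)"
        then have "sum (mult t) (Q \<mu>) < mult t0 (l0, \<mu>)" using le[OF \<mu>] by simp
        then have "(\<Sum>\<mu>\<in>M. sum (mult t) (Q \<mu>)) < (\<Sum>\<mu>\<in>M. mult t0 (l0, \<mu>))"
          using finM le \<mu> by (intro sum_strict_mono_ex1) auto
        then show False using total by simp
      qed
      show ?thesis
        unfolding splits_def h_def[symmetric]
      proof (intro conjI allI impI)
        fix l m assume l: "\<bar>l - l0\<bar> \<le> r" and m: "0 < mult t (l, m)"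
        obtain \<mu> where \<mu>: "\<mu> \<in> M" "l \<in> L \<mu>" using win[OF l m] by blast
        show "\<exists>\<mu>. 0 < mult t0 (l0, \<mu>) \<and> \<bar>l - l0 - h * \<mu>\<bar> \<le> \<beta> * \<bar>h\<bar> \<and> \<bar>m - \<mu>\<bar> \<le> \<epsilon>"
          using \<mu> deriv[OF \<mu> m] by (intro exI[of _ \<mu>]) (auto simp: M_def L_def)
      next
        fix \<mu> assume "0 < mult t0 (l0, \<mu>)"
        then have \<mu>: "\<mu> \<in> M" by (simp add: M_def)
        show "finite {p \<in> {l. \<bar>l - l0\<bar> \<le> r \<and> \<bar>l - l0 - h * \<mu>\<bar> \<le> \<beta> * \<bar>h\<bar>} \<times> UNIV. 0 < mult t p}"
          using Q(1)[of \<mu>] unfolding Q_def L_def .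
        show "sum (mult t) {p \<in> {l. \<bar>l - l0\<bar> \<le> r \<and> \<bar>l - l0 - h * \<mu>\<bar> \<le> \<beta> * \<bar>h\<bar>} \<times> UNIV. 0 < mult t p} = mult t0 (l0, \<mu>)"
          using eq[OF \<mu>] unfolding Q_def L_def .
      qed
    qed
    show ?thesis
      by (rule exI[of _ \<beta>], rule conjI[OF \<beta>(1)], rule conjI[OF \<beta>\<epsilon>], rule exI[of _ d], rule conjI[OF d],
          intro allI impI, rule step)
  qed
  have "\<forall>l. \<bar>l - l0\<bar> \<le> r \<longrightarrow> l \<noteq> l0 \<longrightarrow> eig t0 l = {0}" using iso r(2) by (meson order_trans)
  then show ?thesis
    using main by (intro exI[of _ r] conjI[OF r(1)] conjI) blast+
qed

section \<open>The eigenvalue functions\<close>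

text \<open>
  In a small ball around \<open>(l0, m0)\<close> only the group of the slope \<open>m0\<close> can be found: the other slopes
  keep a positive distance.
\<close>

lemma continuous_multiset_mult: "continuous_multiset UNIV mult"
  unfolding continuous_multiset_def
proof (intro ballI allI)
  fix t0 :: real and p :: "real \<times> real"
  define l0 where "l0 = fst p"
  define m0 where "m0 = snd p"
  have p: "p = (l0, m0)" by (simp add: l0_def m0_def)
  obtain r where r: "0 < r" and triv: "\<forall>l. \<bar>l - l0\<bar> \<le> r \<longrightarrow> l \<noteq> l0 \<longrightarrow> eig t0 l = {0}"
    and split: "\<forall>\<epsilon>>0. \<exists>\<beta>>0. \<beta> \<le> \<epsilon> \<and> (\<exists>d>0. \<forall>t. t \<noteq> t0 \<longrightarrow> \<bar>t - t0\<bar> < d \<longrightarrow> splits t0 l0 r \<beta> \<epsilon> t)"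
    using splitting[of l0 t0] by (elim exE conjE)
  obtain d0 where d0: "0 < d0" and avoid: "\<forall>m\<in>{m. 0 < mult t0 (l0, m)}. m \<noteq> m0 \<longrightarrow> d0 \<le> dist m0 m"
    using finite_set_avoid[OF finite_derivatives[of t0 l0], of m0] by (elim exE conjE)
  have near: "m = m0" if "0 < mult t0 (l0, m)" "\<bar>m - m0\<bar> < d0" for m
  proof (rule ccontr)
    assume "m \<noteq> m0"
    then have "d0 \<le> dist m0 m" using avoid that(1) by blast
    then show False using that(2) by (simp add: dist_real_def abs_minus_commute)
  qed
  have coords: "\<bar>fst q - l0\<bar> < e" "\<bar>snd q - m0\<bar> < e" if "q \<in> ball p e" for q e
  proof -
    have "dist (fst q) (fst p) < e" "dist (snd q) (snd p) < e"
      using that dist_fst_le[of q p] dist_snd_le[of q p] by (simp_all add: dist_commute)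
    then show "\<bar>fst q - l0\<bar> < e" "\<bar>snd q - m0\<bar> < e" by (simp_all add: dist_real_def l0_def m0_def)
  qed
  show "\<exists>e0>0. \<forall>e>0. e < e0 \<longrightarrow> (\<exists>d>0. \<forall>t\<in>UNIV. dist t t0 < d \<longrightarrow>
      finite {q \<in> ball p e. 0 < mult t q} \<and> sum (mult t) {q \<in> ball p e. 0 < mult t q} = mult t0 p)"
  proof (rule exI[of _ "min r (d0/2)"], intro conjI allI impI)
    show "0 < min r (d0/2)" using r d0 by simp
    fix e :: real assume e: "0 < e" and "e < min r (d0/2)"
    then have er: "e < r" "2 * e < d0" by auto
    obtain \<beta> d1 where \<beta>: "0 < \<beta>" "\<beta> \<le> e/2" and d1: "0 < d1"
      and S: "\<forall>t. t \<noteq> t0 \<longrightarrow> \<bar>t - t0\<bar> < d1 \<longrightarrow> splits t0 l0 r \<beta> (e/2) t"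
      using split[rule_format, OF half_gt_zero[OF e]] by (elim exE conjE)
    define c where "c = \<bar>m0\<bar> + \<beta>"
    have c: "0 < c" using \<beta> by (simp add: c_def)
    define d where "d = min d1 (e / 2 / c)"
    have d: "0 < d" using d1 e c by (simp add: d_def)
    have main: "finite {q \<in> ball p e. 0 < mult t q} \<and> sum (mult t) {q \<in> ball p e. 0 < mult t q} = mult t0 p"
      if t: "dist t t0 < d" for t
    proof (cases "t = t0")
      case True
      have "q = p" if q: "q \<in> ball p e" "0 < mult t0 q" for q
      proof -
        have q': "0 < mult t0 (fst q, snd q)" using q by simp
        obtain u where u: "u \<in> pair_space t0 (fst q) (snd q)" "norm u = 1"
          using q'[unfolded mult_pos_iff] by (elim bexE)
        have "u \<in> eig t0 (fst q)" "u \<noteq> 0" using u pair_space_subset by auto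
        then have "eig t0 (fst q) \<noteq> {0}" by blast
        then have l: "fst q = l0" using triv coords(1)[OF q(1)] er by force
        have "snd q = m0" by (rule near) (use q' l coords(2)[OF q(1)] er e in auto)
        then show ?thesis using l p by (simp add: prod_eq_iff)
      qed
      then have "{q \<in> ball p e. 0 < mult t0 q} = (if 0 < mult t0 p then {p} else {})" using e by auto
      then show ?thesis using True by auto
    next
      case False
      define h where "h = t - t0"
      have h0: "0 < \<bar>h\<bar>" using False by (simp add: h_def)
      have td: "\<bar>t - t0\<bar> < d1" using t by (simp add: d_def dist_real_def)
      have "\<bar>h\<bar> < e / 2 / c" using t by (simp add: d_def dist_real_def h_def)
      then have hc: "\<bar>h\<bar> * c < e / 2" using c by (simp add: pos_less_divide_eq)
      define L where "L = {l. \<bar>l - l0\<bar> \<le> r \<and> \<bar>l - l0 - h * m0\<bar> \<le> \<beta> * \<bar>h\<bar>}"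
      have S1: "\<exists>\<mu>. 0 < mult t0 (l0, \<mu>) \<and> \<bar>l - l0 - h * \<mu>\<bar> \<le> \<beta> * \<bar>h\<bar> \<and> \<bar>m - \<mu>\<bar> \<le> e/2"
        if "\<bar>l - l0\<bar> \<le> r" "0 < mult t (l, m)" for l m
        using S[rule_format, OF False td, unfolded splits_def, THEN conjunct1] that unfolding h_def by blast
      have inc: "q \<in> L \<times> UNIV \<and> 0 < mult t0 p" if q: "q \<in> ball p e" "0 < mult t q" for q
      proof -
        have l: "\<bar>fst q - l0\<bar> \<le> r" using coords(1)[OF q(1)] er by simp
        obtain \<mu> where \<mu>: "0 < mult t0 (l0, \<mu>)" "\<bar>fst q - l0 - h * \<mu>\<bar> \<le> \<beta> * \<bar>h\<bar>" "\<bar>snd q - \<mu>\<bar> \<le> e/2"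
          using S1[OF l, of "snd q"] q(2) by auto
        have "\<mu> = m0" by (rule near[OF \<mu>(1)]) (use \<mu>(3) coords(2)[OF q(1)] er e in linarith)
        then show ?thesis using \<mu> l p by (auto simp: L_def mem_Times_iff)
      qed
      show ?thesis
      proof (cases "0 < mult t0 p")
        case True
        have conv: "q \<in> ball p e" if q: "q \<in> L \<times> UNIV" "0 < mult t q" for q
        proof -
          have l: "\<bar>fst q - l0\<bar> \<le> r" "\<bar>fst q - l0 - h * m0\<bar> \<le> \<beta> * \<bar>h\<bar>" using q(1) by (auto simp: L_def)
          obtain \<mu> where \<mu>: "0 < mult t0 (l0, \<mu>)" "\<bar>fst q - l0 - h * \<mu>\<bar> \<le> \<beta> * \<bar>h\<bar>" "\<bar>snd q - \<mu>\<bar> \<le> e/2"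
            using S1[OF l(1), of "snd q"] q(2) by auto
          have "\<bar>(fst q - l0 - h * m0) - (fst q - l0 - h * \<mu>)\<bar> \<le> 2 * \<beta> * \<bar>h\<bar>"
            using order_trans[OF abs_triangle_ineq4 add_mono[OF l(2) \<mu>(2)]] by simp
          also have "fst q - l0 - h * m0 - (fst q - l0 - h * \<mu>) = h * (\<mu> - m0)" by (simp add: algebra_simps)
          finally have "\<bar>\<mu> - m0\<bar> * \<bar>h\<bar> \<le> 2 * \<beta> * \<bar>h\<bar>" by (simp add: abs_mult mult.commute)
          then have "\<bar>\<mu> - m0\<bar> \<le> 2 * \<beta>" using h0 by (simp add: mult_le_cancel_right)
          then have "\<mu> = m0" by (intro near[OF \<mu>(1)]) (use \<beta>(2) er e in linarith)
          then have m: "\<bar>snd q - m0\<bar> \<le> e/2" using \<mu>(3) by simp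
          have "\<bar>fst q - l0\<bar> \<le> \<bar>fst q - l0 - h * m0\<bar> + \<bar>h * m0\<bar>"
            using abs_triangle_ineq[of "fst q - l0 - h * m0" "h * m0"] by simp
          also have "\<dots> \<le> \<bar>h\<bar> * c" using l(2) by (simp add: c_def abs_mult algebra_simps)
          finally have "\<bar>fst q - l0\<bar> < e/2" using hc by simp
          moreover have "dist p q \<le> \<bar>fst q - l0\<bar> + \<bar>snd q - m0\<bar>"
            unfolding dist_prod_def p by (simp add: dist_real_def abs_minus_commute[of l0] abs_minus_commute[of m0])
              (metis sqrt_sum_squares_le_sum_abs abs_abs power2_abs power2_commute)
          ultimately show ?thesis using m by simp
        qed
        have eq: "{q \<in> ball p e. 0 < mult t q} = {q \<in> L \<times> UNIV. 0 < mult t q}" using inc conv by blast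
        show ?thesis
          unfolding eq using S[rule_format, OF False td, unfolded splits_def, THEN conjunct2] True unfolding L_def h_def p by blast
      next
        case False
        have eq: "{q \<in> ball p e. 0 < mult t q} = {}"
        proof (rule equals0I)
          fix q assume "q \<in> {q \<in> ball p e. 0 < mult t q}"
          then have "q \<in> ball p e" "0 < mult t q" by simp_all
          from inc[OF this] False show False by simp
        qed
        show ?thesis unfolding eq using False by simp
      qed
    qed
    show "\<exists>d>0. \<forall>t\<in>UNIV. dist t t0 < d \<longrightarrow>
      finite {q \<in> ball p e. 0 < mult t q} \<and> sum (mult t) {q \<in> ball p e. 0 < mult t q} = mult t0 p"
      by (rule exI[of _ d], rule conjI[OF d], intro ballI impI, rule main)
  qed
qed

text \<open>
  By continuity, the curve stays in the group of its slope at \<open>t0\<close>.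
\<close>

lemma selection_derivative:
  assumes sel: "selection mult U c" and U: "open U" "t0 \<in> U"
  shows "((\<lambda>t. fst (c t)) has_real_derivative snd (c t0)) (at t0)"
  unfolding has_field_derivative_def has_derivative_at_alt
proof (intro conjI allI impI)
  show "bounded_linear ((*) (snd (c t0)))" by (rule bounded_linear_mult_right)
  fix \<epsilon>' :: real assume \<epsilon>': "0 < \<epsilon>'"
  define l0 where "l0 = fst (c t0)"
  define m0 where "m0 = snd (c t0)"
  obtain r where r: "0 < r" and triv: "\<forall>l. \<bar>l - l0\<bar> \<le> r \<longrightarrow> l \<noteq> l0 \<longrightarrow> eig t0 l = {0}"
    and split: "\<forall>\<epsilon>>0. \<exists>\<beta>>0. \<beta> \<le> \<epsilon> \<and> (\<exists>d>0. \<forall>t. t \<noteq> t0 \<longrightarrow> \<bar>t - t0\<bar> < d \<longrightarrow> splits t0 l0 r \<beta> \<epsilon> t)"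
    using splitting[of l0 t0] by (elim exE conjE)
  obtain d0 where d0: "0 < d0" and avoid: "\<forall>m\<in>{m. 0 < mult t0 (l0, m)}. m \<noteq> m0 \<longrightarrow> d0 \<le> dist m0 m"
    using finite_set_avoid[OF finite_derivatives[of t0 l0], of m0] by (elim exE conjE)
  have near: "m = m0" if "0 < mult t0 (l0, m)" "\<bar>m - m0\<bar> < d0" for m
  proof (rule ccontr)
    assume "m \<noteq> m0"
    then have "d0 \<le> dist m0 m" using avoid that(1) by blast
    then show False using that(2) by (simp add: dist_real_def abs_minus_commute)
  qed
  define \<epsilon> where "\<epsilon> = min \<epsilon>' (d0/3)"
  have \<epsilon>: "0 < \<epsilon>" using \<epsilon>' d0 by (simp add: \<epsilon>_def)
  obtain \<beta> d1 where \<beta>: "0 < \<beta>" "\<beta> \<le> \<epsilon>" and d1: "0 < d1"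
      and S: "\<forall>t. t \<noteq> t0 \<longrightarrow> \<bar>t - t0\<bar> < d1 \<longrightarrow> splits t0 l0 r \<beta> \<epsilon> t"
    using split[rule_format, OF \<epsilon>] by (elim exE conjE)
  have "continuous_on U c" using sel by (simp add: selection_def)
  then have "isCont c t0" using U by (simp add: continuous_on_eq_continuous_at)
  then obtain d2 where d2: "0 < d2" "\<forall>t. dist t t0 < d2 \<longrightarrow> dist (c t) (c t0) < min r (d0/3)"
    unfolding continuous_at_eps_delta using r d0 by (metis min_less_iff_conj divide_pos_pos zero_less_numeral)
  obtain d3 where d3: "0 < d3" "ball t0 d3 \<subseteq> U" using U by (meson open_contains_ball)
  have "\<bar>fst (c y) - l0 - m0 * (y - t0)\<bar> \<le> \<epsilon>' * \<bar>y - t0\<bar>" if y: "\<bar>y - t0\<bar> < min d1 (min d2 d3)" for y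
  proof (cases "y = t0")
    case False
    have yU: "y \<in> U" using y d3 by (auto simp: dist_real_def abs_minus_commute)
    then have pos: "0 < mult y (fst (c y), snd (c y))" using sel by (simp add: selection_def)
    have "dist (c y) (c t0) < min r (d0/3)" using d2(2) y by (simp add: dist_real_def)
    then have l: "\<bar>fst (c y) - l0\<bar> \<le> r" and m: "\<bar>snd (c y) - m0\<bar> < d0/3"
      using dist_fst_le[of "c y" "c t0"] dist_snd_le[of "c y" "c t0"] by (auto simp: dist_real_def l0_def m0_def)
    have "\<bar>y - t0\<bar> < d1" using y by simp
    from S[rule_format, OF False this, unfolded splits_def, THEN conjunct1, rule_format, OF l pos]
    obtain \<mu> where \<mu>: "0 < mult t0 (l0, \<mu>)" "\<bar>fst (c y) - l0 - (y - t0) * \<mu>\<bar> \<le> \<beta> * \<bar>y - t0\<bar>" "\<bar>snd (c y) - \<mu>\<bar> \<le> \<epsilon>"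
      by (elim exE conjE)
    have "\<epsilon> \<le> d0/3" by (simp add: \<epsilon>_def)
    then have "\<mu> = m0" by (intro near[OF \<mu>(1)]) (use \<mu>(3) m d0 in linarith)
    then have "\<bar>fst (c y) - l0 - m0 * (y - t0)\<bar> \<le> \<beta> * \<bar>y - t0\<bar>" using \<mu>(2) by (simp add: mult.commute)
    also have "\<dots> \<le> \<epsilon>' * \<bar>y - t0\<bar>" using \<beta>(2) by (intro mult_right_mono) (auto simp: \<epsilon>_def)
    finally show ?thesis .
  qed (simp add: l0_def)
  then show "\<exists>d>0. \<forall>y. norm (y - t0) < d \<longrightarrow>
      norm (fst (c y) - fst (c t0) - snd (c t0) * (y - t0)) \<le> \<epsilon>' * norm (y - t0)"
    using d1 d2(1) d3(1) by (intro exI[of _ "min d1 (min d2 d3)"]) (simp add: l0_def m0_def)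
qed

lemma derivative_bound:
  "\<exists>d>0. \<exists>B\<ge>0. \<forall>t. \<bar>t - b\<bar> < d \<longrightarrow> (\<forall>l m. 0 < mult t (l, m) \<longrightarrow> \<bar>m\<bar> \<le> B * (1 + \<bar>l\<bar>))"
proof -
  obtain d C where d: "0 < d" and C: "0 \<le> C" and Ct: "\<forall>t. \<bar>t - b\<bar> < d \<longrightarrow> (\<forall>u\<in>V.
      norm u + norm (A b u) \<le> 2 * (norm u + norm (A t u)) \<and>
      norm (A t u - A b u) \<le> (C + 1) * \<bar>t - b\<bar> * (norm u + norm (A b u)) \<and>
      norm (D t u) \<le> 2 * (C + 1) * (norm u + norm (A t u)))"
    using comparison[of b] by (elim exE conjE)
  have "\<bar>m\<bar> \<le> 2 * (C + 1) * (1 + \<bar>l\<bar>)" if t: "\<bar>t - b\<bar> < d" and m: "0 < mult t (l, m)" for t l m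
  proof -
    obtain u where u: "u \<in> pair_space t l m" "norm u = 1" using m[unfolded mult_pos_iff] by (elim bexE)
    have ue: "u \<in> eig t l" using u(1) pair_space_subset by blast
    have uV: "u \<in> V" using ue eig_subset by blast
    have "cinner (D t u - complex_of_real m *\<^sub>C u) u = 0" using u(1) ue by (auto simp: pair_space_def)
    then have "cinner (D t u) u = complex_of_real m"
      using u(2) by (simp add: cinner.diff_left cinner_scaleC_left cinner_self)
    then have "\<bar>m\<bar> \<le> norm (D t u)" using cmod_cinner_le[of "D t u" u] u(2) by simp
    also have "\<dots> \<le> 2 * (C + 1) * (norm u + norm (A t u))" using Ct t uV by blast
    also have "norm (A t u) = \<bar>l\<bar>" using ue u(2) by (simp add: eigenspace_def norm_scaleC)
    finally show ?thesis using u(2) by simp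
  qed
  then show ?thesis using d C by (intro exI[of _ d] conjI exI[of _ "2 * (C + 1)"]) auto
qed

text \<open>
  The logarithmic derivative of \<open>1 + \<lambda>\<^sup>2\<close> is \<open>2 \<lambda> \<mu> / (1 + \<lambda>\<^sup>2)\<close>, at most \<open>4 B\<close> in absolute value if
  \<open>\<bar>\<mu>\<bar> \<le> B (1 + \<bar>\<lambda>\<bar>)\<close>. The slope bound for the eigenvalues holds since \<open>\<mu> = \<langle>D t u, u\<rangle>\<close> for a unit
  eigenvector \<open>u\<close>.
\<close>

lemma selection_growth:
  assumes sel: "selection mult {x..y} c" and xy: "x \<le> y" and B: "0 \<le> B"
    and bnd: "\<And>t l m. t \<in> {x..y} \<Longrightarrow> 0 < mult t (l, m) \<Longrightarrow> \<bar>m\<bar> \<le> B * (1 + \<bar>l\<bar>)"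
  shows "\<bar>ln (1 + (fst (c y))\<^sup>2) - ln (1 + (fst (c x))\<^sup>2)\<bar> \<le> 4 * B * (y - x)"
proof (cases "x = y")
  case False
  define f where "f t = ln (1 + (fst (c t))\<^sup>2)" for t
  define f' where "f' t = 2 * fst (c t) * snd (c t) / (1 + (fst (c t))\<^sup>2)" for t
  have pos: "0 < 1 + s\<^sup>2" for s :: real by (rule add_pos_nonneg) simp_all
  have cc: "continuous_on {x..y} c" using sel by (simp add: selection_def)
  have ne: "\<forall>t\<in>{x..y}. 1 + (fst (c t))\<^sup>2 \<noteq> 0" using pos by (metis less_irrefl)
  have cf: "continuous_on {x..y} f"
    unfolding f_def by (intro continuous_intros cc ne)
  have der: "(f has_real_derivative f' t) (at t)" if t: "x < t" "t < y" for t
  proof -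
    have "selection mult {x<..<y} c" using sel by (rule selection_subset) auto
    then have d: "((\<lambda>t. fst (c t)) has_real_derivative snd (c t)) (at t)"
      by (rule selection_derivative) (use t in auto)
    show ?thesis unfolding f_def f'_def
      by (rule derivative_eq_intros d refl pos)+ (simp add: field_simps)
  qed
  have xy': "x < y" using xy False by simp
  obtain \<xi> where \<xi>: "x < \<xi>" "\<xi> < y" "f y - f x = f' \<xi> * (y - x)"
    using mvt[OF xy' cf, of "\<lambda>t. (*) (f' t)"] der by (auto simp: has_field_derivative_def)
  define l where "l = \<bar>fst (c \<xi>)\<bar>"
  have l0: "0 \<le> l" by (simp add: l_def)
  have "0 < mult \<xi> (fst (c \<xi>), snd (c \<xi>))" using sel \<xi> by (simp add: selection_def)
  then have m: "\<bar>snd (c \<xi>)\<bar> \<le> B * (1 + l)" unfolding l_def using \<xi> by (intro bnd) auto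
  have "\<bar>f' \<xi>\<bar> = 2 * l * \<bar>snd (c \<xi>)\<bar> / (1 + l\<^sup>2)"
    using pos[of "fst (c \<xi>)"] by (simp add: f'_def l_def abs_mult)
  also have "\<dots> \<le> 2 * l * (B * (1 + l)) / (1 + l\<^sup>2)"
    using m l0 pos[of l] by (intro divide_right_mono mult_left_mono) auto
  also have "\<dots> \<le> 4 * B"
  proof -
    have "0 \<le> (l - 1)\<^sup>2" by simp
    then have "2 * l \<le> 1 + l\<^sup>2" by (simp add: power2_eq_square algebra_simps)
    moreover define q where "q = l\<^sup>2"
    ultimately have "2 * l \<le> 1 + q" "0 \<le> q" by simp_all
    then have "l + q \<le> 2 * (1 + q)" by simp
    then have "l + l\<^sup>2 \<le> 2 * (1 + l\<^sup>2)" by (simp only: q_def)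
    moreover have "l * (1 + l) = l + l\<^sup>2" by (simp add: power2_eq_square algebra_simps)
    ultimately have "l * (1 + l) \<le> 2 * (1 + l\<^sup>2)" by simp
    from mult_left_mono[OF this, of "2 * B"] B have "2 * l * (B * (1 + l)) \<le> 4 * B * (1 + l\<^sup>2)"
      by (simp add: mult_ac)
    then show ?thesis using pos[of l] by (simp add: pos_divide_le_eq)
  qed
  finally have "\<bar>f' \<xi>\<bar> * (y - x) \<le> 4 * B * (y - x)" using xy by (intro mult_right_mono) auto
  then show ?thesis using \<xi>(3) xy unfolding f_def[symmetric] by (simp add: abs_mult)
qed simp

lemma non_escaping_mult: "non_escaping UNIV mult"
  unfolding non_escaping_def
proof
  fix b :: real
  obtain d B where d: "0 < d" and B: "0 \<le> B"
    and bnd: "\<forall>t. \<bar>t - b\<bar> < d \<longrightarrow> (\<forall>l m. 0 < mult t (l, m) \<longrightarrow> \<bar>m\<bar> \<le> B * (1 + \<bar>l\<bar>))"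
    using derivative_bound[of b] by (elim exE conjE)
  have bounded: "bounded (c ` I)"
    if near: "\<And>x. x \<in> I \<Longrightarrow> \<bar>x - b\<bar> < d" and pos: "\<And>x. x \<in> I \<Longrightarrow> 0 < mult x (c x)"
      and gr: "\<And>x. x \<in> I \<Longrightarrow> ln (1 + (fst (c x))\<^sup>2) \<le> F" for I c F
  proof (unfold bounded_iff, intro exI ballI)
    fix q assume "q \<in> c ` I"
    then obtain x where x: "x \<in> I" "q = c x" by auto
    define l where "l = fst (c x)"
    have 1: "0 < 1 + l\<^sup>2" by (rule add_pos_nonneg) simp_all
    then have "1 + l\<^sup>2 = exp (ln (1 + l\<^sup>2))" by simp
    also have "\<dots> \<le> exp F" using gr[OF x(1)] by (simp add: l_def)
    finally have le: "1 + l\<^sup>2 \<le> exp F" .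
    have "0 \<le> (\<bar>l\<bar> - 1)\<^sup>2" by simp
    then have "2 * \<bar>l\<bar> \<le> 1 + l\<^sup>2" by (simp add: power2_eq_square algebra_simps)
    then have l: "\<bar>l\<bar> \<le> exp F" using le abs_ge_zero[of l] by linarith
    have "0 < mult x (fst (c x), snd (c x))" using pos[OF x(1)] by simp
    then have "\<bar>snd (c x)\<bar> \<le> B * (1 + \<bar>l\<bar>)" unfolding l_def using bnd near[OF x(1)] by blast
    also have "\<dots> \<le> B * (1 + exp F)" using l B by (intro mult_left_mono) auto
    finally have m: "\<bar>snd (c x)\<bar> \<le> B * (1 + exp F)" .
    have "norm q \<le> norm (fst q) + norm (snd q)" by (metis norm_Pair_le prod.collapse)
    then show "norm q \<le> exp F + B * (1 + exp F)" using l m x(2) by (simp add: l_def)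
  qed
  have "bounded (c ` {a..<b})" if a: "b - d < a" "a < b" and sel: "selection mult {a..<b} c" for a c
  proof (rule bounded[of _ _ "ln (1 + (fst (c a))\<^sup>2) + 4 * B * d"])
    fix x assume x: "x \<in> {a..<b}"
    show "\<bar>x - b\<bar> < d" using x a by auto
    show "0 < mult x (c x)" using x sel by (simp add: selection_def)
    have s: "selection mult {a..x} c" by (rule selection_subset[OF sel]) (use x in auto)
    have "\<bar>ln (1 + (fst (c x))\<^sup>2) - ln (1 + (fst (c a))\<^sup>2)\<bar> \<le> 4 * B * (x - a)"
    proof (rule selection_growth[OF s _ B])
      fix t l m assume t: "t \<in> {a..x}" and "0 < mult t (l, m)"
      moreover have "\<bar>t - b\<bar> < d" using t x a by auto
      ultimately show "\<bar>m\<bar> \<le> B * (1 + \<bar>l\<bar>)" using bnd by blast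
    qed (use x in simp)
    also have "\<dots> \<le> 4 * B * d" using x a B by (intro mult_left_mono) auto
    finally show "ln (1 + (fst (c x))\<^sup>2) \<le> ln (1 + (fst (c a))\<^sup>2) + 4 * B * d" by linarith
  qed
  moreover have "bounded (c ` {b<..a})" if a: "b < a" "a < b + d" and sel: "selection mult {b<..a} c" for a c
  proof (rule bounded[of _ _ "ln (1 + (fst (c a))\<^sup>2) + 4 * B * d"])
    fix x assume x: "x \<in> {b<..a}"
    show "\<bar>x - b\<bar> < d" using x a by auto
    show "0 < mult x (c x)" using x sel by (simp add: selection_def)
    have s: "selection mult {x..a} c" by (rule selection_subset[OF sel]) (use x in auto)
    have "\<bar>ln (1 + (fst (c a))\<^sup>2) - ln (1 + (fst (c x))\<^sup>2)\<bar> \<le> 4 * B * (a - x)"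
    proof (rule selection_growth[OF s _ B])
      fix t l m assume t: "t \<in> {x..a}" and "0 < mult t (l, m)"
      moreover have "\<bar>t - b\<bar> < d" using t x a by auto
      ultimately show "\<bar>m\<bar> \<le> B * (1 + \<bar>l\<bar>)" using bnd by blast
    qed (use x in simp)
    also have "\<dots> \<le> 4 * B * d" using x a B by (intro mult_left_mono) auto
    finally show "ln (1 + (fst (c x))\<^sup>2) \<le> ln (1 + (fst (c a))\<^sup>2) + 4 * B * d" by linarith
  qed
  ultimately show "\<exists>d>0. \<forall>a c. (b - d < a \<and> a < b \<and> selection mult {a..<b} c \<longrightarrow> bounded (c ` {a..<b})) \<and>
        (b < a \<and> a < b + d \<and> selection mult {b<..a} c \<longrightarrow> bounded (c ` {b<..a}))"
    using d by (intro exI[of _ d] conjI allI impI) simp_all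
qed

lemma C1_eigenvalues:
  "\<exists>(N::enat) lam. (\<forall>i. enat i < N \<longrightarrow> lam i C1_differentiable_on UNIV) \<and>
    parameterizes_eigenvalues {i. enat i < N} lam V A"
proof -
  obtain N :: enat and c where cont: "\<forall>i. enat i < N \<longrightarrow> continuous_on UNIV (c i)"
    and cnt: "\<forall>t q. finite {i. enat i < N \<and> c i t = q} \<and> card {i. enat i < N \<and> c i t = q} = mult t q"
    using continuous_multiset_parametrization[OF continuous_multiset_mult non_escaping_mult] by (elim exE conjE)
  define lam where "lam i t = fst (c i t)" for i t
  have pos: "0 < mult t (c i t)" if "enat i < N" for i t
  proof -
    have "{j. enat j < N \<and> c j t = c i t} \<noteq> {}" using that by blast
    then have "0 < card {j. enat j < N \<and> c j t = c i t}"
      using cnt[rule_format, of t "c i t", THEN conjunct1] by (simp only: card_gt_0_iff simp_thms)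
    then show ?thesis using cnt[rule_format, of t "c i t", THEN conjunct2] by (simp only:)
  qed
  have C1: "lam i C1_differentiable_on UNIV" if i: "enat i < N" for i
    unfolding C1_differentiable_on_def
  proof (intro exI conjI ballI)
    have ci: "continuous_on UNIV (c i)" using cont i by blast
    then have "selection mult UNIV (c i)" using pos[OF i] by (simp add: selection_def)
    from selection_derivative[OF this open_UNIV UNIV_I]
    show "(lam i has_vector_derivative snd (c i t)) (at t)" for t
      by (simp add: lam_def[abs_def] has_real_derivative_iff_has_vector_derivative)
    show "continuous_on UNIV (\<lambda>t. snd (c i t))" using ci by (rule continuous_on_snd)
  qed
  have "parameterizes_eigenvalues {i. enat i < N} lam V A"
    unfolding parameterizes_eigenvalues_def
  proof (intro allI)
    fix t z
    obtain B where B: "finite B" "orthonormal B" "complex_vector.span B = eig t z" "complex_vector.dim (eig t z) = card B"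
      using eig_fin_dim by (rule fin_dimE)
    define M where "M = {m. 0 < mult t (z, m)}"
    define J where "J m = {i. enat i < N \<and> c i t = (z, m)}" for m
    have J: "finite (J m)" "card (J m) = mult t (z, m)" for m
      unfolding J_def using cnt[rule_format, of t "(z, m)"] by blast+
    have finM: "finite M" unfolding M_def by (rule finite_derivatives)
    have eq: "{i \<in> {i. enat i < N}. lam i t = z} = (\<Union>m\<in>M. J m)"
    proof (intro equalityI subsetI)
      fix i assume "i \<in> {i \<in> {i. enat i < N}. lam i t = z}"
      then have i: "enat i < N" "fst (c i t) = z" by (auto simp: lam_def)
      then have c: "c i t = (z, snd (c i t))" by (simp add: prod_eq_iff)
      have "0 < mult t (z, snd (c i t))" using pos[OF i(1), of t] by (simp only: c[symmetric])
      then have "snd (c i t) \<in> M" by (simp add: M_def)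
      moreover have "i \<in> J (snd (c i t))" unfolding J_def using i(1) c by blast
      ultimately show "i \<in> (\<Union>m\<in>M. J m)" by blast
    qed (auto simp: J_def lam_def)
    have "card (\<Union>m\<in>M. J m) = (\<Sum>m\<in>M. card (J m))"
      by (rule card_UN_disjoint[OF finM]) (use J in \<open>auto simp: J_def\<close>)
    also have "\<dots> = card B" unfolding B(4)[symmetric] J(2) M_def by (rule sum_derivatives)
    finally have "{i \<in> {i. enat i < N}. lam i t = z} \<approx> B"
      unfolding eq using finM J(1) B(1) by (subst eqpoll_iff_card) auto
    then show "\<exists>B. complex_vector.independent B \<and> complex_vector.span B = eig t z \<and>
        {i \<in> {i. enat i < N}. lam i t = z} \<approx> B"
      using orthonormal_independent[OF B(2)] B(3) by (intro exI[of _ B] conjI)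
  qed
  then show ?thesis using C1 by (intro exI[of _ N] exI[of _ lam]) simp
qed

end

theorem mainTheorem2:
  fixes A :: "real \<Rightarrow> 'h::complex_hilbert_space \<Rightarrow> 'h"
    and V :: "'h set"
    and \<alpha> :: real
  assumes "\<alpha> > 0"
    and "\<And>t. selfadjoint_op V (A t)"
    and "C_holder_curve 1 \<alpha> V A"
    and "\<And>t. compact_resolvent V (A t)"
  shows "\<exists>(N::enat) (lam :: nat \<Rightarrow> real \<Rightarrow> real).
    (\<forall>i. enat i < N \<longrightarrow> lam i C1_differentiable_on UNIV) \<and>
    parameterizes_eigenvalues {i. enat i < N} lam V A"
  by (rule selfadjoint_curve.C1_eigenvalues[OF selfadjoint_curve_of_C1_holder[OF assms]])

end
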